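(* Let $X$ be a P-complex in $V$ with compact cells, $S$ a supercommutative ring, and $v\in\mathcal{U}(X)$ a convenient point. Let $r_p\in C^p(X,S)$ and $r_q\in C^q(X,S)$ be closed ($dr_p=0$, $dr_q=0$). Then: (1) the cochain $r_p\smile_v r_q$ is closed; (2) if $r_p=dr_{p-1}$ with $r_{p-1}\in C^{p-1}(X,S)$, then $r_p\smile_v r_q=d(r_{p-1}\smile_v r_q)$.
   Context: $V$ is a real vector space of finite dimension $n$, $V^*$ its dual. P-complex: a finite set $X$ of closed convex polyhedra in $V$ (its cells) such that every face of a cell is a cell and every non-empty intersection of two cells is a common face of both. All cells are assumed compact. Cochains: $S$ is a supercommutative ring ($\mathbb{Z}/2$-graded, $ab=(-1)^{|a||b|}ba$ for homogeneous $a,b$). $C^p(X,S)$ is the module of functions from oriented $p$-dimensional cells to $S$ that change sign when the orientation of the cell is reversed; $d\colon C^p(X,S)\to C^{p+1}(X,S)$ is the usual coboundary: $(dr)(\mu)$ is the sum of $r$ over the facets of $\mu$ with induced boundary orientation (outward normal first). For a cell $\delta$, $V_\delta\subset V$ is the linear subspace generated by differences of points of $\delta$. For a cell $\gamma$, let $X_\gamma$ be the P-complex in $V_\gamma$ of faces of $\gamma$ ($\gamma$ translated into $V_\gamma$; the choice is immaterial). For a face $\delta$ of $\gamma$ the dual cone $\delta^*\subset (V_\gamma)^*$ consists of all $w\in(V_\gamma)^*$ for which the maximum of $w$ on $\gamma$ is attained at every point of $\delta$; $\dim\delta^*=\dim\gamma-\dim\delta$. These cones form the dual fan $X_\gamma^*$,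 with $j$-dimensional skeleton $(X_\gamma^* )^j$. Let $\pi_\gamma\colon V^*\to(V_\gamma)^*$ be the restriction map. Two P-complexes in a space are transversal if for any cells $\delta_1,\delta_2$ of them with $\delta_1\cap\delta_2\ne\emptyset$ one has $\operatorname{codim}(V_{\delta_1}\cap V_{\delta_2})=\operatorname{codim}V_{\delta_1}+\operatorname{codim}V_{\delta_2}$. A point $v\in V^*$ is $(p,q)$-convenient if $\pi_\gamma(v)+(X_\gamma^* )^q$ and $(X_\gamma^* )^p$ are transversal for every $\gamma\in X$ with $\dim\gamma=p+q$; $\mathcal{U}_{p,q}(X)$ is the set of such points, and $\mathcal{U}(X)=\bigcap_{p,q}\mathcal{U}_{p,q}(X)$ is the set of convenient points. Product: for $v\in\mathcal{U}_{p,q}(X)$ and an oriented cell $\gamma$ of dimension $p+q$, $(r_p\smile_v r_q)(\gamma)=\sum_{(\delta,\lambda)\in\mathcal{P}(p,q,\gamma,v)}r_p(\delta)r_q(\lambda)$, where $\mathcal{P}(p,q,\gamma,v)$ is the set of pairs $(\delta,\lambda)$ of faces of $\gamma$ of dimensions $p,q$ with $(\pi_\gamma(v)+\delta^* )\cap\lambda^*\neq\emptyset$, oriented so that $V_\gamma=V_\delta\oplus V_\lambda$ as oriented spaces. *)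

theory Defs
  imports
    "Jordan_Normal_Form.Determinant"
    "HOL-Library.Function_Algebras"
    "HOL-Library.Z2"
    "HOL-Analysis.Analysis"
begin

(* Linear functionals are plain functions, so the pointwise vector space structure is needed. *)

instantiation "fun" :: (type, real_vector) real_vector
begin

definition scaleR_fun :: "real \<Rightarrow> ('a \<Rightarrow> 'b) \<Rightarrow> 'a \<Rightarrow> 'b"
  where "scaleR_fun c f = (\<lambda>x. c *\<^sub>R f x)"

instance
  by standard (auto simp: scaleR_fun_def fun_eq_iff scaleR_add_right scaleR_add_left)

end


subsection \<open>Polyhedral complexes\<close>

definition direction :: "'a::real_vector set \<Rightarrow> 'a set"
  where "direction C = span {x - y | x y. x \<in> C \<and> y \<in> C}"

(* The empty set is a face in the sense of face_of, but never a cell.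
   The space V is a linear subspace of the ambient Euclidean space, which allows dim V = 0;
   the inner product of the ambient space only enters through the library notion of polyhedron. *)

definition p_complex :: "'a::euclidean_space set \<Rightarrow> 'a set set \<Rightarrow> bool"
  where "p_complex V X \<longleftrightarrow>
    finite X \<and>
    (\<forall>\<gamma>\<in>X. polyhedron \<gamma> \<and> \<gamma> \<noteq> {} \<and> \<gamma> \<subseteq> V) \<and>
    (\<forall>\<gamma>\<in>X. \<forall>\<delta>. \<delta> face_of \<gamma> \<and> \<delta> \<noteq> {} \<longrightarrow> \<delta> \<in> X) \<and>
    (\<forall>\<gamma>\<in>X. \<forall>\<delta>\<in>X. \<gamma> \<inter> \<delta> \<noteq> {} \<longrightarrow> \<gamma> \<inter> \<delta> face_of \<gamma> \<and> \<gamma> \<inter> \<delta> face_of \<delta>)"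


subsection \<open>Orientations\<close>

definition ordered_basis :: "'a::real_vector set \<Rightarrow> 'a list \<Rightarrow> bool"
  where "ordered_basis W bs \<longleftrightarrow> distinct bs \<and> independent (set bs) \<and> span (set bs) = W"

definition transition_det :: "'a::real_vector list \<Rightarrow> 'a list \<Rightarrow> real"
  where "transition_det bs cs =
    Determinant.det (Matrix.mat (length bs) (length bs)
      (\<lambda>(i, j). representation (set bs) (cs ! j) (bs ! i)))"

(* An orientation marks every ordered basis as positive (1) or negative (-1), compatibly with
   changes of basis, and is 0 on lists that are not bases. In this way a zero-dimensional space,
   whose only basis is the empty list, also has two orientations. The reversed orientation is
   the pointwise negative. *)

type_synonym 'a orientation = "'a list \<Rightarrow> real"

definition is_orientation :: "'a::real_vector set \<Rightarrow> 'a orientation \<Rightarrow> bool"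
  where "is_orientation W \<omega> \<longleftrightarrow>
    (\<forall>bs. ordered_basis W bs \<longrightarrow> \<omega> bs \<in> {1, -1}) \<and>
    (\<forall>bs. \<not> ordered_basis W bs \<longrightarrow> \<omega> bs = 0) \<and>
    (\<forall>bs cs. ordered_basis W bs \<and> ordered_basis W cs \<longrightarrow>
       \<omega> cs = sgn (transition_det bs cs) * \<omega> bs)"

(* Says that the oriented space (W, \<omega>) is the direct sum of (W1, \<alpha>) and (W2, \<beta>), in this order. *)

definition oriented_direct_sum ::
    "'a::real_vector set \<Rightarrow> 'a orientation \<Rightarrow> 'a set \<Rightarrow> 'a orientation \<Rightarrow>
     'a set \<Rightarrow> 'a orientation \<Rightarrow> bool"
  where "oriented_direct_sum W \<omega> W1 \<alpha> W2 \<beta> \<longleftrightarrow>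
    is_orientation W \<omega> \<and> is_orientation W1 \<alpha> \<and> is_orientation W2 \<beta> \<and>
    (\<forall>bs cs. ordered_basis W1 bs \<and> ordered_basis W2 cs \<longrightarrow>
       ordered_basis W (bs @ cs) \<and> \<omega> (bs @ cs) = \<alpha> bs * \<beta> cs)"

(* V carries no inner product, so an outward normal of \<mu> at the facet \<delta> is any vector of the form
   x - y with x in \<delta> and y in \<mu> outside \<delta>; the orientation does not depend on the choice. *)

definition boundary_orientation ::
    "'a::real_vector set \<Rightarrow> 'a orientation \<Rightarrow> 'a set \<Rightarrow> 'a orientation"
  where "boundary_orientation \<mu> \<omega> \<delta> =
    (let n = (SOME n. \<exists>x\<in>\<delta>. \<exists>y\<in>\<mu> - \<delta>. n = x - y)
     in (\<lambda>bs. if ordered_basis (direction \<delta>) bs then \<omega> (n # bs) else 0))"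


subsection \<open>Cochains\<close>

(* The ring is the whole type 'r and S i is its part of parity i. *)

definition supercommutative :: "(bit \<Rightarrow> 'r::ring set) \<Rightarrow> bool"
  where "supercommutative S \<longleftrightarrow>
    (\<forall>i. 0 \<in> S i \<and> (\<forall>a\<in>S i. \<forall>b\<in>S i. a - b \<in> S i)) \<and>
    (\<forall>a. \<exists>!(a0, a1). a0 \<in> S 0 \<and> a1 \<in> S 1 \<and> a = a0 + a1) \<and>
    (\<forall>i j. \<forall>a\<in>S i. \<forall>b\<in>S j. a * b \<in> S (i + j)) \<and>
    (\<forall>i j. \<forall>a\<in>S i. \<forall>b\<in>S j. a * b = (if i = 1 \<and> j = 1 then - (b * a) else b * a))"

definition oriented_cell :: "'a::euclidean_space set set \<Rightarrow> int \<Rightarrow> 'a set \<Rightarrow> 'a orientation \<Rightarrow> bool"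
  where "oriented_cell X p \<gamma> \<omega> \<longleftrightarrow>
    \<gamma> \<in> X \<and> aff_dim \<gamma> = p \<and> is_orientation (direction \<gamma>) \<omega>"

(* Cochains are extended by 0 outside the oriented p-cells, so that equality of cochains is
   equality of functions. Degrees are integers; there are no cells of negative dimension,
   so only the zero cochain has negative degree. *)

type_synonym ('a, 'r) cochain = "'a set \<Rightarrow> 'a orientation \<Rightarrow> 'r"

definition cochains :: "'a::euclidean_space set set \<Rightarrow> int \<Rightarrow> ('a, 'r::ring) cochain set"
  where "cochains X p = {r.
    (\<forall>\<gamma> \<omega>. \<not> oriented_cell X p \<gamma> \<omega> \<longrightarrow> r \<gamma> \<omega> = 0) \<and>
    (\<forall>\<gamma> \<omega>. oriented_cell X p \<gamma> \<omega> \<longrightarrow> r \<gamma> (- \<omega>) = - r \<gamma> \<omega>)}"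

definition coboundary :: "'a::euclidean_space set set \<Rightarrow> ('a, 'r::ring) cochain \<Rightarrow> ('a, 'r) cochain"
  where "coboundary X r = (\<lambda>\<mu> \<omega>.
    if oriented_cell X (aff_dim \<mu>) \<mu> \<omega>
    then \<Sum>\<delta> | \<delta> facet_of \<mu>. r \<delta> (boundary_orientation \<mu> \<omega> \<delta>)
    else 0)"

definition closed_cochains :: "'a::euclidean_space set set \<Rightarrow> int \<Rightarrow> ('a, 'r::ring) cochain set"
  where "closed_cochains X p = {r \<in> cochains X p. coboundary X r = 0}"


subsection \<open>Dual fans and convenient points\<close>

(* A functional on the subspace W is represented by its extension by 0 outside W. *)

definition dual_space :: "'a::real_vector set \<Rightarrow> ('a \<Rightarrow> real) set"
  where "dual_space W = {w.
    (\<forall>x\<in>W. \<forall>y\<in>W. w (x + y) = w x + w y) \<and>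
    (\<forall>c. \<forall>x\<in>W. w (c *\<^sub>R x) = c * w x) \<and>
    (\<forall>x. x \<notin> W \<longrightarrow> w x = 0)}"

definition restrict_functional :: "'a set \<Rightarrow> ('a \<Rightarrow> real) \<Rightarrow> 'a \<Rightarrow> real"
  where "restrict_functional W w = (\<lambda>x. if x \<in> W then w x else 0)"

(* The point a translates \<gamma> into its direction space. *)

definition dual_cone :: "'a::real_vector set \<Rightarrow> 'a set \<Rightarrow> ('a \<Rightarrow> real) set"
  where "dual_cone \<gamma> \<delta> =
    {w \<in> dual_space (direction \<gamma>). \<forall>a\<in>\<gamma>. \<forall>x\<in>\<delta>. \<forall>y\<in>\<gamma>. w (y - a) \<le> w (x - a)}"

definition dual_fan :: "'a::real_vector set \<Rightarrow> ('a \<Rightarrow> real) set set"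
  where "dual_fan \<gamma> = {dual_cone \<gamma> \<delta> | \<delta>. \<delta> face_of \<gamma> \<and> \<delta> \<noteq> {}}"

definition skeleton :: "int \<Rightarrow> 'b::real_vector set set \<Rightarrow> 'b set set"
  where "skeleton j F = {C \<in> F. int (dim (direction C)) \<le> j}"

definition codim :: "'b::real_vector set \<Rightarrow> 'b set \<Rightarrow> int"
  where "codim E W = int (dim E) - int (dim W)"

definition transversal :: "'b::real_vector set \<Rightarrow> 'b set set \<Rightarrow> 'b set set \<Rightarrow> bool"
  where "transversal E F G \<longleftrightarrow> (\<forall>C\<in>F. \<forall>D\<in>G. C \<inter> D \<noteq> {} \<longrightarrow>
    codim E (direction C \<inter> direction D) = codim E (direction C) + codim E (direction D))"

definition translate :: "'b::ab_group_add \<Rightarrow> 'b set \<Rightarrow> 'b set"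
  where "translate w C = (\<lambda>u. w + u) ` C"

definition convenient_pq ::
    "'a::euclidean_space set \<Rightarrow> 'a set set \<Rightarrow> int \<Rightarrow> int \<Rightarrow> ('a \<Rightarrow> real) set"
  where "convenient_pq V X p q = {v \<in> dual_space V. \<forall>\<gamma>\<in>X. aff_dim \<gamma> = p + q \<longrightarrow>
    transversal (dual_space (direction \<gamma>))
      (translate (restrict_functional (direction \<gamma>) v) ` skeleton q (dual_fan \<gamma>))
      (skeleton p (dual_fan \<gamma>))}"

definition convenient :: "'a::euclidean_space set \<Rightarrow> 'a set set \<Rightarrow> ('a \<Rightarrow> real) set"
  where "convenient V X = (\<Inter>p. \<Inter>q. convenient_pq V X p q)"


subsection \<open>The product\<close>

definition product_pairs ::
    "int \<Rightarrow> int \<Rightarrow> 'a::euclidean_space set \<Rightarrow> ('a \<Rightarrow> real) \<Rightarrow> ('a set \<times> 'a set) set"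
  where "product_pairs p q \<gamma> v = {(\<delta>, \<kappa>).
    \<delta> face_of \<gamma> \<and> \<delta> \<noteq> {} \<and> aff_dim \<delta> = p \<and>
    \<kappa> face_of \<gamma> \<and> \<kappa> \<noteq> {} \<and> aff_dim \<kappa> = q \<and>
    translate (restrict_functional (direction \<gamma>) v) (dual_cone \<gamma> \<delta>) \<inter> dual_cone \<gamma> \<kappa> \<noteq> {}}"

(* For convenient v the spaces of \<delta> and \<kappa> are complementary, so there are exactly two choices of
   (\<alpha>, \<beta>); they differ by a simultaneous sign, which does not affect the product. *)

definition cup_product ::
    "'a::euclidean_space set set \<Rightarrow> ('a \<Rightarrow> real) \<Rightarrow> int \<Rightarrow> int \<Rightarrow>
     ('a, 'r::ring) cochain \<Rightarrow> ('a, 'r) cochain \<Rightarrow> ('a, 'r) cochain"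
  where "cup_product X v p q r s = (\<lambda>\<gamma> \<omega>.
    if oriented_cell X (p + q) \<gamma> \<omega>
    then \<Sum>(\<delta>, \<kappa>)\<in>product_pairs p q \<gamma> v.
           (let (\<alpha>, \<beta>) = (SOME (\<alpha>, \<beta>).
                  oriented_direct_sum (direction \<gamma>) \<omega> (direction \<delta>) \<alpha> (direction \<kappa>) \<beta>)
            in r \<delta> \<alpha> * s \<kappa> \<beta>)
    else 0)"

end

theory Submission
  imports Defs
begin

text \<open>
  Both claims follow from the Leibniz rule
  \<open>d (r \<smile> s) = dr \<smile> s \<plusminus> r \<smile> ds\<close>, which is proved cell by cell (theorem \<open>leibniz\<close>).

  Represent \<open>v\<close> by a vector. For a functional \<open>a\<close> on the direction space of \<open>\<gamma>\<close> let \<open>amax \<gamma> a\<close> be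
  the face of \<open>\<gamma>\<close> on which \<open>a\<close> is maximal. A pair of faces \<open>\<delta>\<close>, \<open>\<kappa>\<close> occurs in the product on \<open>\<gamma>\<close>
  if and only if it is linked: some \<open>a\<close> satisfies \<open>\<delta> \<subseteq> amax \<gamma> a\<close> and \<open>\<kappa> \<subseteq> amax \<gamma> (a + v)\<close>.
  Convenience speaks only about skeleta of complementary dimensions, but it reaches all linked
  pairs: the set of all \<open>a\<close> that link a given pair is a convex polyhedron without lines, and at
  one of its vertices the spans of the two dual cones meet in \<open>0\<close>, so that transversality applies
  and makes them complementary. Hence the directions of linked faces always meet in \<open>0\<close> only
  (lemma \<open>convenient_imp_generic\<close>).

  Now let \<open>\<gamma>\<close> have dimension \<open>p + q + 1\<close> and let \<open>\<delta>\<close>, \<open>\<kappa>\<close> be linked faces of dimensions \<open>p\<close>, \<open>q\<close>.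
  The functionals that link them form a segment or a ray on a line with direction \<open>m\<close>. An end at a
  finite distance is a functional where exactly one of the two faces grows by one dimension. Such
  an end is a pair \<open>(\<delta>', \<kappa>)\<close> with \<open>\<delta>\<close> a facet of \<open>\<delta>'\<close>, that is, a term of \<open>dr \<smile> s\<close>, or a pair
  \<open>(\<delta>, \<kappa>')\<close> with \<open>\<kappa>\<close> a facet of \<open>\<kappa>'\<close>, a term of \<open>r \<smile> ds\<close>. An end at infinity is a facet of \<open>\<gamma>\<close>
  that contains both faces, a term of \<open>d (r \<smile> s)\<close>. Each of the two directions \<open>m\<close> and \<open>- m\<close> has
  exactly one end (lemma \<open>unique_end\<close>). All these terms are equal up to sign, and the sign is that
  of the scalar product of \<open>m\<close> with the outward normal of the facet involved. At the end in the
  direction \<open>m\<close> it is positive for a term of \<open>d (r \<smile> s)\<close> and negative for the others, which stand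
  on the opposite side of the equation; at the other end the signs are reversed. So the two ends
  cancel (lemma \<open>pair_cancellation\<close>), and summing over all pairs gives the Leibniz rule.
\<close>

(* From here on the dot is the inner product of the ambient space. *)
no_notation Matrix.scalar_prod (infix \<open>\<bullet>\<close> 70)

section \<open>Ordered bases of direct sums\<close>

lemma dim_direct_sum_le:
  fixes A B C :: "'a::euclidean_space set"
  assumes "subspace A" "subspace B" "subspace C" "A \<inter> B = {0}" "A \<subseteq> C" "B \<subseteq> C"
  shows "dim A + dim B \<le> dim C"
proof -
  have "{x + y |x y. x \<in> A \<and> y \<in> B} \<subseteq> C"
    using assms(3,5,6) by (auto intro: subspace_add)
  then have "dim {x + y |x y. x \<in> A \<and> y \<in> B} \<le> dim C" by (rule dim_subset)
  then show ?thesis using dim_sums_Int[OF assms(1,2)] assms(4) by simp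
qed

lemma direct_sum_eq:
  fixes A B C :: "'a::euclidean_space set"
  assumes "subspace A" "subspace B" "subspace C" "A \<inter> B = {0}" "A \<subseteq> C" "B \<subseteq> C"
    and "dim A + dim B = dim C"
  shows "C = {x + y |x y. x \<in> A \<and> y \<in> B}"
proof -
  have "{x + y |x y. x \<in> A \<and> y \<in> B} \<subseteq> C"
    using assms(3,5,6) by (auto intro: subspace_add)
  then have "{x + y |x y. x \<in> A \<and> y \<in> B} = C"
    using dim_sums_Int[OF assms(1,2)] assms by (intro subspace_dim_equal subspace_sums) auto
  then show ?thesis by simp
qed

lemma ordered_basis_iff:
  fixes W :: "'a::euclidean_space set"
  shows "ordered_basis W bs \<longleftrightarrow> span (set bs) = W \<and> length bs = dim W"
proof
  assume "ordered_basis W bs"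
  then have "distinct bs" "independent (set bs)" "span (set bs) = W"
    by (auto simp: ordered_basis_def)
  then show "span (set bs) = W \<and> length bs = dim W"
    using dim_eq_card_independent[of "set bs"] distinct_card[of bs] dim_span[of "set bs"] by simp
next
  assume *: "span (set bs) = W \<and> length bs = dim W"
  then have dW: "dim W = dim (set bs)" by (metis dim_span)
  have "dim (set bs) \<le> card (set bs)" by (simp add: dim_le_card')
  moreover have "card (set bs) \<le> length bs" by (rule card_length)
  ultimately have c: "card (set bs) = length bs" "card (set bs) = dim (set bs)"
    using * dW by simp_all
  then have "independent (set bs)"
    by (intro card_le_dim_spanning[of "set bs" "set bs"]) (auto simp: span_superset)
  then show "ordered_basis W bs"
    using c * by (simp add: ordered_basis_def card_distinct)
qed

lemma ordered_basis_exists: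
  fixes W :: "'a::euclidean_space set"
  assumes "subspace W"
  obtains bs where "ordered_basis W bs"
proof -
  obtain B where B: "B \<subseteq> W" "independent B" "W \<subseteq> span B" "card B = dim W"
    using basis_exists[of W] by metis
  then have "finite B" by (simp add: finiteI_independent)
  then obtain bs where bs: "set bs = B" "distinct bs" using finite_distinct_list by metis
  have "span B = W" using B assms by (metis span_subspace)
  then have "ordered_basis W bs" using bs B by (simp add: ordered_basis_def)
  then show ?thesis by (rule that)
qed

lemma ordered_basis_append:
  fixes W1 W2 :: "'a::euclidean_space set"
  assumes b: "ordered_basis W1 bs" and c: "ordered_basis W2 cs"
    and W: "subspace W" "W1 \<inter> W2 = {0}" "W1 \<subseteq> W" "W2 \<subseteq> W" "dim W1 + dim W2 = dim W"
  shows "ordered_basis W (bs @ cs)"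
proof -
  have sp: "span (set bs) = W1" "span (set cs) = W2"
    using b c by (simp_all add: ordered_basis_def)
  then have s: "subspace W1" "subspace W2" by (auto intro: subspace_span)
  have "W = {x + y |x y. x \<in> W1 \<and> y \<in> W2}"
    by (rule direct_sum_eq[OF s W])
  moreover have "span (set (bs @ cs)) = {x + y |x y. x \<in> W1 \<and> y \<in> W2}"
    using sp by (simp add: span_Un)
  ultimately have "span (set (bs @ cs)) = W" by simp
  then show ?thesis using b c W by (simp add: ordered_basis_iff)
qed

lemma ordered_basis_Cons:
  fixes H :: "'a::euclidean_space set"
  assumes "ordered_basis H bs" "subspace W" "H \<subseteq> W" "n \<in> W" "n \<notin> H" "dim W = dim H + 1"
  shows "ordered_basis W (n # bs)"
proof -
  have sp: "span (set bs) = H" and i: "independent (set bs)" and d: "distinct bs"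
    using assms by (auto simp: ordered_basis_def)
  have i': "independent (set (n # bs))"
    using i assms(5) sp by (simp add: independent_insertI)
  have "n \<notin> set bs" using sp assms(5) span_base by auto
  then have d': "distinct (n # bs)" using d by simp
  have "set (n # bs) \<subseteq> W"
    using sp assms(3,4) span_superset[of "set bs"] by auto
  moreover have "card (set (n # bs)) = dim W"
    using assms(1,6) distinct_card[OF d'] by (simp add: ordered_basis_iff)
  ultimately have "span (set (n # bs)) = W"
    using card_eq_dim[of "set (n # bs)" W] i' assms(2)
    by (metis List.finite_set span_subspace)
  then show ?thesis using i' d' by (simp add: ordered_basis_def)
qed

section \<open>Determinants of changes of basis\<close>

lemma representation_nth:
  assumes "ordered_basis W bs" "j < length bs"
  shows "representation (set bs) (bs ! j) = (\<lambda>b. if b = bs ! j then 1 else 0)"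
  using assms by (simp add: ordered_basis_def representation_basis)

text \<open>
  The matrix is block diagonal, with an identity block for the vectors of \<open>cs\<close>, which do not
  change.
\<close>

lemma transition_det_suffix:
  fixes W :: "'a::euclidean_space set"
  assumes L: "ordered_basis W (bs @ cs)" and L': "ordered_basis W (bs' @ cs)"
    and sp: "span (set bs) = span (set bs')"
  shows "transition_det (bs @ cs) (bs' @ cs) = transition_det bs bs'"
proof -
  have len: "length bs' = length bs" using L L' by (simp add: ordered_basis_iff)
  let ?p = "length bs" and ?q = "length cs"
  define f where "f = (\<lambda>i j. representation (set (bs @ cs)) ((bs' @ cs) ! j) ((bs @ cs) ! i))"
  define g where "g = (\<lambda>i j. representation (set bs) (bs' ! j) (bs ! i))"
  have ind: "independent (set (bs @ cs))" and dist: "distinct (bs @ cs)"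
    using L by (simp_all add: ordered_basis_def)
  have up: "representation (set (bs @ cs)) (bs' ! j) = representation (set bs) (bs' ! j)"
    if "j < ?p" for j
  proof (rule representation_extend[OF ind])
    show "bs' ! j \<in> span (set bs)" unfolding sp using that len by (intro span_base nth_mem) simp
  qed simp
  have z: "representation (set bs) w (cs ! i) = 0" if "i < ?q" for w i
    using representation_ne_zero[of "set bs" w "cs ! i"] dist nth_mem[OF that] by auto
  have e1: "f i j = g i j" if "i < ?p" "j < ?p" for i j
    using that len up[of j] by (simp add: f_def g_def nth_append)
  have e2: "f i j = 0" if "\<not> i < ?p" "i < ?p + ?q" "j < ?p" for i j
    using that len up[of j] z[of "i - ?p"] by (simp add: f_def nth_append)
  have e3: "f i j = (if i = j then 1 else 0)" if "i < ?p + ?q" "\<not> j < ?p" "j < ?p + ?q" for i j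
  proof -
    have "(bs' @ cs) ! j = (bs @ cs) ! j" using that len by (simp add: nth_append)
    then have "f i j = (if (bs @ cs) ! i = (bs @ cs) ! j then 1 else 0)"
      unfolding f_def using representation_nth[OF L, of j] that by simp
    then show ?thesis using dist that nth_eq_iff_index_eq[OF dist, of i j] by simp
  qed
  have "Matrix.mat (?p + ?q) (?p + ?q) (\<lambda>(i,j). f i j) =
    four_block_mat (Matrix.mat ?p ?p (\<lambda>(i, j). g i j)) (0\<^sub>m ?p ?q) (0\<^sub>m ?q ?p) (1\<^sub>m ?q)"
  proof (rule eq_matI, goal_cases)
    case prems: (1 i j)
    then have ij: "i < ?p + ?q" "j < ?p + ?q" by simp_all
    show ?case
      using ij e1[of i j] e2[of i j] e3[of i j]
      by (cases "i < ?p"; cases "j < ?p") auto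
  qed simp_all
  then show ?thesis
    unfolding transition_det_def
    by (simp add: len f_def[symmetric] g_def[symmetric]
          det_four_block_mat_upper_right_zero[of _ ?p _ ?q] del: set_append)
qed

lemma transition_det_prefix:
  fixes W :: "'a::euclidean_space set"
  assumes L: "ordered_basis W (cs @ bs)" and L': "ordered_basis W (cs @ bs')"
    and sp: "span (set bs) = span (set bs')"
  shows "transition_det (cs @ bs) (cs @ bs') = transition_det bs bs'"
proof -
  have len: "length bs' = length bs" using L L' by (simp add: ordered_basis_iff)
  let ?p = "length bs" and ?q = "length cs"
  define f where "f = (\<lambda>i j. representation (set (cs @ bs)) ((cs @ bs') ! j) ((cs @ bs) ! i))"
  define g where "g = (\<lambda>i j. representation (set bs) (bs' ! j) (bs ! i))"
  have ind: "independent (set (cs @ bs))" and dist: "distinct (cs @ bs)"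
    using L by (simp_all add: ordered_basis_def)
  have up: "representation (set (cs @ bs)) (bs' ! j) = representation (set bs) (bs' ! j)"
    if "j < ?p" for j
  proof (rule representation_extend[OF ind])
    show "bs' ! j \<in> span (set bs)" unfolding sp using that len by (intro span_base nth_mem) simp
  qed simp
  have z: "representation (set bs) w (cs ! i) = 0" if "i < ?q" for w i
    using representation_ne_zero[of "set bs" w "cs ! i"] dist nth_mem[OF that] by auto
  have e1: "f i j = g (i - ?q) (j - ?q)" if "\<not> i < ?q" "\<not> j < ?q" "j < ?q + ?p" for i j
    using that len up[of "j - ?q"] by (simp add: f_def g_def nth_append)
  have e2: "f i j = 0" if "i < ?q" "\<not> j < ?q" "j < ?q + ?p" for i j
    using that len up[of "j - ?q"] z[of i] by (simp add: f_def nth_append)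
  have e3: "f i j = (if i = j then 1 else 0)" if "i < ?q + ?p" "j < ?q" for i j
  proof -
    have "(cs @ bs') ! j = (cs @ bs) ! j" using that len by (simp add: nth_append)
    then have "f i j = (if (cs @ bs) ! i = (cs @ bs) ! j then 1 else 0)"
      unfolding f_def using representation_nth[OF L, of j] that by simp
    then show ?thesis using dist that nth_eq_iff_index_eq[OF dist, of i j] by simp
  qed
  have "Matrix.mat (?q + ?p) (?q + ?p) (\<lambda>(i,j). f i j) =
    four_block_mat (1\<^sub>m ?q) (0\<^sub>m ?q ?p) (0\<^sub>m ?p ?q) (Matrix.mat ?p ?p (\<lambda>(i, j). g i j))"
  proof (rule eq_matI, goal_cases)
    case prems: (1 i j)
    then have ij: "i < ?q + ?p" "j < ?q + ?p" by simp_all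
    show ?case
      using ij e1[of i j] e2[of i j] e3[of i j]
      by (cases "i < ?q"; cases "j < ?q") auto
  qed simp_all
  then show ?thesis
    unfolding transition_det_def
    by (simp add: len f_def[symmetric] g_def[symmetric]
          det_four_block_mat_upper_right_zero[of _ ?q _ ?p] del: set_append)
qed

text \<open>
  The matrix is lower triangular, and its only diagonal entry other than \<open>1\<close> is the coordinate of
  \<open>x\<close> along \<open>m\<close>. Since \<open>m\<close> is orthogonal to the other basis vectors, that coordinate is
  \<open>(m \<bullet> x) / (m \<bullet> m)\<close>.
\<close>

lemma transition_det_Cons:
  fixes W :: "'a::euclidean_space set"
  assumes L: "ordered_basis W (m # bs)" and x: "x \<in> W"
    and m: "\<And>b. b \<in> set bs \<Longrightarrow> inner m b = 0"
  shows "inner m m * transition_det (m # bs) (x # bs) = inner m x"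
proof -
  let ?B = "set (m # bs)" and ?n = "length (m # bs)"
  have ind: "independent ?B" and sp: "span ?B = W" and dist: "distinct (m # bs)"
    using L by (simp_all add: ordered_basis_def)
  define f where "f = (\<lambda>i j. representation ?B ((x # bs) ! j) ((m # bs) ! i))"
  define A where "A = Matrix.mat ?n ?n (\<lambda>(i, j). f i j)"
  have col: "f i j = (if i = j then 1 else 0)" if "i < ?n" "j < ?n" "j \<noteq> 0" for i j
  proof -
    have "(x # bs) ! j = (m # bs) ! j" using that(3) by (simp add: nth_Cons')
    then have "f i j = (if (m # bs) ! i = (m # bs) ! j then 1 else 0)"
      unfolding f_def using representation_nth[OF L that(2)] by simp
    then show ?thesis using that nth_eq_iff_index_eq[OF dist that(1,2)] by simp
  qed
  have "Determinant.det A = prod_list (diag_mat A)"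
  proof (rule det_lower_triangular)
    fix i j assume "i < j" "j < ?n"
    then show "A $$ (i,j) = 0" using col[of i j] by (simp add: A_def)
  qed (simp add: A_def)
  also have "\<dots> = (\<Prod>i=0..<?n. A $$ (i,i))"
    by (simp add: prod_list_diag_prod A_def)
  also have "\<dots> = (\<Prod>i=0..<?n. if i = 0 then f 0 0 else 1)"
    using col by (intro prod.cong) (auto simp: A_def)
  also have "\<dots> = representation ?B x m"
    by (simp add: f_def)
  finally have td: "transition_det (m # bs) (x # bs) = representation ?B x m"
    by (simp add: transition_det_def A_def f_def)
  have "x = (\<Sum>b\<in>?B. representation ?B x b *\<^sub>R b)"
    using sum_representation_eq[OF ind, of x ?B] x sp by simp
  then have "inner m x = inner m (\<Sum>b\<in>?B. representation ?B x b *\<^sub>R b)" by simp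
  also have "\<dots> = (\<Sum>b\<in>?B. representation ?B x b * inner m b)" by (simp add: inner_sum_right)
  also have "\<dots> = representation ?B x m * inner m m"
    using m dist by simp
  finally show ?thesis using td by simp
qed

section \<open>Orientations\<close>

lemma is_orientation_basis:
  assumes "is_orientation W \<omega>" "ordered_basis W bs"
  shows "\<omega> bs = 1 \<or> \<omega> bs = -1"
  using assms unfolding is_orientation_def by blast

text \<open>
  To be used with explicit instances: as a rewrite rule it does not terminate.
\<close>

lemma is_orientation_trans:
  assumes "is_orientation W \<omega>" "ordered_basis W bs" "ordered_basis W cs"
  shows "\<omega> cs = sgn (transition_det bs cs) * \<omega> bs"
  using assms unfolding is_orientation_def by blast

lemma is_orientation_outside:
  assumes "is_orientation W \<omega>" "\<not> ordered_basis W bs"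
  shows "\<omega> bs = 0"
  using assms unfolding is_orientation_def by blast

lemma is_orientationI:
  assumes "\<And>bs. ordered_basis W bs \<Longrightarrow> \<omega> bs = 1 \<or> \<omega> bs = -1"
    and "\<And>bs. \<not> ordered_basis W bs \<Longrightarrow> \<omega> bs = 0"
    and "\<And>bs cs. ordered_basis W bs \<Longrightarrow> ordered_basis W cs \<Longrightarrow>
           \<omega> cs = sgn (transition_det bs cs) * \<omega> bs"
  shows "is_orientation W \<omega>"
  using assms unfolding is_orientation_def by blast

lemma is_orientation_uminus:
  assumes "is_orientation W \<omega>" shows "is_orientation W (- \<omega>)"
proof (rule is_orientationI)
  fix bs assume "ordered_basis W bs"
  from is_orientation_basis[OF assms this]
  show "(- \<omega>) bs = 1 \<or> (- \<omega>) bs = - 1" by auto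
next
  fix bs cs assume "ordered_basis W bs" "ordered_basis W cs"
  from is_orientation_trans[OF assms this]
  show "(- \<omega>) cs = sgn (transition_det bs cs) * (- \<omega>) bs" by simp
qed (simp add: is_orientation_outside[OF assms])

lemma is_orientation_eqI:
  assumes a: "is_orientation W \<alpha>" and b: "is_orientation W \<beta>"
    and bs: "ordered_basis W bs" "\<alpha> bs = \<beta> bs"
  shows "\<alpha> = \<beta>"
proof
  fix cs show "\<alpha> cs = \<beta> cs"
    using is_orientation_trans[OF a bs(1), of cs] is_orientation_trans[OF b bs(1), of cs]
      is_orientation_outside[OF a, of cs] is_orientation_outside[OF b, of cs] bs(2)
    by (cases "ordered_basis W cs") simp_all
qed

text \<open>
  The source of all signs in the Leibniz rule: it compares different outward normals through their
  scalar products with a single vector \<open>m\<close>.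
\<close>

lemma orientation_change_first:
  fixes W :: "'a::euclidean_space set"
  assumes o: "is_orientation W \<omega>" and L: "ordered_basis W (m # bs)" and L': "ordered_basis W (x # bs)"
    and m: "\<And>b. b \<in> set bs \<Longrightarrow> inner m b = 0"
  shows "\<omega> (x # bs) = sgn (inner m x) * \<omega> (m # bs)"
proof -
  have "m \<noteq> 0" using L dependent_zero[of "set (m # bs)"] by (auto simp: ordered_basis_def)
  then have mm: "sgn (inner m m) = 1" by simp
  have "x \<in> W" using L' span_base[of x "set (x # bs)"] by (auto simp: ordered_basis_def)
  from transition_det_Cons[OF L this m]
  have "sgn (inner m x) = sgn (inner m m) * sgn (transition_det (m # bs) (x # bs))"
    by (simp flip: sgn_mult)
  then have "sgn (inner m x) = sgn (transition_det (m # bs) (x # bs))"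
    using mm by simp
  then show ?thesis using is_orientation_trans[OF o L L'] by simp
qed

text \<open>
  The determinant of the cyclic permutation that moves entry \<open>p\<close> to the front, hence \<open>(- 1) ^ p\<close>.
  It is the sign in front of \<open>r \<smile> ds\<close>; all that matters is that it does not depend on the basis.
\<close>

definition rotation_sign :: "nat \<Rightarrow> nat \<Rightarrow> real" where
  "rotation_sign p q = sgn (Determinant.det (Matrix.mat (p + q + 1) (p + q + 1)
     (\<lambda>(i, j). if i = (if j = 0 then p else if j \<le> p then j - 1 else j) then 1 else 0)))"

lemma orientation_rotate:
  fixes W :: "'a::euclidean_space set"
  assumes o: "is_orientation W \<omega>" and L: "ordered_basis W (x # bs @ cs)"
  shows "\<omega> (x # bs @ cs) = rotation_sign (length bs) (length cs) * \<omega> (bs @ x # cs)"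
proof -
  let ?p = "length bs" and ?q = "length cs"
  let ?L = "bs @ x # cs" and ?L' = "x # bs @ cs"
  let ?n = "?p + ?q + 1"
  define \<pi> where "\<pi> = (\<lambda>j. if j = 0 then ?p else if j \<le> ?p then j - 1 else j)"
  have L2: "ordered_basis W ?L"
    using L by (simp add: ordered_basis_iff)
  then have dist: "distinct ?L" by (simp add: ordered_basis_def)
  have \<pi>: "\<pi> j < ?n" "?L' ! j = ?L ! \<pi> j" if "j < ?n" for j
    using that by (auto simp: \<pi>_def nth_append nth_Cons')
  have e: "representation (set ?L) (?L' ! j) (?L ! i) = (if i = \<pi> j then 1 else 0)"
    if "i < ?n" "j < ?n" for i j
    using representation_nth[OF L2, of "\<pi> j"] \<pi>[OF that(2)] that nth_eq_iff_index_eq[OF dist, of i "\<pi> j"]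
    by (simp del: set_append)
  have "Matrix.mat ?n ?n (\<lambda>(i, j). representation (set ?L) (?L' ! j) (?L ! i)) =
     Matrix.mat ?n ?n (\<lambda>(i, j). if i = \<pi> j then 1 else 0)"
    by (rule cong_mat) (use e in simp_all)
  then have "sgn (transition_det ?L ?L') = rotation_sign ?p ?q"
    by (simp add: transition_det_def rotation_sign_def \<pi>_def del: set_append)
  then show ?thesis using is_orientation_trans[OF o L2 L] by simp
qed

text \<open>
  The orientation of a hyperplane \<open>H\<close> that puts \<open>n\<close> first. Boundary orientations are of this form,
  and so is the orientation used for a pair of faces whose directions span a hyperplane.
\<close>

definition contract_orientation :: "'a::real_vector \<Rightarrow> 'a set \<Rightarrow> 'a orientation \<Rightarrow> 'a orientation" where
  "contract_orientation n H \<omega> = (\<lambda>bs. if ordered_basis H bs then \<omega> (n # bs) else 0)"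

lemma is_orientation_contract:
  fixes W :: "'a::euclidean_space set"
  assumes o: "is_orientation W \<omega>"
    and W: "subspace W" "H \<subseteq> W" "n \<in> W" "n \<notin> H" "dim W = dim H + 1"
  shows "is_orientation H (contract_orientation n H \<omega>)"
proof -
  have c: "ordered_basis W (n # bs)" if "ordered_basis H bs" for bs
    using ordered_basis_Cons[OF that] W by simp
  have "transition_det (n # bs) (n # cs) = transition_det bs cs"
    if "ordered_basis H bs" "ordered_basis H cs" for bs cs
    using transition_det_prefix[of W "[n]" bs cs] c[OF that(1)] c[OF that(2)] that
    by (simp add: ordered_basis_def)
  then have tr: "\<omega> (n # cs) = sgn (transition_det bs cs) * \<omega> (n # bs)"
    if "ordered_basis H bs" "ordered_basis H cs" for bs cs
    using is_orientation_trans[OF o c[OF that(1)] c[OF that(2)]] that by simp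
  show ?thesis
  proof (rule is_orientationI)
    fix bs assume "ordered_basis H bs"
    then show "contract_orientation n H \<omega> bs = 1 \<or> contract_orientation n H \<omega> bs = -1"
      using is_orientation_basis[OF o c[of bs]] by (simp add: contract_orientation_def)
  next
    fix bs cs assume bc: "ordered_basis H bs" "ordered_basis H cs"
    then show "contract_orientation n H \<omega> cs =
        sgn (transition_det bs cs) * contract_orientation n H \<omega> bs"
      using tr[OF bc] by (simp add: contract_orientation_def)
  qed (simp add: contract_orientation_def)
qed

text \<open>
  Fix bases \<open>b0\<close>, \<open>c0\<close> of the summands and put \<open>\<alpha> bs = \<omega> (bs @ c0)\<close> and
  \<open>\<beta> cs = \<omega> (b0 @ cs) \<omega> (b0 @ c0)\<close>. The last factor is a sign, so it cancels against its second
  occurrence in the product.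
\<close>

lemma oriented_direct_sum_exists:
  fixes W :: "'a::euclidean_space set"
  assumes o: "is_orientation W \<omega>"
    and s: "subspace W1" "subspace W2"
    and W: "subspace W" "W1 \<inter> W2 = {0}" "W1 \<subseteq> W" "W2 \<subseteq> W" "dim W1 + dim W2 = dim W"
  shows "\<exists>\<alpha> \<beta>. oriented_direct_sum W \<omega> W1 \<alpha> W2 \<beta>"
proof -
  obtain b0 where b0: "ordered_basis W1 b0" using ordered_basis_exists[OF s(1)] .
  obtain c0 where c0: "ordered_basis W2 c0" using ordered_basis_exists[OF s(2)] .
  have ob: "ordered_basis W (bs @ cs)" if "ordered_basis W1 bs" "ordered_basis W2 cs" for bs cs
    using ordered_basis_append[OF that W] .
  have pm: "\<omega> (bs @ cs) = 1 \<or> \<omega> (bs @ cs) = -1" if "ordered_basis W1 bs" "ordered_basis W2 cs" for bs cs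
    using is_orientation_basis[OF o ob[OF that]] .
  have 1: "\<omega> (bs' @ cs) = sgn (transition_det bs bs') * \<omega> (bs @ cs)"
    if "ordered_basis W1 bs" "ordered_basis W1 bs'" "ordered_basis W2 cs" for bs bs' cs
    using transition_det_suffix[OF ob ob, of bs cs bs'] that is_orientation_trans[OF o ob ob, of bs cs bs' cs]
    by (simp add: ordered_basis_def)
  have 2: "\<omega> (bs @ cs') = sgn (transition_det cs cs') * \<omega> (bs @ cs)"
    if "ordered_basis W1 bs" "ordered_basis W2 cs'" "ordered_basis W2 cs" for bs cs cs'
    using transition_det_prefix[OF ob ob, of bs cs cs'] that is_orientation_trans[OF o ob ob, of bs cs bs cs']
    by (simp add: ordered_basis_def)
  define \<alpha> where "\<alpha> = (\<lambda>bs. if ordered_basis W1 bs then \<omega> (bs @ c0) else 0)"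
  define \<beta> where "\<beta> = (\<lambda>cs. if ordered_basis W2 cs then \<omega> (b0 @ cs) * \<omega> (b0 @ c0) else 0)"
  have "is_orientation W1 \<alpha>"
  proof (rule is_orientationI)
    fix bs assume "ordered_basis W1 bs"
    then show "\<alpha> bs = 1 \<or> \<alpha> bs = -1" using pm[of bs, OF _ c0] by (simp add: \<alpha>_def)
  next
    fix bs bs' assume c: "ordered_basis W1 bs" "ordered_basis W1 bs'"
    then show "\<alpha> bs' = sgn (transition_det bs bs') * \<alpha> bs"
      using 1[OF c c0] by (simp add: \<alpha>_def)
  qed (simp add: \<alpha>_def)
  moreover have "is_orientation W2 \<beta>"
  proof (rule is_orientationI)
    fix cs assume "ordered_basis W2 cs"
    then show "\<beta> cs = 1 \<or> \<beta> cs = -1" using pm[OF b0, of cs] pm[OF b0 c0] by (auto simp: \<beta>_def)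
  next
    fix cs cs' assume c: "ordered_basis W2 cs" "ordered_basis W2 cs'"
    then show "\<beta> cs' = sgn (transition_det cs cs') * \<beta> cs"
      using 2[OF b0 c(2,1)] by (simp add: \<beta>_def)
  qed (simp add: \<beta>_def)
  moreover have "\<omega> (bs @ cs) = \<alpha> bs * \<beta> cs" if "ordered_basis W1 bs" "ordered_basis W2 cs" for bs cs
  proof -
    have "\<alpha> bs = sgn (transition_det b0 bs) * \<omega> (b0 @ c0)"
      using 1[OF b0 that(1) c0] that by (simp add: \<alpha>_def)
    moreover have "\<omega> (b0 @ c0) * \<omega> (b0 @ c0) = 1" using pm[OF b0 c0] by auto
    ultimately have "\<alpha> bs * \<beta> cs = sgn (transition_det b0 bs) * \<omega> (b0 @ cs)"
      using that by (simp add: \<beta>_def)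
    then show ?thesis using 1[OF b0 that] by simp
  qed
  ultimately show ?thesis
    using o ob unfolding oriented_direct_sum_def by blast
qed

section \<open>Signs in products of cochains\<close>

text \<open>
  Multiplication by the sign of a real number; it replaces a product, since the ring may have no
  unit.
\<close>

definition signed :: "real \<Rightarrow> 'r::ring \<Rightarrow> 'r" where
  "signed c x = (if c > 0 then x else if c < 0 then - x else 0)"

lemma signed_simps [simp]: "signed 1 x = x" "signed (-1) x = - x"
  by (simp_all add: signed_def)

lemma signed_sum: "signed c (sum f A) = (\<Sum>x\<in>A. signed c (f x))"
  by (simp add: signed_def sum_negf)

lemma signed_signed: "signed c (signed d x) = signed (c * d) x"
  by (auto simp: signed_def zero_less_mult_iff mult_less_0_iff not_less)

lemma signed_sgn: "signed (sgn c) x = signed c x"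
  by (simp add: signed_def)

text \<open>
  An orientation is determined by its value on one basis, so \<open>\<alpha>'\<close> and \<open>\<alpha>\<close> agree up to sign, as do
  \<open>\<beta>'\<close> and \<open>\<beta>\<close>; \<open>c\<close> is the product of the two signs. In particular, the choice of orientations in
  the definition of the product does not affect its value.
\<close>

lemma cochain_product_sign:
  fixes r s :: "('a::euclidean_space, 'r::ring) cochain"
  assumes r: "r \<in> cochains X p" "\<delta> \<in> X" "aff_dim \<delta> = p"
    and s: "s \<in> cochains X q" "\<kappa> \<in> X" "aff_dim \<kappa> = q"
    and \<alpha>: "is_orientation (direction \<delta>) \<alpha>" "is_orientation (direction \<delta>) \<alpha>'"
    and \<beta>: "is_orientation (direction \<kappa>) \<beta>" "is_orientation (direction \<kappa>) \<beta>'"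
    and bs: "ordered_basis (direction \<delta>) bs" and cs: "ordered_basis (direction \<kappa>) cs"
    and eq: "\<alpha>' bs * \<beta>' cs = c * (\<alpha> bs * \<beta> cs)"
  shows "r \<delta> \<alpha>' * s \<kappa> \<beta>' = signed c (r \<delta> \<alpha> * s \<kappa> \<beta>)"
proof -
  have rm: "r \<delta> (- \<alpha>) = - r \<delta> \<alpha>" and sm: "s \<kappa> (- \<beta>) = - s \<kappa> \<beta>"
    using r s \<alpha> \<beta> by (auto simp: cochains_def oriented_cell_def)
  have pm: "\<alpha> bs = 1 \<or> \<alpha> bs = -1" "\<alpha>' bs = 1 \<or> \<alpha>' bs = -1" "\<beta> cs = 1 \<or> \<beta> cs = -1" "\<beta>' cs = 1 \<or> \<beta>' cs = -1"
    using is_orientation_basis \<alpha> \<beta> bs cs by blast+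
  have a: "\<alpha>' = (if \<alpha>' bs = \<alpha> bs then \<alpha> else - \<alpha>)"
  proof (rule is_orientation_eqI[OF \<alpha>(2) _ bs])
    show "is_orientation (direction \<delta>) (if \<alpha>' bs = \<alpha> bs then \<alpha> else - \<alpha>)"
      using \<alpha> is_orientation_uminus by auto
    show "\<alpha>' bs = (if \<alpha>' bs = \<alpha> bs then \<alpha> else - \<alpha>) bs"
      using pm by auto
  qed
  have b: "\<beta>' = (if \<beta>' cs = \<beta> cs then \<beta> else - \<beta>)"
  proof (rule is_orientation_eqI[OF \<beta>(2) _ cs])
    show "is_orientation (direction \<kappa>) (if \<beta>' cs = \<beta> cs then \<beta> else - \<beta>)"
      using \<beta> is_orientation_uminus by auto
    show "\<beta>' cs = (if \<beta>' cs = \<beta> cs then \<beta> else - \<beta>) cs"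
      using pm by auto
  qed
  show ?thesis
  proof (cases "\<alpha>' bs = \<alpha> bs"; cases "\<beta>' cs = \<beta> cs")
    assume h: "\<alpha>' bs = \<alpha> bs" "\<beta>' cs = \<beta> cs"
    then have "c = 1" using eq pm by auto
    then show ?thesis using a b h by simp
  next
    assume h: "\<alpha>' bs = \<alpha> bs" "\<beta>' cs \<noteq> \<beta> cs"
    then have "c = -1" using eq pm by auto
    then show ?thesis using a b h sm by simp
  next
    assume h: "\<alpha>' bs \<noteq> \<alpha> bs" "\<beta>' cs = \<beta> cs"
    then have "c = -1" using eq pm by auto
    then show ?thesis using a b h rm by simp
  next
    assume h: "\<alpha>' bs \<noteq> \<alpha> bs" "\<beta>' cs \<noteq> \<beta> cs"
    then have "c = 1" using eq pm by auto
    then show ?thesis using a b h rm sm by simp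
  qed
qed

section \<open>Directions and maximal faces\<close>

lemma subspace_direction: "subspace (direction C)"
  by (simp add: direction_def)

lemma direction_mono: "C \<subseteq> D \<Longrightarrow> direction C \<subseteq> direction D"
  unfolding direction_def by (rule span_mono) blast

lemma diff_in_direction: "x \<in> C \<Longrightarrow> y \<in> C \<Longrightarrow> x - y \<in> direction C"
  unfolding direction_def by (rule span_base) blast

lemma direction_minimal:
  assumes "subspace W" "\<And>x y. x \<in> C \<Longrightarrow> y \<in> C \<Longrightarrow> x - y \<in> W"
  shows "direction C \<subseteq> W"
  unfolding direction_def by (rule span_minimal) (use assms in auto)

lemma aff_dim_direction:
  fixes C :: "'a::euclidean_space set"
  assumes "C \<noteq> {}"
  shows "aff_dim C = int (dim (direction C))"
proof -
  obtain a where a: "a \<in> C" using assms by blast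
  let ?D = "(\<lambda>x. x - a) ` C"
  have "direction C \<subseteq> span ?D"
  proof (rule direction_minimal)
    fix x y assume "x \<in> C" "y \<in> C"
    then have "(x - a) - (y - a) \<in> span ?D" by (intro span_diff span_base) auto
    then show "x - y \<in> span ?D" by simp
  qed simp
  moreover have "span ?D \<subseteq> direction C"
    by (rule span_minimal) (auto intro: diff_in_direction a subspace_direction)
  ultimately have "dim (direction C) = dim ?D"
    by (metis dim_span subset_antisym)
  then show ?thesis
    using aff_dim_eq_dim_subtract[of a C] a by (simp add: hull_inc)
qed

lemma orthogonal_direction_const:
  assumes "\<And>u. u \<in> direction C \<Longrightarrow> w \<bullet> u = 0" "x \<in> C" "y \<in> C"
  shows "w \<bullet> x = w \<bullet> y"
  using assms(1)[OF diff_in_direction[OF assms(2,3)]] by (simp add: inner_diff_right)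

lemma const_orthogonal_direction:
  fixes C :: "'a::euclidean_space set"
  assumes "\<And>x y. x \<in> C \<Longrightarrow> y \<in> C \<Longrightarrow> w \<bullet> x = w \<bullet> y" "u \<in> direction C"
  shows "w \<bullet> u = 0"
proof -
  have "direction C \<subseteq> {u. w \<bullet> u = 0}"
    by (rule direction_minimal) (auto simp: subspace_hyperplane inner_diff_right intro: assms(1))
  then show ?thesis using assms(2) by blast
qed

definition amax :: "'a::real_inner set \<Rightarrow> 'a \<Rightarrow> 'a set" where
  "amax \<gamma> a = {x \<in> \<gamma>. \<forall>y\<in>\<gamma>. a \<bullet> y \<le> a \<bullet> x}"

lemma amax_subset: "amax \<gamma> a \<subseteq> \<gamma>"
  by (auto simp: amax_def)

lemma amax_const: "x \<in> amax \<gamma> a \<Longrightarrow> y \<in> amax \<gamma> a \<Longrightarrow> a \<bullet> x = a \<bullet> y"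
  by (auto simp: amax_def intro: antisym)

lemma amax_le: "x \<in> amax \<gamma> a \<Longrightarrow> y \<in> \<gamma> \<Longrightarrow> a \<bullet> y \<le> a \<bullet> x"
  by (auto simp: amax_def)

lemma amax_eqI: "x \<in> amax \<gamma> a \<Longrightarrow> y \<in> \<gamma> \<Longrightarrow> a \<bullet> y = a \<bullet> x \<Longrightarrow> y \<in> amax \<gamma> a"
  by (auto simp: amax_def)

lemma face_of_amax:
  assumes "convex \<gamma>" shows "amax \<gamma> a face_of \<gamma>"
proof (cases "amax \<gamma> a = {}")
  case False
  then obtain x where x: "x \<in> amax \<gamma> a" by blast
  then have "amax \<gamma> a = \<gamma> \<inter> {y. a \<bullet> y = a \<bullet> x}"
    using amax_subset amax_const[of _ \<gamma> a x] amax_eqI[OF x] by blast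
  then show ?thesis
    using face_of_Int_supporting_hyperplane_le[OF assms, of a "a \<bullet> x"] amax_le[OF x] by simp
qed simp

text \<open>
  A functional \<open>w\<close> that is constant on \<open>D\<close> treats all points of \<open>D\<close> alike, so it suffices to check
  a single point.
\<close>

lemma amax_extend:
  assumes D: "D \<subseteq> amax \<gamma> a" "x0 \<in> D" "\<And>u. u \<in> direction D \<Longrightarrow> w \<bullet> u = 0"
    and x0: "x0 \<in> amax \<gamma> (a + t *\<^sub>R w)"
  shows "D \<subseteq> amax \<gamma> (a + t *\<^sub>R w)"
proof
  fix x assume x: "x \<in> D"
  have "w \<bullet> x = w \<bullet> x0" "a \<bullet> x = a \<bullet> x0"
    using orthogonal_direction_const[OF D(3) x D(2)] amax_const[of x \<gamma> a x0] D x by auto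
  then show "x \<in> amax \<gamma> (a + t *\<^sub>R w)"
    using x D(1) amax_subset by (intro amax_eqI[OF x0]) (auto simp: inner_left_distrib)
qed

text \<open>
  On the finitely many vertices where \<open>a\<close> is not maximal there is a positive gap, which a small
  perturbation cannot close; on the others \<open>a\<close> is constant and \<open>w\<close> decides.
\<close>

lemma amax_perturb:
  fixes \<gamma> :: "'a::euclidean_space set"
  assumes "polytope \<gamma>" and x0: "x0 \<in> amax \<gamma> a"
    and w: "\<And>y. y \<in> amax \<gamma> a \<Longrightarrow> w \<bullet> y \<le> w \<bullet> x0"
  shows "\<forall>\<^sub>F \<epsilon> in at_right 0. x0 \<in> amax \<gamma> (a + \<epsilon> *\<^sub>R w)"
proof -
  obtain K where K: "finite K" "\<gamma> = convex hull K"
    using assms(1) by (auto simp: polytope_def)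
  have "\<forall>k\<in>K. \<forall>\<^sub>F \<epsilon> in at_right 0. (a + \<epsilon> *\<^sub>R w) \<bullet> k \<le> (a + \<epsilon> *\<^sub>R w) \<bullet> x0"
  proof
    fix k assume "k \<in> K"
    then have k: "k \<in> \<gamma>" using K hull_inc by metis
    show "\<forall>\<^sub>F \<epsilon> in at_right 0. (a + \<epsilon> *\<^sub>R w) \<bullet> k \<le> (a + \<epsilon> *\<^sub>R w) \<bullet> x0"
    proof (cases "a \<bullet> k = a \<bullet> x0")
      case True
      then have "w \<bullet> k \<le> w \<bullet> x0" using w amax_eqI[OF x0 k] by blast
      then show ?thesis
        using eventually_at_right_less[of "0::real"]
        by (auto elim!: eventually_mono simp: inner_left_distrib True mult_left_mono)
    next
      case False
      then have "a \<bullet> (k - x0) < 0" using amax_le[OF x0 k] by (simp add: inner_diff_right)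
      moreover have "((\<lambda>\<epsilon>. (a + \<epsilon> *\<^sub>R w) \<bullet> (k - x0)) \<longlongrightarrow> (a + 0 *\<^sub>R w) \<bullet> (k - x0)) (at_right 0)"
        by (intro tendsto_intros)
      ultimately have "\<forall>\<^sub>F \<epsilon> in at_right 0. (a + \<epsilon> *\<^sub>R w) \<bullet> (k - x0) < 0"
        by (intro order_tendstoD(2)) auto
      then show ?thesis by (rule eventually_mono) (simp add: inner_diff_right)
    qed
  qed
  then have "\<forall>\<^sub>F \<epsilon> in at_right 0. \<forall>k\<in>K. (a + \<epsilon> *\<^sub>R w) \<bullet> k \<le> (a + \<epsilon> *\<^sub>R w) \<bullet> x0"
    by (rule eventually_ball_finite[OF K(1)])
  then show ?thesis
  proof (rule eventually_mono)
    fix \<epsilon> assume "\<forall>k\<in>K. (a + \<epsilon> *\<^sub>R w) \<bullet> k \<le> (a + \<epsilon> *\<^sub>R w) \<bullet> x0"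
    then have "convex hull K \<subseteq> {y. (a + \<epsilon> *\<^sub>R w) \<bullet> y \<le> (a + \<epsilon> *\<^sub>R w) \<bullet> x0}"
      by (intro hull_minimal) (auto simp: convex_halfspace_le)
    then show "x0 \<in> amax \<gamma> (a + \<epsilon> *\<^sub>R w)"
      using x0 K(2) by (auto simp: amax_def)
  qed
qed

text \<open>
  The parameters \<open>t \<ge> 0\<close> for which \<open>a + t w\<close> is maximal at \<open>x0\<close> and \<open>a + v + t w\<close> is maximal at
  \<open>z0\<close> form a compact set, because the point \<open>x\<close> bounds it. At its last element one of the two
  maximal faces must contain a point at which \<open>w\<close> is larger, as otherwise a perturbation leads
  further.
\<close>

lemma ray_endpoint:
  fixes \<gamma> :: "'a::euclidean_space set"
  assumes \<gamma>: "polytope \<gamma>" and x0: "x0 \<in> amax \<gamma> a" and z0: "z0 \<in> amax \<gamma> (a + v)"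
    and x: "x \<in> \<gamma>" "w \<bullet> x0 < w \<bullet> x \<or> w \<bullet> z0 < w \<bullet> x"
  obtains t where "x0 \<in> amax \<gamma> (a + t *\<^sub>R w)" "z0 \<in> amax \<gamma> (a + v + t *\<^sub>R w)"
    "(\<exists>y \<in> amax \<gamma> (a + t *\<^sub>R w). w \<bullet> x0 < w \<bullet> y) \<or> (\<exists>y \<in> amax \<gamma> (a + v + t *\<^sub>R w). w \<bullet> z0 < w \<bullet> y)"
proof -
  define T where "T = {t. 0 \<le> t \<and> x0 \<in> amax \<gamma> (a + t *\<^sub>R w) \<and> z0 \<in> amax \<gamma> (a + v + t *\<^sub>R w)}"
  have mem: "x0 \<in> \<gamma>" "z0 \<in> \<gamma>" using x0 z0 amax_subset by auto
  have "T = {0..} \<inter> (\<Inter>y\<in>\<gamma>. {t. (a + t *\<^sub>R w) \<bullet> y \<le> (a + t *\<^sub>R w) \<bullet> x0}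
         \<inter> {t. (a + v + t *\<^sub>R w) \<bullet> y \<le> (a + v + t *\<^sub>R w) \<bullet> z0})"
    using mem by (auto simp: T_def amax_def)
  also have "closed \<dots>"
    by (intro closed_Int closed_INT ballI closed_Collect_le continuous_intros closed_atLeast)
  finally have "closed T" .
  \<comment> \<open>Either point gives a linear inequality in the parameter that fails for large values.\<close>
  obtain b y0 where by0: "y0 \<in> \<gamma>" "w \<bullet> y0 < w \<bullet> x"
    "\<And>t. t \<in> T \<Longrightarrow> (b + t *\<^sub>R w) \<bullet> x \<le> (b + t *\<^sub>R w) \<bullet> y0"
    using x(2)
  proof
    assume "w \<bullet> x0 < w \<bullet> x"
    then show ?thesis using that[of x0 a] mem x by (auto simp: T_def amax_def)
  next
    assume "w \<bullet> z0 < w \<bullet> x"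
    then show ?thesis using that[of z0 "a + v"] mem x by (auto simp: T_def amax_def)
  qed
  have ub: "t \<le> (b \<bullet> y0 - b \<bullet> x) / (w \<bullet> x - w \<bullet> y0)" if "t \<in> T" for t
    using by0(2) by0(3)[OF that] by (simp add: pos_le_divide_eq inner_left_distrib algebra_simps)
  have "T \<subseteq> {0 .. (b \<bullet> y0 - b \<bullet> x) / (w \<bullet> x - w \<bullet> y0)}"
    using ub by (auto simp: T_def)
  then have "bounded T" using bounded_closed_interval bounded_subset by blast
  moreover have "0 \<in> T" using x0 z0 by (simp add: T_def)
  ultimately obtain t where t: "t \<in> T" "\<And>s. s \<in> T \<Longrightarrow> s \<le> t"
    using \<open>closed T\<close> compact_attains_sup[of T] compact_eq_bounded_closed by blast
  have "(\<exists>y \<in> amax \<gamma> (a + t *\<^sub>R w). w \<bullet> x0 < w \<bullet> y) \<or> (\<exists>y \<in> amax \<gamma> (a + v + t *\<^sub>R w). w \<bullet> z0 < w \<bullet> y)"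
  proof (rule ccontr)
    assume no: "\<not> ?thesis"
    have "\<forall>\<^sub>F \<epsilon> in at_right 0. x0 \<in> amax \<gamma> (a + t *\<^sub>R w + \<epsilon> *\<^sub>R w)"
      by (rule amax_perturb[OF \<gamma>]) (use t no in \<open>auto simp: T_def not_less\<close>)
    moreover have "\<forall>\<^sub>F \<epsilon> in at_right 0. z0 \<in> amax \<gamma> (a + v + t *\<^sub>R w + \<epsilon> *\<^sub>R w)"
      by (rule amax_perturb[OF \<gamma>]) (use t no in \<open>auto simp: T_def not_less\<close>)
    ultimately have "\<forall>\<^sub>F \<epsilon> in at_right 0. 0 < \<epsilon> \<and> t + \<epsilon> \<in> T"
      using eventually_at_right_less[of "0::real"]
    proof eventually_elim
      case (elim \<epsilon>)
      then show ?case using t(1) by (simp add: T_def scaleR_left_distrib add.assoc)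
    qed
    then obtain \<epsilon> where "0 < \<epsilon>" "t + \<epsilon> \<in> T"
      using eventually_happens'[OF trivial_limit_at_right_real] by blast
    then show False using t(2)[of "t + \<epsilon>"] by simp
  qed
  then show thesis using t(1) that[of t] unfolding T_def by blast
qed

lemma amax_cong:
  assumes "\<And>u. u \<in> direction \<gamma> \<Longrightarrow> a \<bullet> u = b \<bullet> u"
  shows "amax \<gamma> a = amax \<gamma> b"
proof -
  have "a \<bullet> y \<le> a \<bullet> x \<longleftrightarrow> b \<bullet> y \<le> b \<bullet> x" if "x \<in> \<gamma>" "y \<in> \<gamma>" for x y
    using assms[OF diff_in_direction[OF that(2,1)]] by (simp add: inner_diff_right) linarith
  then show ?thesis by (auto simp: amax_def)
qed

lemma project_inner:
  fixes E :: "'a::euclidean_space set"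
  assumes "subspace E"
  obtains b where "b \<in> E" "\<And>x. x \<in> E \<Longrightarrow> b \<bullet> x = a \<bullet> x"
proof -
  have sp: "span E = E" using assms by (rule span_eq_iff[THEN iffD2])
  obtain b z where bz: "b \<in> span E" "\<And>w. w \<in> span E \<Longrightarrow> orthogonal z w" "a = b + z"
    using orthogonal_subspace_decomp_exists[of E a] by metis
  have "b \<bullet> x = a \<bullet> x" if "x \<in> E" for x
    using bz(2)[of x] bz(3) that sp by (simp add: orthogonal_def inner_left_distrib)
  then show thesis using that[of b] bz(1) sp by simp
qed

lemma amax_project:
  fixes \<gamma> :: "'a::euclidean_space set"
  obtains a0 where "a0 \<in> direction \<gamma>" "\<And>b. amax \<gamma> (a + b) = amax \<gamma> (a0 + b)"
proof -
  obtain a0 where a0: "a0 \<in> direction \<gamma>" "\<And>x. x \<in> direction \<gamma> \<Longrightarrow> a0 \<bullet> x = a \<bullet> x"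
    using project_inner[OF subspace_direction, of \<gamma> a] by blast
  then have "amax \<gamma> (a + b) = amax \<gamma> (a0 + b)" for b
    by (intro amax_cong) (simp add: inner_left_distrib)
  then show thesis using that a0(1) by blast
qed

lemma orthogonal_direction_eq_0:
  fixes \<gamma> :: "'a::euclidean_space set"
  assumes "w \<in> direction \<gamma>" "\<And>x y. x \<in> \<gamma> \<Longrightarrow> y \<in> \<gamma> \<Longrightarrow> w \<bullet> x = w \<bullet> y"
  shows "w = 0"
  using const_orthogonal_direction[OF assms(2,1)] by simp

text \<open>
  This is the existence of a vertex in the polyhedron of all functionals that link two given
  faces. The vectors \<open>w\<close> in the statement are those along which \<open>b\<close> can move in both directions.
  If there is a nonzero one, moving along it until \<open>ray_endpoint\<close> stops the motion enlarges one of
  the maximal faces, and the space of such vectors loses dimension.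
\<close>

lemma linked_vertex_exists:
  fixes \<gamma> :: "'a::euclidean_space set"
  assumes \<gamma>: "polytope \<gamma>"
    and ne: "amax \<gamma> a \<noteq> {}" "amax \<gamma> (a + v) \<noteq> {}"
  shows "\<exists>b. amax \<gamma> a \<subseteq> amax \<gamma> b \<and> amax \<gamma> (a + v) \<subseteq> amax \<gamma> (b + v) \<and>
    (\<forall>w \<in> direction \<gamma>. (\<forall>u \<in> direction (amax \<gamma> b) \<union> direction (amax \<gamma> (b + v)). w \<bullet> u = 0) \<longrightarrow> w = 0)"
proof -
  define W where "W = (\<lambda>a. {w \<in> direction \<gamma>.
     \<forall>u \<in> direction (amax \<gamma> a) \<union> direction (amax \<gamma> (a + v)). w \<bullet> u = 0})"
  have sW: "subspace (W a)" for a
    using subspace_direction[of \<gamma>]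
    by (auto simp: W_def subspace_def inner_left_distrib)
  show ?thesis using ne
  proof (induction "dim (W a)" arbitrary: a rule: less_induct)
    case less
    show ?case
    proof (cases "W a \<subseteq> {0}")
      case True
      then show ?thesis by (intro exI[of _ a]) (auto simp: W_def)
    next
      case False
      then obtain w' where w': "w' \<in> W a" "w' \<noteq> 0" by blast
      obtain x0 z0 where xz: "x0 \<in> amax \<gamma> a" "z0 \<in> amax \<gamma> (a + v)"
        using less.prems by blast
      have mem: "x0 \<in> \<gamma>" using xz amax_subset by blast
      \<comment> \<open>A nonzero vector of \<open>W a\<close> is not constant on \<open>\<gamma>\<close>, so it or its negative increases somewhere.\<close>
      have "\<exists>w x. w \<in> W a \<and> x \<in> \<gamma> \<and> w \<bullet> x0 < w \<bullet> x"
      proof (rule ccontr)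
        assume no: "\<not> ?thesis"
        have neg: "- w' \<in> W a" using w'(1) sW subspace_neg by blast
        have "w' \<bullet> x = w' \<bullet> x0" if "x \<in> \<gamma>" for x
        proof -
          have "\<not> w' \<bullet> x0 < w' \<bullet> x" "\<not> (- w') \<bullet> x0 < (- w') \<bullet> x"
            using no w'(1) neg that by blast+
          then show ?thesis by simp
        qed
        then have "w' = 0"
          using orthogonal_direction_eq_0[of w' \<gamma>] w'(1) by (simp add: W_def)
        then show False using w' by simp
      qed
      then obtain w x where w: "w \<in> W a" "x \<in> \<gamma>" "w \<bullet> x0 < w \<bullet> x" by blast
      obtain t where t: "x0 \<in> amax \<gamma> (a + t *\<^sub>R w)" "z0 \<in> amax \<gamma> (a + v + t *\<^sub>R w)"
        and st: "(\<exists>y \<in> amax \<gamma> (a + t *\<^sub>R w). w \<bullet> x0 < w \<bullet> y) \<or> (\<exists>y \<in> amax \<gamma> (a + v + t *\<^sub>R w). w \<bullet> z0 < w \<bullet> y)"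
        using ray_endpoint[OF \<gamma> xz w(2)] w(3) by blast
      define b where "b = a + t *\<^sub>R w"
      have bv: "a + v + t *\<^sub>R w = b + v" by (simp add: b_def)
      have sub1: "amax \<gamma> a \<subseteq> amax \<gamma> b"
        unfolding b_def using w(1) by (intro amax_extend[OF _ xz(1) _ t(1)]) (auto simp: W_def)
      have sub2: "amax \<gamma> (a + v) \<subseteq> amax \<gamma> (b + v)"
        unfolding bv[symmetric] using w(1) by (intro amax_extend[OF _ xz(2) _ t(2)]) (auto simp: W_def)
      have "W b \<subseteq> W a"
        using direction_mono[OF sub1] direction_mono[OF sub2] by (auto simp: W_def)
      moreover have "w \<notin> W b"
      proof
        assume "w \<in> W b"
        then have o: "\<And>u. u \<in> direction (amax \<gamma> b) \<Longrightarrow> w \<bullet> u = 0"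
          "\<And>u. u \<in> direction (amax \<gamma> (b + v)) \<Longrightarrow> w \<bullet> u = 0" by (auto simp: W_def)
        have "w \<bullet> y = w \<bullet> x0" if "y \<in> amax \<gamma> b" for y
          using orthogonal_direction_const[OF o(1) that] t(1) by (simp add: b_def)
        moreover have "w \<bullet> y = w \<bullet> z0" if "y \<in> amax \<gamma> (b + v)" for y
          using orthogonal_direction_const[OF o(2) that] t(2) by (simp add: bv)
        ultimately show False
          using st unfolding bv b_def[symmetric] by fastforce
      qed
      ultimately have "span (W b) \<subset> span (W a)"
        using w(1) sW by (auto simp: span_eq_iff[THEN iffD2, OF sW])
      then have "dim (W b) < dim (W a)" by (rule dim_psubset)
      moreover have "amax \<gamma> b \<noteq> {}" "amax \<gamma> (b + v) \<noteq> {}"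
        using less.prems sub1 sub2 by blast+
      ultimately obtain c where c: "amax \<gamma> b \<subseteq> amax \<gamma> c" "amax \<gamma> (b + v) \<subseteq> amax \<gamma> (c + v)"
        "\<forall>w \<in> direction \<gamma>. (\<forall>u \<in> direction (amax \<gamma> c) \<union> direction (amax \<gamma> (c + v)). w \<bullet> u = 0) \<longrightarrow> w = 0"
        using less.hyps[of b] by blast
      show ?thesis
        by (intro exI[of _ c] conjI subset_trans[OF sub1 c(1)] subset_trans[OF sub2 c(2)] c(3))
    qed
  qed
qed

text \<open>
  All of \<open>\<mu>\<close> outside a facet lies on one side of it: up to the direction of the facet, all outward
  normals are positive multiples of each other. So the sign of a scalar product with an outward
  normal does not depend on the choice of the normal.
\<close>

lemma facet_side:
  fixes \<mu> :: "'a::euclidean_space set"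
  assumes \<mu>: "polyhedron \<mu>" and f: "\<delta> facet_of \<mu>"
    and xy: "x \<in> \<delta>" "y \<in> \<mu> - \<delta>" "x' \<in> \<delta>" "y' \<in> \<mu> - \<delta>"
  obtains k h where "k > 0" "h \<in> direction \<delta>" "x - y = h + k *\<^sub>R (x' - y')" "x' - y' \<notin> direction \<delta>"
proof -
  have fo: "\<delta> face_of \<mu>" and ne: "\<delta> \<noteq> {}" and ad: "aff_dim \<delta> = aff_dim \<mu> - 1"
    using f by (auto simp: facet_of_def)
  have sub: "\<delta> \<subseteq> \<mu>" using fo by (rule face_of_imp_subset)
  then have ne': "\<mu> \<noteq> {}" using ne by blast
  obtain c b where cb: "\<mu> \<subseteq> {z. c \<bullet> z \<le> b}" "\<delta> = \<mu> \<inter> {z. c \<bullet> z = b}"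
    using exposed_face_of_polyhedron[OF \<mu>, of \<delta>] fo by (auto simp: exposed_face_of_def)
  have orth: "c \<bullet> u = 0" if "u \<in> direction \<delta>" for u
    by (rule const_orthogonal_direction[OF _ that]) (use cb in auto)
  have pos: "0 < c \<bullet> (u - z)" if "u \<in> \<delta>" "z \<in> \<mu> - \<delta>" for u z
    using that cb by (auto simp: inner_diff_right less_le)
  let ?n = "x' - y'"
  have n: "?n \<notin> direction \<delta>" using orth pos[OF xy(3,4)] by fastforce
  have "dim (direction \<mu>) = dim (direction \<delta>) + 1"
    using ad aff_dim_direction[OF ne] aff_dim_direction[OF ne'] by linarith
  moreover have "insert ?n (direction \<delta>) \<subseteq> direction \<mu>"
    using direction_mono[OF sub] xy sub diff_in_direction[of x' \<mu> y'] by auto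
  moreover have "dim (insert ?n (direction \<delta>)) = dim (direction \<delta>) + 1"
    using n by (simp add: dim_insert span_eq_iff[THEN iffD2, OF subspace_direction])
  ultimately have "span (insert ?n (direction \<delta>)) = direction \<mu>"
    by (intro subspace_dim_equal subspace_span subspace_direction span_minimal) (simp_all only: dim_span)
  moreover have "x - y \<in> direction \<mu>"
    using xy sub by (intro diff_in_direction) auto
  ultimately obtain k where k: "(x - y) - k *\<^sub>R ?n \<in> direction \<delta>"
    by (metis span_breakdown_eq span_eq_iff subspace_direction)
  have "c \<bullet> (x - y) = k * (c \<bullet> ?n)"
    using orth[OF k] by (simp add: inner_diff_right)
  then have "k > 0" using pos[OF xy(1,2)] pos[OF xy(3,4)] by (metis zero_less_mult_pos2)
  then show thesis using that[of k "(x - y) - k *\<^sub>R ?n"] k n by simp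
qed

section \<open>Linked faces\<close>

definition linked :: "'a::real_inner \<Rightarrow> 'a set \<Rightarrow> 'a set \<Rightarrow> 'a set \<Rightarrow> bool" where
  "linked v \<gamma> \<delta> \<kappa> \<longleftrightarrow> (\<exists>a. \<delta> \<subseteq> amax \<gamma> a \<and> \<kappa> \<subseteq> amax \<gamma> (a + v))"

text \<open>
  The form in which transversality is used. It is imposed on all pairs of maximal faces, not only
  on pairs of complementary dimension.
\<close>

definition generic :: "'a::euclidean_space \<Rightarrow> 'a set \<Rightarrow> bool" where
  "generic v \<gamma> \<longleftrightarrow> (\<forall>a. direction (amax \<gamma> a) \<inter> direction (amax \<gamma> (a + v)) \<subseteq> {0})"

definition outward_normal :: "'a::real_vector set \<Rightarrow> 'a set \<Rightarrow> 'a" where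
  "outward_normal \<mu> \<delta> = (SOME n. \<exists>x\<in>\<delta>. \<exists>y\<in>\<mu> - \<delta>. n = x - y)"

lemma linked_swap: "linked (- v) \<gamma> \<kappa> \<delta> \<longleftrightarrow> linked v \<gamma> \<delta> \<kappa>"
proof -
  have "linked v \<gamma> \<delta> \<kappa>" if l: "linked (- v) \<gamma> \<kappa> \<delta>" for v :: 'a and \<delta> \<kappa>
  proof -
    obtain a where "\<kappa> \<subseteq> amax \<gamma> a" "\<delta> \<subseteq> amax \<gamma> (a + - v)"
      using l unfolding linked_def by blast
    then show ?thesis unfolding linked_def by (intro exI[of _ "a - v"]) simp
  qed
  from this[of v \<kappa> \<delta>] this[of "- v" \<delta> \<kappa>] show ?thesis by auto
qed

lemma generic_uminus: "generic v \<gamma> \<Longrightarrow> generic (- v) \<gamma>"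
  unfolding generic_def
proof
  fix a assume "\<forall>a. direction (amax \<gamma> a) \<inter> direction (amax \<gamma> (a + v)) \<subseteq> {0}"
  from this[rule_format, of "a - v"]
  show "direction (amax \<gamma> a) \<inter> direction (amax \<gamma> (a + - v)) \<subseteq> {0}"
    by (simp add: Int_commute)
qed

lemma linked_mono: "linked v \<gamma> \<delta> \<kappa> \<Longrightarrow> \<delta>' \<subseteq> \<delta> \<Longrightarrow> \<kappa>' \<subseteq> \<kappa> \<Longrightarrow> linked v \<gamma> \<delta>' \<kappa>'"
  unfolding linked_def by blast

lemma linked_face:
  assumes "linked v \<gamma> \<delta> \<kappa>" "\<mu> \<subseteq> \<gamma>" "\<delta> \<subseteq> \<mu>" "\<kappa> \<subseteq> \<mu>"
  shows "linked v \<mu> \<delta> \<kappa>"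
proof -
  obtain a where "\<delta> \<subseteq> amax \<gamma> a" "\<kappa> \<subseteq> amax \<gamma> (a + v)"
    using assms(1) unfolding linked_def by blast
  then have "\<delta> \<subseteq> amax \<mu> a" "\<kappa> \<subseteq> amax \<mu> (a + v)"
    using assms(2-4) unfolding amax_def by blast+
  then show ?thesis unfolding linked_def by blast
qed

lemma linked_obtain_direction:
  fixes \<gamma> :: "'a::euclidean_space set"
  assumes "linked v \<gamma> \<delta> \<kappa>"
  obtains a where "a \<in> direction \<gamma>" "\<delta> \<subseteq> amax \<gamma> a" "\<kappa> \<subseteq> amax \<gamma> (a + v)"
proof -
  obtain a where a: "\<delta> \<subseteq> amax \<gamma> a" "\<kappa> \<subseteq> amax \<gamma> (a + v)"
    using assms unfolding linked_def by blast
  obtain a0 where "a0 \<in> direction \<gamma>" "\<And>b. amax \<gamma> (a + b) = amax \<gamma> (a0 + b)"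
    using amax_project[of \<gamma> a] by blast
  from this(1) this(2)[of 0] this(2)[of v] a that show thesis by simp
qed

lemma generic_linked:
  assumes "generic v \<gamma>" "linked v \<gamma> \<delta> \<kappa>"
  shows "direction \<delta> \<inter> direction \<kappa> = {0}"
proof -
  obtain a where "\<delta> \<subseteq> amax \<gamma> a" "\<kappa> \<subseteq> amax \<gamma> (a + v)"
    using assms(2) unfolding linked_def by blast
  then have "direction \<delta> \<inter> direction \<kappa> \<subseteq> {0}"
    using assms(1) direction_mono unfolding generic_def by blast
  then show ?thesis using subspace_direction subspace_0 by blast
qed

lemma exposed_amax:
  fixes \<gamma> :: "'a::euclidean_space set"
  assumes "polyhedron \<gamma>" "\<mu> face_of \<gamma>" "\<mu> \<noteq> {}"
  obtains c where "c \<in> direction \<gamma>" "\<mu> = amax \<gamma> c"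
proof -
  obtain c b where cb: "\<gamma> \<subseteq> {z. c \<bullet> z \<le> b}" "\<mu> = \<gamma> \<inter> {z. c \<bullet> z = b}"
    using exposed_face_of_polyhedron[OF assms(1), of \<mu>] assms(2) by (auto simp: exposed_face_of_def)
  obtain x where "x \<in> \<mu>" using assms(3) by blast
  then have "\<mu> = amax \<gamma> c" using cb by (force simp: amax_def)
  moreover obtain c0 where "c0 \<in> direction \<gamma>" "\<And>b. amax \<gamma> (c + b) = amax \<gamma> (c0 + b)"
    using amax_project[of \<gamma> c] by blast
  ultimately show thesis using that[of c0] by (metis add.right_neutral)
qed

lemma outward_normal_obtain:
  assumes "\<delta> facet_of \<mu>"
  obtains x y where "x \<in> \<delta>" "y \<in> \<mu> - \<delta>" "outward_normal \<mu> \<delta> = x - y"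
proof -
  have "\<delta> \<noteq> {}" "\<delta> \<subseteq> \<mu>" "\<delta> \<noteq> \<mu>"
    using assms by (auto simp: facet_of_def dest: face_of_imp_subset)
  then have "\<exists>n. \<exists>x\<in>\<delta>. \<exists>y\<in>\<mu> - \<delta>. n = x - y" by blast
  from someI_ex[OF this] show thesis
    using that unfolding outward_normal_def by blast
qed

text \<open>
  The two kinds of ends in the direction \<open>m\<close> of the set of functionals that link \<open>\<delta>\<close> and \<open>\<kappa>\<close>: at
  infinity the functional is dominated by \<open>m\<close> and maximal on a facet of the cell; at a finite end
  the face \<open>\<delta>\<close> grows in the direction in which \<open>m\<close> increases, which is opposite to the outward
  normal. The finite ends at which \<open>\<kappa>\<close> grows are obtained by exchanging the two faces and
  replacing \<open>v\<close> by \<open>- v\<close>.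
\<close>

definition outer_ends :: "'a::euclidean_space \<Rightarrow> 'a set \<Rightarrow> 'a set \<Rightarrow> 'a set \<Rightarrow> 'a \<Rightarrow> 'a set set" where
  "outer_ends v \<gamma> \<delta> \<kappa> m =
     {\<mu>. \<mu> facet_of \<gamma> \<and> \<delta> \<subseteq> \<mu> \<and> \<kappa> \<subseteq> \<mu> \<and> linked v \<mu> \<delta> \<kappa> \<and> 0 < m \<bullet> outward_normal \<gamma> \<mu>}"

definition inner_ends :: "'a::euclidean_space \<Rightarrow> 'a set \<Rightarrow> 'a set \<Rightarrow> 'a set \<Rightarrow> 'a \<Rightarrow> 'a set set" where
  "inner_ends v \<gamma> \<delta> \<kappa> m =
     {\<delta>'. \<delta>' face_of \<gamma> \<and> \<delta> facet_of \<delta>' \<and> linked v \<gamma> \<delta>' \<kappa> \<and> m \<bullet> outward_normal \<delta>' \<delta> < 0}"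

section \<open>The two ends of the functionals linking a pair of faces\<close>

text \<open>
  A linked pair whose directions span a hyperplane with normal \<open>m\<close>. In the mixed subdivision of
  \<open>\<gamma> + \<gamma>\<close> defined by \<open>v\<close> the sum of the two faces is a cell of codimension one.
\<close>

locale wall =
  fixes \<gamma> :: "'a::euclidean_space set" and v :: 'a and \<delta> \<kappa> :: "'a set" and m :: 'a
  assumes polytope: "polytope \<gamma>" and generic: "generic v \<gamma>"
    and faces: "\<delta> face_of \<gamma>" "\<kappa> face_of \<gamma>" "\<delta> \<noteq> {}" "\<kappa> \<noteq> {}"
    and dims: "dim (direction \<delta>) + dim (direction \<kappa>) + 1 = dim (direction \<gamma>)"
    and linked: "linked v \<gamma> \<delta> \<kappa>"
    and m: "m \<in> direction \<gamma>" "m \<noteq> 0"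
    and m_orth: "\<And>u. u \<in> direction \<delta> \<Longrightarrow> m \<bullet> u = 0" "\<And>u. u \<in> direction \<kappa> \<Longrightarrow> m \<bullet> u = 0"
begin

lemma wall_swap: "wall \<gamma> (- v) \<kappa> \<delta> m"
  using polytope generic_uminus[OF generic] faces dims linked m m_orth
  by unfold_locales (auto simp: linked_swap)

lemma wall_uminus: "wall \<gamma> v \<delta> \<kappa> (- m)"
  using polytope generic faces dims linked m m_orth subspace_neg[OF subspace_direction]
  by unfold_locales auto

lemma polyhedron_cell: "polyhedron \<gamma>"
  using polytope by (rule polytope_imp_polyhedron)

lemma convex_cell: "convex \<gamma>"
  using polytope by (rule polytope_imp_convex)

lemma dir_subset: "direction \<delta> \<subseteq> direction \<gamma>" "direction \<kappa> \<subseteq> direction \<gamma>"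
  using faces face_of_imp_subset direction_mono by blast+

lemma sum_directions:
  defines "S \<equiv> {x + y |x y. x \<in> direction \<delta> \<and> y \<in> direction \<kappa>}"
  shows "subspace S" "S \<subseteq> direction \<gamma>" "m \<notin> S" "dim S = dim (direction \<delta>) + dim (direction \<kappa>)"
    "direction \<delta> \<subseteq> S" "direction \<kappa> \<subseteq> S"
proof -
  show "subspace S" unfolding S_def by (intro subspace_sums subspace_direction)
  show "S \<subseteq> direction \<gamma>"
    using dir_subset by (auto simp: S_def intro: subspace_add[OF subspace_direction])
  have "m \<bullet> s = 0" if "s \<in> S" for s
    using that by (auto simp: S_def inner_right_distrib m_orth)
  then show "m \<notin> S" using m(2) inner_eq_zero_iff[of m] by blast
  show "dim S = dim (direction \<delta>) + dim (direction \<kappa>)"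
    using dim_sums_Int[of "direction \<delta>" "direction \<kappa>"] generic_linked[OF generic linked]
    by (simp add: subspace_direction S_def)
  show "direction \<delta> \<subseteq> S"
  proof
    fix x assume "x \<in> direction \<delta>"
    then have "x + 0 \<in> S" unfolding S_def using subspace_0[OF subspace_direction] by blast
    then show "x \<in> S" by simp
  qed
  show "direction \<kappa> \<subseteq> S"
  proof
    fix x assume "x \<in> direction \<kappa>"
    then have "0 + x \<in> S" unfolding S_def using subspace_0[OF subspace_direction] by blast
    then show "x \<in> S" by simp
  qed
qed

text \<open>
  The vectors orthogonal to both faces form the line spanned by \<open>m\<close>, so any two functionals that
  link the faces differ by a multiple of \<open>m\<close>.
\<close>

lemma normal_line:
  assumes u: "u \<in> direction \<gamma>" "\<And>x. x \<in> direction \<delta> \<Longrightarrow> u \<bullet> x = 0" "\<And>x. x \<in> direction \<kappa> \<Longrightarrow> u \<bullet> x = 0"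
  shows "\<exists>t. u = t *\<^sub>R m"
proof -
  define S where "S = {x + y |x y. x \<in> direction \<delta> \<and> y \<in> direction \<kappa>}"
  note S = sum_directions[folded S_def]
  have orth: "f \<bullet> s = 0" if "s \<in> S" "\<And>x. x \<in> direction \<delta> \<Longrightarrow> f \<bullet> x = 0" "\<And>x. x \<in> direction \<kappa> \<Longrightarrow> f \<bullet> x = 0"
    for f s
    using that(1) by (auto simp: S_def inner_right_distrib that(2,3))
  have "dim (insert m S) = dim (direction \<gamma>)"
    using dims S(3,4) by (simp add: dim_insert span_eq_iff[THEN iffD2, OF S(1)])
  moreover have "insert m S \<subseteq> direction \<gamma>" using m(1) S(2) by simp
  ultimately have sp: "span (insert m S) = direction \<gamma>"
    by (intro subspace_dim_equal subspace_span subspace_direction span_minimal) (simp_all only: dim_span)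
  define t where "t = (u \<bullet> m) / (m \<bullet> m)"
  define w where "w = u - t *\<^sub>R m"
  have "w \<bullet> m = 0" using m(2) by (simp add: w_def t_def inner_diff_left)
  moreover have "w \<bullet> s = 0" if "s \<in> S" for s
    using orth[OF that, of u] orth[OF that, of m] u m_orth by (simp add: w_def inner_diff_left)
  ultimately have "insert m S \<subseteq> {x. w \<bullet> x = 0}" by blast
  then have "span (insert m S) \<subseteq> {x. w \<bullet> x = 0}"
    by (intro span_minimal subspace_hyperplane)
  moreover have "w \<in> direction \<gamma>"
    unfolding w_def by (intro subspace_diff subspace_scale subspace_direction u m)
  ultimately have "w \<bullet> w = 0" using sp by blast
  then have "u = t *\<^sub>R m" by (simp add: w_def)
  then show ?thesis ..
qed

text \<open>
  At such an \<open>a\<close> a further step in the direction \<open>m\<close> makes one of the faces cease to be maximal.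
\<close>

definition terminal :: "'a \<Rightarrow> bool" where
  "terminal a \<longleftrightarrow> \<delta> \<subseteq> amax \<gamma> a \<and> \<kappa> \<subseteq> amax \<gamma> (a + v) \<and>
     ((\<exists>x\<in>\<delta>. \<exists>y \<in> amax \<gamma> a. m \<bullet> x < m \<bullet> y) \<or> (\<exists>z\<in>\<kappa>. \<exists>y \<in> amax \<gamma> (a + v). m \<bullet> z < m \<bullet> y))"

lemma terminal_maximal:
  assumes "terminal a" "\<delta> \<subseteq> amax \<gamma> (a + t *\<^sub>R m)" "\<kappa> \<subseteq> amax \<gamma> (a + t *\<^sub>R m + v)"
  shows "t \<le> 0"
proof (rule ccontr)
  assume "\<not> t \<le> 0"
  then have t: "0 < t" by simp
  have contra: False if x: "x \<in> amax \<gamma> b" "y \<in> amax \<gamma> b" "x \<in> amax \<gamma> (b + t *\<^sub>R m)" "m \<bullet> x < m \<bullet> y" for x y b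
  proof -
    have "b \<bullet> y + t * (m \<bullet> y) \<le> b \<bullet> x + t * (m \<bullet> x)"
      using amax_le[OF x(3), of y] x(2) amax_subset by (auto simp: inner_left_distrib)
    then have "t * (m \<bullet> y) \<le> t * (m \<bullet> x)" using amax_const[OF x(1,2)] by simp
    then show False using t x(4) by simp
  qed
  have sub: "\<delta> \<subseteq> amax \<gamma> a" "\<kappa> \<subseteq> amax \<gamma> (a + v)"
    and stop: "(\<exists>x\<in>\<delta>. \<exists>y \<in> amax \<gamma> a. m \<bullet> x < m \<bullet> y) \<or> (\<exists>z\<in>\<kappa>. \<exists>y \<in> amax \<gamma> (a + v). m \<bullet> z < m \<bullet> y)"
    using assms(1) by (simp_all only: terminal_def)
  have eq: "a + t *\<^sub>R m + v = a + v + t *\<^sub>R m" by simp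
  have K: "\<kappa> \<subseteq> amax \<gamma> (a + v + t *\<^sub>R m)" using assms(3) unfolding eq .
  from stop show False
  proof (elim disjE bexE)
    fix x y assume "x \<in> \<delta>" "y \<in> amax \<gamma> a" "m \<bullet> x < m \<bullet> y"
    then show False using sub(1) assms(2) by (intro contra[where x = x and y = y and b = a]) auto
  next
    fix z y assume "z \<in> \<kappa>" "y \<in> amax \<gamma> (a + v)" "m \<bullet> z < m \<bullet> y"
    then show False using sub(2) K by (intro contra[where x = z and y = y and b = "a + v"]) auto
  qed
qed

lemma terminal_unique_in_direction:
  assumes a: "terminal a" "a \<in> direction \<gamma>" and b: "terminal b" "b \<in> direction \<gamma>"
  shows "a = b"
proof -
  have 1: "\<delta> \<subseteq> amax \<gamma> a" "\<kappa> \<subseteq> amax \<gamma> (a + v)"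
    and 2: "\<delta> \<subseteq> amax \<gamma> b" "\<kappa> \<subseteq> amax \<gamma> (b + v)"
    using a b by (auto simp: terminal_def)
  have "\<exists>t. b - a = t *\<^sub>R m"
  proof (rule normal_line)
    show "b - a \<in> direction \<gamma>" using a b by (intro subspace_diff subspace_direction)
  next
    fix x assume x: "x \<in> direction \<delta>"
    show "(b - a) \<bullet> x = 0"
    proof (rule const_orthogonal_direction[OF _ x])
      fix x y assume "x \<in> \<delta>" "y \<in> \<delta>"
      then have "a \<bullet> x = a \<bullet> y" "b \<bullet> x = b \<bullet> y"
        using amax_const 1(1) 2(1) by blast+
      then show "(b - a) \<bullet> x = (b - a) \<bullet> y" by (simp add: inner_diff_left)
    qed
  next
    fix x assume x: "x \<in> direction \<kappa>"
    show "(b - a) \<bullet> x = 0"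
    proof (rule const_orthogonal_direction[OF _ x])
      fix x y assume "x \<in> \<kappa>" "y \<in> \<kappa>"
      then have "(a + v) \<bullet> x = (a + v) \<bullet> y" "(b + v) \<bullet> x = (b + v) \<bullet> y"
        using amax_const 1(2) 2(2) by blast+
      then show "(b - a) \<bullet> x = (b - a) \<bullet> y" by (simp add: inner_diff_left inner_left_distrib)
    qed
  qed
  then obtain t where t: "b - a = t *\<^sub>R m" by blast
  then have b': "b = a + t *\<^sub>R m" and a': "a = b + (- t) *\<^sub>R m" by (auto simp: algebra_simps)
  have "t \<le> 0" using terminal_maximal[OF a(1), of t] 2 b' by simp
  moreover have "- t \<le> 0" using terminal_maximal[OF b(1), of "- t"] 1 a' by simp
  ultimately show ?thesis using b' by simp
qed

text \<open>
  Functionals that agree on \<open>direction \<gamma>\<close> have the same maximal faces, so only these faces, not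
  \<open>a\<close> itself, are unique.
\<close>

lemma terminal_unique:
  assumes a: "terminal a" and b: "terminal b"
  shows "amax \<gamma> a = amax \<gamma> b" "amax \<gamma> (a + v) = amax \<gamma> (b + v)"
proof -
  obtain a0 where a0: "a0 \<in> direction \<gamma>" "\<And>x. amax \<gamma> (a + x) = amax \<gamma> (a0 + x)"
    using amax_project[of \<gamma> a] by blast
  obtain b0 where b0: "b0 \<in> direction \<gamma>" "\<And>x. amax \<gamma> (b + x) = amax \<gamma> (b0 + x)"
    using amax_project[of \<gamma> b] by blast
  have "terminal a0" "terminal b0"
    using a b a0(2)[of 0] a0(2)[of v] b0(2)[of 0] b0(2)[of v] by (simp_all add: terminal_def)
  then have "a0 = b0" using a0 b0 terminal_unique_in_direction by blast
  then show "amax \<gamma> a = amax \<gamma> b" "amax \<gamma> (a + v) = amax \<gamma> (b + v)"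
    using a0(2)[of 0] a0(2)[of v] b0(2)[of 0] b0(2)[of v] by simp_all
qed

text \<open>
  A facet \<open>\<delta>\<close> of \<open>\<delta>'\<close> with \<open>m\<close> negative on the outward normal leaves points of \<open>\<delta>'\<close> where \<open>m\<close> is
  larger than on \<open>\<delta>\<close>; so every functional that links \<open>\<delta>'\<close> and \<open>\<kappa>\<close> is terminal.
\<close>

lemma inner_end_terminal:
  assumes "\<delta>' \<in> inner_ends v \<gamma> \<delta> \<kappa> m"
  obtains a where "terminal a" "\<delta>' \<subseteq> amax \<gamma> a"
proof -
  have f: "\<delta> facet_of \<delta>'" and l: "linked v \<gamma> \<delta>' \<kappa>" and neg: "m \<bullet> outward_normal \<delta>' \<delta> < 0"
    using assms by (auto simp: inner_ends_def)
  obtain x y where xy: "x \<in> \<delta>" "y \<in> \<delta>' - \<delta>" "outward_normal \<delta>' \<delta> = x - y"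
    using outward_normal_obtain[OF f] .
  have "\<delta> \<subseteq> \<delta>'" using f by (auto simp: facet_of_def dest: face_of_imp_subset)
  moreover obtain a where a: "\<delta>' \<subseteq> amax \<gamma> a" "\<kappa> \<subseteq> amax \<gamma> (a + v)"
    using l unfolding linked_def by blast
  moreover have "m \<bullet> x < m \<bullet> y" using neg xy(3) by (simp add: inner_diff_right)
  ultimately have "terminal a" using xy unfolding terminal_def by blast
  then show thesis using that a by blast
qed

lemma terminal_swap: "wall.terminal \<gamma> (- v) \<kappa> \<delta> m (a + v) \<longleftrightarrow> terminal a"
  unfolding wall.terminal_def[OF wall_swap] terminal_def by auto

text \<open>
  Genericity bounds the sum of the dimensions of the two maximal faces by \<open>dim \<gamma>\<close>, which is only
  one more than that of \<open>\<delta>\<close> and \<open>\<kappa>\<close>. So if \<open>\<delta>\<close> grows, it grows by one dimension and \<open>\<kappa>\<close> does not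
  grow.
\<close>

lemma terminal_inner_end:
  assumes a: "terminal a" and ne: "amax \<gamma> a \<noteq> \<delta>"
  shows "inner_ends v \<gamma> \<delta> \<kappa> m = {amax \<gamma> a}" "inner_ends (- v) \<gamma> \<kappa> \<delta> m = {}"
proof -
  let ?D = "amax \<gamma> a" and ?K = "amax \<gamma> (a + v)"
  have sub: "\<delta> \<subseteq> ?D" "\<kappa> \<subseteq> ?K" using a by (auto simp: terminal_def)
  have fD: "?D face_of \<gamma>" "?K face_of \<gamma>" using face_of_amax[OF convex_cell] by auto
  have fd: "\<delta> face_of ?D" "\<kappa> face_of ?K"
    by (rule face_of_subset[OF faces(1) sub(1) amax_subset], rule face_of_subset[OF faces(2) sub(2) amax_subset])
  have neD: "?D \<noteq> {}" "?K \<noteq> {}" using sub faces by auto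
  have cv: "convex ?D" "convex ?K" using fD face_of_imp_convex convex_cell by blast+
  have "direction ?D \<inter> direction ?K \<subseteq> {0}" using generic by (simp add: generic_def)
  then have z: "direction ?D \<inter> direction ?K = {0}"
    using subspace_0[OF subspace_direction] by blast
  have "dim (direction ?D) + dim (direction ?K) \<le> dim (direction \<gamma>)"
    by (intro dim_direct_sum_le subspace_direction z direction_mono amax_subset)
  moreover have "dim (direction \<delta>) < dim (direction ?D)"
    using face_of_aff_dim_lt[OF cv(1) fd(1)] ne aff_dim_direction[OF neD(1)] aff_dim_direction[OF faces(3)] by auto
  moreover have "dim (direction \<kappa>) \<le> dim (direction ?K)"
    by (intro dim_subset direction_mono sub)
  ultimately have dD: "dim (direction ?D) = dim (direction \<delta>) + 1"
    and dK: "dim (direction ?K) = dim (direction \<kappa>)" using dims by linarith+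
  have "?K = \<kappa>"
    using face_of_aff_dim_lt[OF cv(2) fd(2)] dK aff_dim_direction[OF neD(2)] aff_dim_direction[OF faces(4)] by auto
  have facet: "\<delta> facet_of ?D"
    using fd(1) faces(3) dD aff_dim_direction[OF neD(1)] aff_dim_direction[OF faces(3)] by (simp add: facet_of_def)
  have mK: "m \<bullet> y = m \<bullet> z" if "y \<in> \<kappa>" "z \<in> \<kappa>" for y z
    using orthogonal_direction_const[OF m_orth(2)] that by blast
  have mD: "m \<bullet> y = m \<bullet> z" if "y \<in> \<delta>" "z \<in> \<delta>" for y z
    using orthogonal_direction_const[OF m_orth(1)] that by blast
  have "\<not> (\<exists>z\<in>\<kappa>. \<exists>y\<in>?K. m \<bullet> z < m \<bullet> y)"
  proof
    assume "\<exists>z\<in>\<kappa>. \<exists>y\<in>?K. m \<bullet> z < m \<bullet> y"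
    then obtain z y where "z \<in> \<kappa>" "y \<in> \<kappa>" "m \<bullet> z < m \<bullet> y" using \<open>?K = \<kappa>\<close> by blast
    then show False using mK[of z y] by simp
  qed
  then obtain x y where xy: "x \<in> \<delta>" "y \<in> ?D" "m \<bullet> x < m \<bullet> y"
    using a unfolding terminal_def by blast
  have "y \<notin> \<delta>" using mD[OF _ xy(1), of y] xy(3) by auto
  then have y: "y \<in> ?D - \<delta>" using xy(2) by simp
  obtain x' y' where xy': "x' \<in> \<delta>" "y' \<in> ?D - \<delta>" "outward_normal ?D \<delta> = x' - y'"
    using outward_normal_obtain[OF facet] .
  have "polyhedron ?D" using face_of_polyhedron_polyhedron polyhedron_cell fD(1) by blast
  then obtain k h where k: "k > 0" "h \<in> direction \<delta>" "x - y = h + k *\<^sub>R (x' - y')"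
    "x' - y' \<notin> direction \<delta>"
    by (rule facet_side[OF _ facet xy(1) y xy'(1,2)])
  have "m \<bullet> (x - y) = k * (m \<bullet> (x' - y'))"
    using k m_orth(1) by (simp add: inner_right_distrib)
  moreover have "m \<bullet> (x - y) < 0" using xy(3) by (simp add: inner_diff_right)
  ultimately have "m \<bullet> outward_normal ?D \<delta> < 0"
    using k(1) xy'(3) by (simp add: mult_less_0_iff)
  moreover have "linked v \<gamma> ?D \<kappa>" using sub unfolding linked_def by blast
  ultimately have mem: "?D \<in> inner_ends v \<gamma> \<delta> \<kappa> m"
    using fD facet by (simp add: inner_ends_def)
  have uniq: "D' = ?D" if D': "D' \<in> inner_ends v \<gamma> \<delta> \<kappa> m" for D'
  proof -
    obtain b where b: "terminal b" "D' \<subseteq> amax \<gamma> b" using inner_end_terminal[OF D'] .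
    then have s: "D' \<subseteq> ?D" using terminal_unique[OF b(1) a] by simp
    have f: "D' face_of \<gamma>" "\<delta> facet_of D'" using D' by (auto simp: inner_ends_def)
    then have "D' face_of ?D" using s amax_subset face_of_subset by blast
    moreover have "aff_dim D' = aff_dim ?D" using f(2) facet by (simp add: facet_of_def)
    ultimately show ?thesis using face_of_aff_dim_lt[OF cv(1)] by force
  qed
  show "inner_ends v \<gamma> \<delta> \<kappa> m = {?D}" using mem uniq by blast
  show "inner_ends (- v) \<gamma> \<kappa> \<delta> m = {}"
  proof (rule ccontr)
    assume "inner_ends (- v) \<gamma> \<kappa> \<delta> m \<noteq> {}"
    then obtain K' where K': "K' \<in> inner_ends (- v) \<gamma> \<kappa> \<delta> m" by blast
    obtain b where b: "wall.terminal \<gamma> (- v) \<kappa> \<delta> m b" "K' \<subseteq> amax \<gamma> b"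
      using wall.inner_end_terminal[OF wall_swap K'] .
    have "terminal (b - v)" using b(1) terminal_swap[of "b - v"] by simp
    from terminal_unique(2)[OF this a] have "K' \<subseteq> \<kappa>" using b(2) \<open>?K = \<kappa>\<close> by simp
    moreover have "\<kappa> facet_of K'" using K' by (simp add: inner_ends_def)
    then have "\<kappa> \<subseteq> K'" "aff_dim \<kappa> \<noteq> aff_dim K'" by (auto simp: facet_of_def dest: face_of_imp_subset)
    ultimately show False by auto
  qed
qed

text \<open>
  A facet that contains both faces has a normal orthogonal to both, that is, a multiple of \<open>m\<close>;
  the sign of its outward normal makes the multiple positive. Conversely, the face of maximal \<open>m\<close>
  has dimension at least \<open>dim \<delta> + dim \<kappa> = dim \<gamma> - 1\<close> if it contains both faces.
\<close>

lemma outer_end_iff: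
  "outer_ends v \<gamma> \<delta> \<kappa> m = (if \<delta> \<union> \<kappa> \<subseteq> amax \<gamma> m then {amax \<gamma> m} else {})"
proof -
  have uniq: "\<mu> = amax \<gamma> m \<and> \<delta> \<union> \<kappa> \<subseteq> amax \<gamma> m" if \<mu>: "\<mu> \<in> outer_ends v \<gamma> \<delta> \<kappa> m" for \<mu>
  proof -
    have f: "\<mu> facet_of \<gamma>" and sub: "\<delta> \<subseteq> \<mu>" "\<kappa> \<subseteq> \<mu>" and pos: "0 < m \<bullet> outward_normal \<gamma> \<mu>"
      using \<mu> by (auto simp: outer_ends_def)
    have "\<mu> face_of \<gamma>" "\<mu> \<noteq> {}" using f by (auto simp: facet_of_def)
    then obtain c where c: "c \<in> direction \<gamma>" "\<mu> = amax \<gamma> c"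
      using exposed_amax[OF polyhedron_cell] by blast
    have orth: "c \<bullet> u = 0" if "u \<in> direction \<mu>" for u
      by (rule const_orthogonal_direction[OF _ that]) (use c(2) amax_const in blast)
    then obtain t where t: "c = t *\<^sub>R m"
      using normal_line[OF c(1)] direction_mono[OF sub(1)] direction_mono[OF sub(2)] by blast
    obtain x y where xy: "x \<in> \<mu>" "y \<in> \<gamma> - \<mu>" "outward_normal \<gamma> \<mu> = x - y"
      using outward_normal_obtain[OF f] .
    have "c \<bullet> y < c \<bullet> x"
      using xy(1,2) amax_le[of x \<gamma> c y] amax_eqI[of x \<gamma> c y] unfolding c(2) by (auto simp: less_le)
    then have "0 < t * (m \<bullet> (x - y))" using t by (simp add: inner_diff_right algebra_simps)
    then have "t > 0" using pos xy(3) by (simp add: zero_less_mult_iff)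
    then have "amax \<gamma> c = amax \<gamma> m" unfolding t by (simp add: amax_def)
    then show ?thesis using c sub by simp
  qed
  moreover have "amax \<gamma> m \<in> outer_ends v \<gamma> \<delta> \<kappa> m" if sub: "\<delta> \<union> \<kappa> \<subseteq> amax \<gamma> m"
  proof -
    let ?\<mu> = "amax \<gamma> m"
    have fo: "?\<mu> face_of \<gamma>" using face_of_amax[OF convex_cell] .
    have ne: "?\<mu> \<noteq> {}" "\<gamma> \<noteq> {}" using sub faces amax_subset by auto
    have "dim (direction \<delta>) + dim (direction \<kappa>) \<le> dim (direction ?\<mu>)"
      using sub by (intro dim_direct_sum_le subspace_direction generic_linked[OF generic linked] direction_mono) auto
    moreover have "direction ?\<mu> \<noteq> direction \<gamma>"
    proof
      assume "direction ?\<mu> = direction \<gamma>"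
      then have "m \<bullet> m = 0"
        using const_orthogonal_direction[of ?\<mu> m m] amax_const[of _ \<gamma> m] m(1) by blast
      then show False using m(2) by simp
    qed
    then have "dim (direction ?\<mu>) < dim (direction \<gamma>)"
      using subspace_dim_equal[OF subspace_direction subspace_direction direction_mono[OF amax_subset]]
      by (metis not_le)
    ultimately have "dim (direction \<gamma>) = dim (direction ?\<mu>) + 1" using dims by linarith
    then have facet: "?\<mu> facet_of \<gamma>"
      using fo ne aff_dim_direction[OF ne(1)] aff_dim_direction[OF ne(2)] by (simp add: facet_of_def)
    obtain x y where xy: "x \<in> ?\<mu>" "y \<in> \<gamma> - ?\<mu>" "outward_normal \<gamma> ?\<mu> = x - y"
      using outward_normal_obtain[OF facet] .
    have "m \<bullet> y < m \<bullet> x"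
      using xy(1,2) amax_le[of x \<gamma> m y] amax_eqI[of x \<gamma> m y] by (auto simp: less_le)
    then have "0 < m \<bullet> outward_normal \<gamma> ?\<mu>" using xy(3) by (simp add: inner_diff_right)
    moreover have "linked v ?\<mu> \<delta> \<kappa>" using linked_face[OF linked amax_subset] sub by blast
    ultimately show ?thesis using facet sub by (simp add: outer_ends_def)
  qed
  ultimately show ?thesis by auto
qed

text \<open>
  If \<open>m\<close> is maximal on both faces, the motion in the direction \<open>m\<close> never stops and the end is the
  facet at infinity. Otherwise it stops at a terminal functional, where exactly one of the faces
  grows.
\<close>

lemma unique_end:
  "(\<exists>\<mu>. outer_ends v \<gamma> \<delta> \<kappa> m = {\<mu>}) \<and> inner_ends v \<gamma> \<delta> \<kappa> m = {} \<and> inner_ends (- v) \<gamma> \<kappa> \<delta> m = {} \<or>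
   outer_ends v \<gamma> \<delta> \<kappa> m = {} \<and> (\<exists>\<delta>'. inner_ends v \<gamma> \<delta> \<kappa> m = {\<delta>'}) \<and> inner_ends (- v) \<gamma> \<kappa> \<delta> m = {} \<or>
   outer_ends v \<gamma> \<delta> \<kappa> m = {} \<and> inner_ends v \<gamma> \<delta> \<kappa> m = {} \<and> (\<exists>\<kappa>'. inner_ends (- v) \<gamma> \<kappa> \<delta> m = {\<kappa>'})"
proof (cases "\<delta> \<union> \<kappa> \<subseteq> amax \<gamma> m")
  case True
  have noT: False if f: "D facet_of D'" "D' \<subseteq> \<gamma>" "D \<subseteq> amax \<gamma> m" "m \<bullet> outward_normal D' D < 0" for D D'
  proof -
    obtain x y where "x \<in> D" "y \<in> D' - D" "outward_normal D' D = x - y"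
      using outward_normal_obtain[OF f(1)] .
    then show False using f(2-4) amax_le[of x \<gamma> m y] by (auto simp: inner_diff_right)
  qed
  have "inner_ends v \<gamma> \<delta> \<kappa> m = {}" "inner_ends (- v) \<gamma> \<kappa> \<delta> m = {}"
    using noT[of \<delta>] noT[of \<kappa>] True face_of_imp_subset unfolding inner_ends_def by blast+
  then show ?thesis using True outer_end_iff by simp
next
  case False
  obtain a where a: "\<delta> \<subseteq> amax \<gamma> a" "\<kappa> \<subseteq> amax \<gamma> (a + v)"
    using linked unfolding linked_def by blast
  obtain x0 z0 where xz: "x0 \<in> \<delta>" "z0 \<in> \<kappa>" using faces by blast
  have "\<exists>x\<in>\<gamma>. m \<bullet> x0 < m \<bullet> x \<or> m \<bullet> z0 < m \<bullet> x"
  proof (rule ccontr)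
    assume no: "\<not> ?thesis"
    have "m \<bullet> x = m \<bullet> x0" if "x \<in> \<delta>" for x
      using orthogonal_direction_const[OF m_orth(1) that xz(1)] .
    moreover have "m \<bullet> x = m \<bullet> z0" if "x \<in> \<kappa>" for x
      using orthogonal_direction_const[OF m_orth(2) that xz(2)] .
    ultimately have "\<delta> \<union> \<kappa> \<subseteq> amax \<gamma> m"
      using no faces(1,2)[THEN face_of_imp_subset] by (auto simp: amax_def not_less)
    then show False using False by simp
  qed
  then obtain x where x: "x \<in> \<gamma>" "m \<bullet> x0 < m \<bullet> x \<or> m \<bullet> z0 < m \<bullet> x" by blast
  obtain t where t: "x0 \<in> amax \<gamma> (a + t *\<^sub>R m)" "z0 \<in> amax \<gamma> (a + v + t *\<^sub>R m)"
    and st: "(\<exists>y \<in> amax \<gamma> (a + t *\<^sub>R m). m \<bullet> x0 < m \<bullet> y) \<or> (\<exists>y \<in> amax \<gamma> (a + v + t *\<^sub>R m). m \<bullet> z0 < m \<bullet> y)"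
    using ray_endpoint[OF polytope subsetD[OF a(1) xz(1)] subsetD[OF a(2) xz(2)] x] by blast
  define b where "b = a + t *\<^sub>R m"
  have bv: "a + v + t *\<^sub>R m = b + v" by (simp add: b_def)
  have "\<delta> \<subseteq> amax \<gamma> b"
    unfolding b_def by (rule amax_extend[OF a(1) xz(1) m_orth(1) t(1)])
  moreover have "\<kappa> \<subseteq> amax \<gamma> (b + v)"
    unfolding bv[symmetric] by (rule amax_extend[OF a(2) xz(2) m_orth(2) t(2)])
  ultimately have T: "terminal b"
    using st xz unfolding bv b_def[symmetric] terminal_def by blast
  have mc: "m \<bullet> x = m \<bullet> y" if "x \<in> \<delta> \<and> y \<in> \<delta> \<or> x \<in> \<kappa> \<and> y \<in> \<kappa>" for x y
    using that orthogonal_direction_const[of \<delta> m x y, OF m_orth(1)]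
      orthogonal_direction_const[of \<kappa> m x y, OF m_orth(2)] by blast
  have "amax \<gamma> b \<noteq> \<delta> \<or> amax \<gamma> (b + v) \<noteq> \<kappa>"
    using T mc unfolding terminal_def by (metis less_irrefl)
  moreover have out: "outer_ends v \<gamma> \<delta> \<kappa> m = {}" using False outer_end_iff by simp
  ultimately show ?thesis
  proof (elim disjE)
    assume "amax \<gamma> b \<noteq> \<delta>"
    from terminal_inner_end[OF T this] out show ?thesis by simp
  next
    assume ne: "amax \<gamma> (b + v) \<noteq> \<kappa>"
    have "wall.terminal \<gamma> (- v) \<kappa> \<delta> m (b + v)" using T terminal_swap by simp
    from wall.terminal_inner_end[OF wall_swap this ne] out show ?thesis by simp
  qed
qed

end

section \<open>Convenient points are generic\<close>

text \<open>
  The functional on \<open>E\<close> given by a vector. It identifies \<open>E\<close> with \<open>dual_space E\<close>, so that dual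
  cones become sets of vectors.
\<close>

abbreviation inner_functional :: "'a::real_inner set \<Rightarrow> 'a \<Rightarrow> 'a \<Rightarrow> real" where
  "inner_functional E a \<equiv> restrict_functional E (\<lambda>x. a \<bullet> x)"

lemma linear_inner_functional: "linear (inner_functional E)"
  by (rule linearI) (auto simp: restrict_functional_def fun_eq_iff scaleR_fun_def inner_left_distrib)

lemma inner_functional_eq_iff:
  "inner_functional E a = inner_functional E b \<longleftrightarrow> (\<forall>x\<in>E. a \<bullet> x = b \<bullet> x)"
  by (auto simp: restrict_functional_def fun_eq_iff)

lemma inj_on_inner_functional:
  assumes "subspace E"
  shows "inj_on (inner_functional E) E"
proof (rule inj_onI)
  fix a b assume ab: "a \<in> E" "b \<in> E" "inner_functional E a = inner_functional E b"
  then have "a \<bullet> (a - b) = b \<bullet> (a - b)"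
    using subspace_diff[OF assms] inner_functional_eq_iff[of E a b] by blast
  then have "(a - b) \<bullet> (a - b) = 0" by (simp add: inner_diff_left)
  then show "a = b" by simp
qed

lemma inner_functional_project:
  fixes E :: "'a::euclidean_space set"
  assumes "subspace E"
  obtains b where "b \<in> E" "inner_functional E b = inner_functional E a"
  using project_inner[OF assms, of a] inner_functional_eq_iff[of E _ a] by metis

lemma dual_space_representation:
  fixes E :: "'a::euclidean_space set"
  assumes E: "subspace E" and w: "w \<in> dual_space E"
  obtains a where "w = inner_functional E a"
proof -
  obtain B where B: "B \<subseteq> E" "pairwise orthogonal B" "\<And>x. x \<in> B \<Longrightarrow> norm x = 1"
    "independent B" "span B = E"
    using orthonormal_basis_subspace[OF E] by metis
  have fin: "finite B" using B(4) by (rule finiteI_independent)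
  define a where "a = (\<Sum>b\<in>B. w b *\<^sub>R b)"
  have "a \<bullet> c = w c" if c: "c \<in> B" for c
  proof -
    have "b \<bullet> c = (if b = c then 1 else 0)" if "b \<in> B" for b
      using B(2,3) c that by (auto simp: pairwise_def orthogonal_def norm_eq_1)
    then have "(\<Sum>b\<in>B. w b * (b \<bullet> c)) = (\<Sum>b\<in>B. if b = c then w b else 0)"
      by (intro sum.cong) auto
    then show ?thesis using c fin by (simp add: a_def inner_sum_left)
  qed
  moreover have add: "w (x + y) = w x + w y" "w (k *\<^sub>R x) = k * w x" if "x \<in> E" "y \<in> E" for x y k
    using w that by (auto simp: dual_space_def)
  have "w 0 = 0" using add(2)[of 0 0 0] subspace_0[OF E] by simp
  then have "subspace {x \<in> E. a \<bullet> x = w x}"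
    using E add by (auto simp: subspace_def inner_right_distrib)
  ultimately have "span B \<subseteq> {x \<in> E. a \<bullet> x = w x}"
    using B(1) by (intro span_minimal) auto
  then have "w x = inner_functional E a x" for x
    using B(5) w by (auto simp: restrict_functional_def dual_space_def)
  then show thesis using that by blast
qed

lemma dual_space_eq_image:
  fixes E :: "'a::euclidean_space set"
  assumes E: "subspace E"
  shows "dual_space E = inner_functional E ` E"
proof
  show "dual_space E \<subseteq> inner_functional E ` E"
  proof
    fix w assume "w \<in> dual_space E"
    then obtain a where "w = inner_functional E a" using dual_space_representation[OF E] by blast
    moreover obtain b where "b \<in> E" "inner_functional E b = inner_functional E a"
      using inner_functional_project[OF E] by blast
    ultimately show "w \<in> inner_functional E ` E" by (metis imageI)
  qed
  show "inner_functional E ` E \<subseteq> dual_space E"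
    using E by (auto simp: dual_space_def restrict_functional_def subspace_add subspace_scale inner_right_distrib)
qed

lemma dual_cone_eq_image:
  fixes \<gamma> :: "'a::euclidean_space set"
  assumes "\<gamma> \<noteq> {}" "\<delta> \<subseteq> \<gamma>"
  shows "dual_cone \<gamma> \<delta> = inner_functional (direction \<gamma>) ` {a \<in> direction \<gamma>. \<delta> \<subseteq> amax \<gamma> a}"
proof -
  have "(\<forall>c\<in>\<gamma>. \<forall>x\<in>\<delta>. \<forall>y\<in>\<gamma>. inner_functional (direction \<gamma>) a (y - c) \<le> inner_functional (direction \<gamma>) a (x - c))
     \<longleftrightarrow> \<delta> \<subseteq> amax \<gamma> a" for a
  proof -
    have f: "inner_functional (direction \<gamma>) a (y - c) = a \<bullet> y - a \<bullet> c" if "y \<in> \<gamma>" "c \<in> \<gamma>" for y c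
      using diff_in_direction[OF that] by (simp add: restrict_functional_def inner_diff_right)
    show ?thesis
    proof (intro iffI ballI subsetI)
      fix x assume le: "\<forall>c\<in>\<gamma>. \<forall>x\<in>\<delta>. \<forall>y\<in>\<gamma>. inner_functional (direction \<gamma>) a (y - c) \<le>
          inner_functional (direction \<gamma>) a (x - c)" and x: "x \<in> \<delta>"
      have "a \<bullet> y \<le> a \<bullet> x" if "y \<in> \<gamma>" for y
        using le[rule_format, of x x y] f[of y x] f[of x x] that x assms(2) by auto
      then show "x \<in> amax \<gamma> a" using x assms(2) by (auto simp: amax_def)
    next
      fix c x y assume "\<delta> \<subseteq> amax \<gamma> a" and mem: "c \<in> \<gamma>" "x \<in> \<delta>" "y \<in> \<gamma>"
      then have "x \<in> \<gamma>" "a \<bullet> y \<le> a \<bullet> x" using assms(2) amax_le[of x \<gamma> a y] by auto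
      then show "inner_functional (direction \<gamma>) a (y - c) \<le> inner_functional (direction \<gamma>) a (x - c)"
        using f mem by simp
    qed
  qed
  then show ?thesis
    unfolding dual_cone_def dual_space_eq_image[OF subspace_direction] by blast
qed

lemma linked_iff_dual_cones_meet:
  fixes \<gamma> :: "'a::euclidean_space set"
  assumes "\<gamma> \<noteq> {}" "\<delta> \<subseteq> \<gamma>" "\<kappa> \<subseteq> \<gamma>"
  shows "translate (inner_functional (direction \<gamma>) v) (dual_cone \<gamma> \<delta>) \<inter> dual_cone \<gamma> \<kappa> \<noteq> {}
    \<longleftrightarrow> linked v \<gamma> \<delta> \<kappa>"
proof -
  let ?E = "direction \<gamma>"
  let ?f = "inner_functional ?E"
  have f: "?f v + ?f a = ?f b \<longleftrightarrow> (\<forall>u\<in>?E. (a + v) \<bullet> u = b \<bullet> u)" for a b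
  proof -
    have "?f v + ?f a = ?f (a + v)"
      using linear_add[OF linear_inner_functional[of ?E], of a v] by (simp add: add.commute)
    then show ?thesis using inner_functional_eq_iff[of ?E "a + v" b] by simp
  qed
  show ?thesis
  proof
    assume "translate (?f v) (dual_cone \<gamma> \<delta>) \<inter> dual_cone \<gamma> \<kappa> \<noteq> {}"
    then obtain a b where ab: "\<delta> \<subseteq> amax \<gamma> a" "\<kappa> \<subseteq> amax \<gamma> b" "?f v + ?f a = ?f b"
      using assms by (auto simp: translate_def dual_cone_eq_image)
    then have "amax \<gamma> (a + v) = amax \<gamma> b" by (intro amax_cong) (simp add: f)
    then show "linked v \<gamma> \<delta> \<kappa>" using ab unfolding linked_def by blast
  next
    assume "linked v \<gamma> \<delta> \<kappa>"
    then obtain a where a: "a \<in> ?E" "\<delta> \<subseteq> amax \<gamma> a" "\<kappa> \<subseteq> amax \<gamma> (a + v)"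
      by (rule linked_obtain_direction)
    obtain b where b: "b \<in> ?E" "?f b = ?f (a + v)"
      using inner_functional_project[OF subspace_direction] by blast
    then have "amax \<gamma> (a + v) = amax \<gamma> b"
      using inner_functional_eq_iff[of ?E b "a + v"] by (intro amax_cong) simp
    then have "?f b \<in> ?f ` {a \<in> ?E. \<kappa> \<subseteq> amax \<gamma> a}" "?f a \<in> ?f ` {a \<in> ?E. \<delta> \<subseteq> amax \<gamma> a}"
      using imageI[of b "{a \<in> ?E. \<kappa> \<subseteq> amax \<gamma> a}" ?f] imageI[of a "{a \<in> ?E. \<delta> \<subseteq> amax \<gamma> a}" ?f] a b
      by simp_all
    then have "?f b \<in> dual_cone \<gamma> \<kappa>" "?f a \<in> dual_cone \<gamma> \<delta>"
      by (simp_all only: dual_cone_eq_image[OF assms(1,2)] dual_cone_eq_image[OF assms(1,3)])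
    moreover have "?f b = ?f v + ?f a"
      using f[of a b] inner_functional_eq_iff[of ?E b "a + v"] b by auto
    ultimately show "translate (?f v) (dual_cone \<gamma> \<delta>) \<inter> dual_cone \<gamma> \<kappa> \<noteq> {}"
      unfolding translate_def by blast
  qed
qed

lemma direction_contains_0:
  assumes "0 \<in> C" shows "direction C = span C"
proof
  show "direction C \<subseteq> span C"
    by (rule direction_minimal) (auto intro: span_diff span_base)
  show "span C \<subseteq> direction C"
    using diff_in_direction[OF _ assms] by (intro span_minimal subspace_direction) auto
qed

lemma direction_translate: "direction (translate u C) = direction C"
proof -
  have "{x - y |x y. x \<in> translate u C \<and> y \<in> translate u C} = {x - y |x y. x \<in> C \<and> y \<in> C}"
  proof (intro subset_antisym subsetI)
    fix w assume "w \<in> {x - y |x y. x \<in> translate u C \<and> y \<in> translate u C}"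
    then obtain x y where "x \<in> C" "y \<in> C" "w = (u + x) - (u + y)"
      unfolding translate_def by blast
    then show "w \<in> {x - y |x y. x \<in> C \<and> y \<in> C}" by simp blast
  next
    fix w assume "w \<in> {x - y |x y. x \<in> C \<and> y \<in> C}"
    then obtain x y where "x \<in> C" "y \<in> C" "w = (u + x) - (u + y)" by auto
    then show "w \<in> {x - y |x y. x \<in> translate u C \<and> y \<in> translate u C}"
      unfolding translate_def by blast
  qed
  then show ?thesis by (simp add: direction_def)
qed

lemma direction_dual_cone:
  fixes \<gamma> :: "'a::euclidean_space set"
  assumes "\<gamma> \<noteq> {}" "\<delta> \<subseteq> \<gamma>"
  defines "P \<equiv> span {a \<in> direction \<gamma>. \<delta> \<subseteq> amax \<gamma> a}"
  shows "direction (dual_cone \<gamma> \<delta>) = inner_functional (direction \<gamma>) ` P"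
    and "dim (direction (dual_cone \<gamma> \<delta>)) = dim P"
    and "P \<subseteq> direction \<gamma>" and "\<And>w u. w \<in> P \<Longrightarrow> u \<in> direction \<delta> \<Longrightarrow> w \<bullet> u = 0"
proof -
  let ?f = "inner_functional (direction \<gamma>)" and ?P = "{a \<in> direction \<gamma>. \<delta> \<subseteq> amax \<gamma> a}"
  have 0: "?f 0 = 0" using linear_0[OF linear_inner_functional] .
  have "0 \<in> ?P" using assms(2) subspace_0[OF subspace_direction] by (auto simp: amax_def)
  then have "?f 0 \<in> dual_cone \<gamma> \<delta>"
    unfolding dual_cone_eq_image[OF assms(1,2)] by (rule imageI)
  then have "0 \<in> dual_cone \<gamma> \<delta>" unfolding 0 .
  then show 1: "direction (dual_cone \<gamma> \<delta>) = ?f ` P"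
    by (simp add: direction_contains_0 dual_cone_eq_image[OF assms(1,2)] P_def
        linear_span_image[OF linear_inner_functional])
  show 2: "P \<subseteq> direction \<gamma>" unfolding P_def by (rule span_minimal) (auto simp: subspace_direction)
  have sp: "span P = P" unfolding P_def by (rule span_span)
  have "inj_on ?f (span P)"
    unfolding sp by (rule inj_on_subset[OF inj_on_inner_functional[OF subspace_direction] 2])
  then show "dim (direction (dual_cone \<gamma> \<delta>)) = dim P"
    unfolding 1 by (rule dim_image_eq[OF linear_inner_functional])
  fix w u assume w: "w \<in> P" and u: "u \<in> direction \<delta>"
  have "?P \<subseteq> {w. u \<bullet> w = 0}"
  proof
    fix a assume a: "a \<in> ?P"
    have "a \<bullet> u = 0"
      by (rule const_orthogonal_direction[OF _ u]) (use a amax_const in blast)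
    then show "a \<in> {w. u \<bullet> w = 0}" by (simp add: inner_commute)
  qed
  then have "P \<subseteq> {w. u \<bullet> w = 0}" unfolding P_def by (intro span_minimal subspace_hyperplane)
  then show "w \<bullet> u = 0" using w by (auto simp: inner_commute)
qed

text \<open>
  Transversality is applied at a vertex \<open>b\<close> of the polyhedron of functionals that link the two
  faces. There the spans \<open>P\<close>, \<open>Q\<close> of the dual cones meet in \<open>0\<close>, so \<open>dim P + dim Q \<le> dim \<gamma>\<close> and
  the cones lie in skeleta to which the hypothesis applies, with \<open>q = dim P\<close> and \<open>p = dim \<gamma> - q\<close>.
  Transversality turns the inequality into an equality, so \<open>P\<close> and \<open>Q\<close> together span everything. A
  vector in both directions is orthogonal to \<open>P\<close> and to \<open>Q\<close>, hence zero. The original faces are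
  contained in those at the vertex.
\<close>

lemma convenient_imp_generic:
  fixes \<gamma> :: "'a::euclidean_space set"
  assumes v: "v \<in> convenient V X" and \<gamma>: "\<gamma> \<in> X" "polytope \<gamma>" "\<gamma> \<noteq> {}"
    and v': "restrict_functional (direction \<gamma>) v = inner_functional (direction \<gamma>) v'"
  shows "generic v' \<gamma>"
  unfolding generic_def
proof
  fix a0
  let ?E = "direction \<gamma>"
  let ?f = "inner_functional ?E"
  have cpt: "compact \<gamma>" using \<gamma>(2) by (rule polytope_imp_compact)
  have ne: "amax \<gamma> a \<noteq> {}" for a
  proof -
    have "\<exists>x\<in>\<gamma>. \<forall>y\<in>\<gamma>. a \<bullet> y \<le> a \<bullet> x"
      using continuous_attains_sup[OF cpt \<gamma>(3), of "\<lambda>x. a \<bullet> x"] by (simp add: continuous_intros)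
    then show ?thesis by (auto simp: amax_def)
  qed
  obtain b where b: "amax \<gamma> a0 \<subseteq> amax \<gamma> b" "amax \<gamma> (a0 + v') \<subseteq> amax \<gamma> (b + v')"
    and vertex: "\<And>w. w \<in> ?E \<Longrightarrow> (\<forall>u \<in> direction (amax \<gamma> b) \<union> direction (amax \<gamma> (b + v')). w \<bullet> u = 0) \<Longrightarrow> w = 0"
    using linked_vertex_exists[OF \<gamma>(2) ne ne, of a0 v'] by metis
  define D where "D = amax \<gamma> b"
  define K where "K = amax \<gamma> (b + v')"
  define P where "P = span {a \<in> ?E. D \<subseteq> amax \<gamma> a}"
  define Q where "Q = span {a \<in> ?E. K \<subseteq> amax \<gamma> a}"
  have sub: "D \<subseteq> \<gamma>" "K \<subseteq> \<gamma>" using amax_subset by (auto simp: D_def K_def)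
  have face: "D face_of \<gamma>" "K face_of \<gamma>" "D \<noteq> {}" "K \<noteq> {}"
    using face_of_amax polytope_imp_convex[OF \<gamma>(2)] ne by (auto simp: D_def K_def)
  note dD = direction_dual_cone[OF \<gamma>(3) sub(1), folded P_def]
  note dK = direction_dual_cone[OF \<gamma>(3) sub(2), folded Q_def]
  have s: "subspace P" "subspace Q" "subspace ?E"
    by (auto simp: P_def Q_def subspace_direction)
  have z: "P \<inter> Q = {0}"
  proof
    show "P \<inter> Q \<subseteq> {0}"
      using vertex dD(3,4) dK(4) unfolding D_def K_def by blast
    show "{0} \<subseteq> P \<inter> Q" using s subspace_0 by blast
  qed
  have le: "dim P + dim Q \<le> dim ?E" by (rule dim_direct_sum_le[OF s z dD(3) dK(3)])
  let ?q = "int (dim P)" and ?p = "int (dim ?E) - int (dim P)"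
  let ?C = "translate (?f v') (dual_cone \<gamma> D)" and ?K = "dual_cone \<gamma> K"
  have "aff_dim \<gamma> = ?p + ?q" by (simp add: aff_dim_direction \<gamma>)
  moreover have "v \<in> convenient_pq V X ?p ?q" using v by (simp add: convenient_def)
  ultimately have tr: "transversal (dual_space ?E) (translate (?f v') ` skeleton ?q (dual_fan \<gamma>)) (skeleton ?p (dual_fan \<gamma>))"
    using \<gamma>(1) unfolding convenient_pq_def v'[symmetric] by blast
  have "dual_cone \<gamma> D \<in> skeleton ?q (dual_fan \<gamma>)" "?K \<in> skeleton ?p (dual_fan \<gamma>)"
    using face dD(2) dK(2) le unfolding skeleton_def dual_fan_def by auto
  moreover have "?C \<inter> ?K \<noteq> {}"
    unfolding linked_iff_dual_cones_meet[OF \<gamma>(3) sub] linked_def by (auto simp: D_def K_def)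
  ultimately have cod: "codim (dual_space ?E) (direction ?C \<inter> direction ?K)
     = codim (dual_space ?E) (direction ?C) + codim (dual_space ?E) (direction ?K)"
    using tr unfolding transversal_def by blast
  have "direction ?C \<inter> direction ?K = ?f ` (P \<inter> Q)"
    unfolding direction_translate dD(1) dK(1)
    using inj_on_image_Int[OF inj_on_inner_functional[OF s(3)] dD(3) dK(3)] by simp
  moreover have "dim (?f ` {0}) = dim {0::'a}"
    by (rule dim_image_eq[OF linear_inner_functional]) simp
  ultimately have "dim (direction ?C \<inter> direction ?K) = 0"
    unfolding z by simp
  moreover have "dim (dual_space ?E) = dim ?E"
    unfolding dual_space_eq_image[OF s(3)]
    by (rule dim_image_eq[OF linear_inner_functional])
       (simp add: span_eq_iff[THEN iffD2, OF s(3)] inj_on_inner_functional[OF s(3)])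
  ultimately have "dim P + dim Q = dim ?E"
    using cod dD(2) dK(2) by (simp add: codim_def direction_translate)
  then have E: "?E = {x + y |x y. x \<in> P \<and> y \<in> Q}"
    by (rule direct_sum_eq[OF s z dD(3) dK(3)])
  have "u = 0" if u: "u \<in> direction D" "u \<in> direction K" for u
  proof -
    have "u \<in> ?E" using u(1) direction_mono[OF sub(1)] by blast
    then obtain x y where "u = x + y" "x \<in> P" "y \<in> Q" using E by blast
    then have "u \<bullet> u = 0"
      using dD(4)[of x u] dK(4)[of y u] u by (metis add_0 inner_left_distrib)
    then show ?thesis by simp
  qed
  then show "direction (amax \<gamma> a0) \<inter> direction (amax \<gamma> (a0 + v')) \<subseteq> {0}"
    using direction_mono[OF b(1)] direction_mono[OF b(2)] unfolding D_def K_def by blast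
qed

section \<open>Facets, normals and orientations\<close>

text \<open>
  The face \<open>\<mu>\<close> is where some \<open>c\<close> is maximal, and \<open>c / \<epsilon> + a\<close> with small \<open>\<epsilon>\<close> selects in \<open>\<gamma>\<close> what
  \<open>a\<close> selects in \<open>\<mu>\<close>.
\<close>

lemma linked_lift:
  fixes \<gamma> :: "'a::euclidean_space set"
  assumes \<gamma>: "polytope \<gamma>" and \<mu>: "\<mu> face_of \<gamma>" and ne: "\<delta> \<noteq> {}" "\<kappa> \<noteq> {}"
    and l: "linked v \<mu> \<delta> \<kappa>"
  shows "linked v \<gamma> \<delta> \<kappa>"
proof -
  obtain a where a: "\<delta> \<subseteq> amax \<mu> a" "\<kappa> \<subseteq> amax \<mu> (a + v)"
    using l unfolding linked_def by blast
  then have sub: "\<delta> \<subseteq> \<mu>" "\<kappa> \<subseteq> \<mu>" using amax_subset by blast+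
  have "\<mu> \<noteq> {}" using sub(1) ne(1) by blast
  then obtain c where "c \<in> direction \<gamma>" and c: "\<mu> = amax \<gamma> c"
    by (rule exposed_amax[OF polytope_imp_polyhedron[OF \<gamma>] \<mu>])
  have lift: "\<forall>\<^sub>F \<epsilon> in at_right 0. x \<in> amax \<gamma> (c + \<epsilon> *\<^sub>R b)" if "x \<in> amax \<mu> b" for x b
  proof (rule amax_perturb[OF \<gamma>])
    show "x \<in> amax \<gamma> c" using that amax_subset c by blast
    show "b \<bullet> y \<le> b \<bullet> x" if "y \<in> amax \<gamma> c" for y
      using amax_le[OF \<open>x \<in> amax \<mu> b\<close>, of y] that c by simp
  qed
  obtain x0 z0 where xz: "x0 \<in> \<delta>" "z0 \<in> \<kappa>" using ne by blast
  have "\<forall>\<^sub>F \<epsilon> in at_right 0. 0 < \<epsilon> \<and> x0 \<in> amax \<gamma> (c + \<epsilon> *\<^sub>R a) \<and> z0 \<in> amax \<gamma> (c + \<epsilon> *\<^sub>R (a + v))"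
    using lift[of x0 a] lift[of z0 "a + v"] xz a eventually_at_right_less[of "0::real"]
    by (intro eventually_conj) auto
  then obtain \<epsilon> where e: "0 < \<epsilon>" "x0 \<in> amax \<gamma> (c + \<epsilon> *\<^sub>R a)" "z0 \<in> amax \<gamma> (c + \<epsilon> *\<^sub>R (a + v))"
    using eventually_happens'[OF trivial_limit_at_right_real] by blast
  have all: "D \<subseteq> amax \<gamma> ((1 / \<epsilon>) *\<^sub>R c + b)"
    if D: "D \<subseteq> amax \<mu> b" "x \<in> D" "x \<in> amax \<gamma> (c + \<epsilon> *\<^sub>R b)" for D b x
  proof
    fix y assume y: "y \<in> D"
    have "b \<bullet> y = b \<bullet> x" using amax_const D y by blast
    moreover have "c \<bullet> y = c \<bullet> x" using amax_const[of y \<gamma> c x] D y c amax_subset by blast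
    moreover have "y \<in> \<gamma>" using y D(1) amax_subset c by blast
    ultimately have "y \<in> amax \<gamma> (c + \<epsilon> *\<^sub>R b)"
      by (intro amax_eqI[OF D(3)]) (auto simp: inner_left_distrib)
    moreover have "c + \<epsilon> *\<^sub>R b = \<epsilon> *\<^sub>R ((1 / \<epsilon>) *\<^sub>R c + b)"
      using e(1) by (simp add: scaleR_right_distrib)
    moreover have "amax \<gamma> (\<epsilon> *\<^sub>R w) = amax \<gamma> w" for w
      using e(1) by (simp add: amax_def)
    ultimately show "y \<in> amax \<gamma> ((1 / \<epsilon>) *\<^sub>R c + b)" by simp
  qed
  have "\<delta> \<subseteq> amax \<gamma> ((1 / \<epsilon>) *\<^sub>R c + a)" by (rule all[OF a(1) xz(1) e(2)])
  moreover have "\<kappa> \<subseteq> amax \<gamma> ((1 / \<epsilon>) *\<^sub>R c + a + v)"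
    using all[OF a(2) xz(2) e(3)] by (simp add: add.assoc)
  ultimately show ?thesis unfolding linked_def by blast
qed

lemma wall_exists:
  fixes \<gamma> :: "'a::euclidean_space set"
  assumes "polytope \<gamma>" "generic v \<gamma>" "\<delta> face_of \<gamma>" "\<kappa> face_of \<gamma>" "\<delta> \<noteq> {}" "\<kappa> \<noteq> {}"
    and d: "dim (direction \<delta>) + dim (direction \<kappa>) + 1 = dim (direction \<gamma>)"
    and l: "linked v \<gamma> \<delta> \<kappa>"
  obtains m where "wall \<gamma> v \<delta> \<kappa> m"
proof -
  let ?S = "direction \<delta> \<union> direction \<kappa>"
  have sub: "?S \<subseteq> direction \<gamma>"
    using direction_mono face_of_imp_subset assms(3,4) by blast
  have sp: "span (direction C) = direction C" for C :: "'a set"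
    using subspace_direction by (rule span_eq_iff[THEN iffD2])
  have "span ?S = {x + y |x y. x \<in> direction \<delta> \<and> y \<in> direction \<kappa>}"
    by (simp add: span_Un sp)
  then have dS: "dim (span ?S) + 1 = dim (direction \<gamma>)"
    using dim_sums_Int[of "direction \<delta>" "direction \<kappa>"] generic_linked[OF assms(2) l] d
    by (simp add: subspace_direction)
  have "span ?S \<noteq> span (direction \<gamma>)"
  proof
    assume "span ?S = span (direction \<gamma>)"
    then show False using dS by (simp only: dim_span)
  qed
  then have "span ?S \<subset> span (direction \<gamma>)" using span_mono[OF sub] by blast
  then obtain m where m: "m \<noteq> 0" "m \<in> span (direction \<gamma>)" "\<And>y. y \<in> span ?S \<Longrightarrow> orthogonal m y"
    using orthogonal_to_subspace_exists_gen by blast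
  have "m \<bullet> u = 0" if "u \<in> ?S" for u
    using m(3)[OF span_base[OF that]] by (simp add: orthogonal_def)
  then have "wall \<gamma> v \<delta> \<kappa> m"
    using assms m(1,2) by unfold_locales (auto simp: sp)
  then show thesis by (rule that)
qed

lemma facet_normal:
  fixes \<mu> :: "'a::euclidean_space set"
  assumes "polyhedron \<mu>" "\<delta> facet_of \<mu>"
  shows "outward_normal \<mu> \<delta> \<in> direction \<mu>" "outward_normal \<mu> \<delta> \<notin> direction \<delta>"
    "direction \<delta> \<subseteq> direction \<mu>" "dim (direction \<mu>) = dim (direction \<delta>) + 1"
proof -
  have ne: "\<delta> \<noteq> {}" "\<mu> \<noteq> {}" and sub: "\<delta> \<subseteq> \<mu>" and ad: "aff_dim \<delta> = aff_dim \<mu> - 1"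
    using assms(2) by (auto simp: facet_of_def dest: face_of_imp_subset)
  obtain x y where xy: "x \<in> \<delta>" "y \<in> \<mu> - \<delta>" "outward_normal \<mu> \<delta> = x - y"
    using outward_normal_obtain[OF assms(2)] .
  show "outward_normal \<mu> \<delta> \<in> direction \<mu>" "outward_normal \<mu> \<delta> \<notin> direction \<delta>"
    using xy sub diff_in_direction[of x \<mu> y] facet_side[OF assms xy(1,2,1,2)] by auto
  show "direction \<delta> \<subseteq> direction \<mu>" by (rule direction_mono[OF sub])
  show "dim (direction \<mu>) = dim (direction \<delta>) + 1"
    using ad aff_dim_direction[OF ne(1)] aff_dim_direction[OF ne(2)] by linarith
qed

lemma boundary_orientation_contract:
  "boundary_orientation \<mu> \<omega> \<delta> = contract_orientation (outward_normal \<mu> \<delta>) (direction \<delta>) \<omega>"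
  by (simp add: boundary_orientation_def contract_orientation_def outward_normal_def Let_def)

lemma is_orientation_boundary:
  fixes \<mu> :: "'a::euclidean_space set"
  assumes "polyhedron \<mu>" "\<delta> facet_of \<mu>" "is_orientation (direction \<mu>) \<omega>"
  shows "is_orientation (direction \<delta>) (boundary_orientation \<mu> \<omega> \<delta>)"
  unfolding boundary_orientation_contract
  by (rule is_orientation_contract[OF assms(3) subspace_direction]) (use facet_normal[OF assms(1,2)] in auto)

lemma facet_basis:
  fixes \<mu> :: "'a::euclidean_space set"
  assumes "polyhedron \<mu>" "\<delta> facet_of \<mu>" "ordered_basis (direction \<delta>) bs"
  shows "ordered_basis (direction \<mu>) (outward_normal \<mu> \<delta> # bs)"
    "boundary_orientation \<mu> \<omega> \<delta> bs = \<omega> (outward_normal \<mu> \<delta> # bs)"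
  using ordered_basis_Cons[OF assms(3) subspace_direction] facet_normal[OF assms(1,2)] assms(3)
  by (auto simp: boundary_orientation_contract contract_orientation_def)

context wall
begin

lemma normal_basis:
  assumes "ordered_basis (direction \<delta>) bs" "ordered_basis (direction \<kappa>) cs"
  shows "ordered_basis (direction \<gamma>) (m # bs @ cs)"
proof -
  note S = sum_directions
  have "ordered_basis {x + y |x y. x \<in> direction \<delta> \<and> y \<in> direction \<kappa>} (bs @ cs)"
    using ordered_basis_append[OF assms S(1) generic_linked[OF generic linked] S(5,6)] S(4) by simp
  from ordered_basis_Cons[OF this subspace_direction S(2) m(1) S(3)] show ?thesis
    using S(4) dims by simp
qed

text \<open>
  The reference orientations of the two faces, with which all terms at a given pair are compared.
\<close>

lemma normal_split_orientation:
  assumes "is_orientation (direction \<gamma>) \<omega>"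
  obtains \<alpha> \<beta> where "is_orientation (direction \<delta>) \<alpha>" "is_orientation (direction \<kappa>) \<beta>"
    "\<And>bs cs. ordered_basis (direction \<delta>) bs \<Longrightarrow> ordered_basis (direction \<kappa>) cs \<Longrightarrow>
       \<omega> (m # bs @ cs) = \<alpha> bs * \<beta> cs"
proof -
  note S = sum_directions
  let ?S = "{x + y |x y. x \<in> direction \<delta> \<and> y \<in> direction \<kappa>}"
  have "is_orientation ?S (contract_orientation m ?S \<omega>)"
    using is_orientation_contract[OF assms subspace_direction S(2) m(1) S(3)] S(4) dims by simp
  from oriented_direct_sum_exists[OF this subspace_direction subspace_direction S(1) generic_linked[OF generic linked] S(5,6)]
  obtain \<alpha> \<beta> where ods: "oriented_direct_sum ?S (contract_orientation m ?S \<omega>) (direction \<delta>) \<alpha> (direction \<kappa>) \<beta>"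
    using S(4) by auto
  show thesis
  proof (rule that[of \<alpha> \<beta>])
    fix bs cs assume "ordered_basis (direction \<delta>) bs" "ordered_basis (direction \<kappa>) cs"
    then have "ordered_basis ?S (bs @ cs)" "contract_orientation m ?S \<omega> (bs @ cs) = \<alpha> bs * \<beta> cs"
      using ods by (auto simp: oriented_direct_sum_def)
    then show "\<omega> (m # bs @ cs) = \<alpha> bs * \<beta> cs" by (simp add: contract_orientation_def)
  qed (use ods in \<open>auto simp: oriented_direct_sum_def\<close>)
qed

lemma orientation_normal_sign:
  assumes "is_orientation (direction \<gamma>) \<omega>"
    and bs: "ordered_basis (direction \<delta>) bs" and cs: "ordered_basis (direction \<kappa>) cs"
    and n: "ordered_basis (direction \<gamma>) (n # bs @ cs)"
  shows "\<omega> (n # bs @ cs) = sgn (m \<bullet> n) * \<omega> (m # bs @ cs)"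
proof (rule orientation_change_first[OF assms(1) normal_basis[OF bs cs] n])
  fix b assume "b \<in> set (bs @ cs)"
  moreover have "set bs \<subseteq> direction \<delta>" "set cs \<subseteq> direction \<kappa>"
    using bs cs span_superset by (auto simp: ordered_basis_def)
  ultimately show "m \<bullet> b = 0" using m_orth by auto
qed

end

lemma sum_signed_const:
  assumes "finite A"
  shows "(\<Sum>x\<in>A. signed (f x) \<tau>) = (\<Sum>x | x \<in> A \<and> 0 < f x. \<tau>) - (\<Sum>x | x \<in> A \<and> f x < 0. \<tau>)"
proof -
  have "signed c \<tau> = (if 0 < c then \<tau> else 0) - (if c < 0 then \<tau> else 0)" for c
    by (simp add: signed_def)
  then have "(\<Sum>x\<in>A. signed (f x) \<tau>) = (\<Sum>x\<in>A. if 0 < f x then \<tau> else 0) - (\<Sum>x\<in>A. if f x < 0 then \<tau> else 0)"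
    by (simp add: sum_subtractf)
  then show ?thesis by (simp only: sum.inter_filter[OF assms])
qed

section \<open>The Leibniz rule\<close>

definition split_orientation ::
    "'a::real_vector set \<Rightarrow> 'a orientation \<Rightarrow> 'a set \<Rightarrow> 'a set \<Rightarrow> 'a orientation \<times> 'a orientation" where
  "split_orientation \<gamma> \<omega> \<delta> \<kappa> =
     (SOME (\<alpha>, \<beta>). oriented_direct_sum (direction \<gamma>) \<omega> (direction \<delta>) \<alpha> (direction \<kappa>) \<beta>)"

lemma cup_product_sum:
  assumes "oriented_cell X (p + q) \<gamma> \<omega>"
  shows "cup_product X v p q r s \<gamma> \<omega> = (\<Sum>z\<in>product_pairs p q \<gamma> v.
    r (fst z) (fst (split_orientation \<gamma> \<omega> (fst z) (snd z))) * s (snd z) (snd (split_orientation \<gamma> \<omega> (fst z) (snd z))))"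
  using assms by (simp add: cup_product_def split_orientation_def case_prod_unfold Let_def)

text \<open>
  The consequences of the hypotheses on \<open>X\<close> and \<open>v\<close> that the Leibniz rule needs, with \<open>v\<close>
  represented by the vector \<open>v'\<close>.
\<close>

locale generic_complex =
  fixes X :: "'a::euclidean_space set set" and v :: "'a \<Rightarrow> real" and v' :: 'a
  assumes polytope_cell: "\<gamma> \<in> X \<Longrightarrow> polytope \<gamma>"
    and face_cell: "\<gamma> \<in> X \<Longrightarrow> \<delta> face_of \<gamma> \<Longrightarrow> \<delta> \<noteq> {} \<Longrightarrow> \<delta> \<in> X"
    and generic_cell: "\<gamma> \<in> X \<Longrightarrow> generic v' \<gamma>"
    and pairs_iff: "\<gamma> \<in> X \<Longrightarrow> (\<delta>, \<kappa>) \<in> product_pairs p q \<gamma> v \<longleftrightarrow>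
      \<delta> face_of \<gamma> \<and> \<delta> \<noteq> {} \<and> aff_dim \<delta> = p \<and> \<kappa> face_of \<gamma> \<and> \<kappa> \<noteq> {} \<and> aff_dim \<kappa> = q \<and> linked v' \<gamma> \<delta> \<kappa>"
begin

lemma cell_polyhedron: "\<gamma> \<in> X \<Longrightarrow> polyhedron \<gamma>"
  by (simp add: polytope_cell polytope_imp_polyhedron)

lemma facet_cell: "\<gamma> \<in> X \<Longrightarrow> \<delta> facet_of \<gamma> \<Longrightarrow> \<delta> \<in> X"
  using face_cell by (auto simp: facet_of_def)

lemma split_orientation:
  assumes \<gamma>: "\<gamma> \<in> X" "aff_dim \<gamma> = p + q" and o: "is_orientation (direction \<gamma>) \<omega>"
    and z: "(\<delta>, \<kappa>) \<in> product_pairs p q \<gamma> v"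
  shows "oriented_direct_sum (direction \<gamma>) \<omega> (direction \<delta>) (fst (split_orientation \<gamma> \<omega> \<delta> \<kappa>))
    (direction \<kappa>) (snd (split_orientation \<gamma> \<omega> \<delta> \<kappa>))"
proof -
  have f: "\<delta> face_of \<gamma>" "\<delta> \<noteq> {}" "aff_dim \<delta> = p" "\<kappa> face_of \<gamma>" "\<kappa> \<noteq> {}" "aff_dim \<kappa> = q" "linked v' \<gamma> \<delta> \<kappa>"
    using z pairs_iff[OF \<gamma>(1)] by auto
  have "\<gamma> \<noteq> {}" using f(1,2) by auto
  then have d: "dim (direction \<delta>) + dim (direction \<kappa>) = dim (direction \<gamma>)"
    using \<gamma>(2) f by (simp add: aff_dim_direction)
  have sub: "direction \<delta> \<subseteq> direction \<gamma>" "direction \<kappa> \<subseteq> direction \<gamma>"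
    using f(1,4) by (simp_all add: direction_mono face_of_imp_subset)
  have "\<exists>\<alpha> \<beta>. oriented_direct_sum (direction \<gamma>) \<omega> (direction \<delta>) \<alpha> (direction \<kappa>) \<beta>"
    by (rule oriented_direct_sum_exists[OF o subspace_direction subspace_direction subspace_direction
          generic_linked[OF generic_cell[OF \<gamma>(1)] f(7)] sub d])
  then have "\<exists>z. case z of (\<alpha>, \<beta>) \<Rightarrow> oriented_direct_sum (direction \<gamma>) \<omega> (direction \<delta>) \<alpha> (direction \<kappa>) \<beta>"
    by auto
  from someI_ex[OF this] show ?thesis
    unfolding split_orientation_def by (simp add: case_prod_unfold)
qed

lemma cup_product_cochain:
  assumes r: "r \<in> cochains X p" and s: "s \<in> cochains X q"
  shows "cup_product X v p q r s \<in> cochains X (p + q)"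
  unfolding cochains_def
proof (intro CollectI conjI allI impI)
  fix \<gamma> \<omega> assume oc: "oriented_cell X (p + q) \<gamma> \<omega>"
  then have \<gamma>: "\<gamma> \<in> X" "aff_dim \<gamma> = p + q" and o: "is_orientation (direction \<gamma>) \<omega>"
    by (auto simp: oriented_cell_def)
  have om: "is_orientation (direction \<gamma>) (- \<omega>)" using is_orientation_uminus[OF o] .
  then have oc': "oriented_cell X (p + q) \<gamma> (- \<omega>)" using \<gamma> by (simp add: oriented_cell_def)
  have "r (fst z) (fst (split_orientation \<gamma> (- \<omega>) (fst z) (snd z))) * s (snd z) (snd (split_orientation \<gamma> (- \<omega>) (fst z) (snd z)))
    = - (r (fst z) (fst (split_orientation \<gamma> \<omega> (fst z) (snd z))) * s (snd z) (snd (split_orientation \<gamma> \<omega> (fst z) (snd z))))"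
    if "z \<in> product_pairs p q \<gamma> v" for z
  proof -
    obtain \<delta> \<kappa> where z: "z = (\<delta>, \<kappa>)" by force
    have zp: "(\<delta>, \<kappa>) \<in> product_pairs p q \<gamma> v" using that z by simp
    have f: "\<delta> \<in> X" "aff_dim \<delta> = p" "\<kappa> \<in> X" "aff_dim \<kappa> = q"
      using zp pairs_iff[OF \<gamma>(1)] face_cell[OF \<gamma>(1)] by auto
    note A = split_orientation[OF \<gamma> o zp] and B = split_orientation[OF \<gamma> om zp]
    obtain bs where bs: "ordered_basis (direction \<delta>) bs" using ordered_basis_exists[OF subspace_direction] .
    obtain cs where cs: "ordered_basis (direction \<kappa>) cs" using ordered_basis_exists[OF subspace_direction] .
    have eq: "fst (split_orientation \<gamma> (- \<omega>) \<delta> \<kappa>) bs * snd (split_orientation \<gamma> (- \<omega>) \<delta> \<kappa>) cs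
        = -1 * (fst (split_orientation \<gamma> \<omega> \<delta> \<kappa>) bs * snd (split_orientation \<gamma> \<omega> \<delta> \<kappa>) cs)"
      using A B bs cs by (auto simp: oriented_direct_sum_def)
    have or: "is_orientation (direction \<delta>) (fst (split_orientation \<gamma> \<omega> \<delta> \<kappa>))"
      "is_orientation (direction \<delta>) (fst (split_orientation \<gamma> (- \<omega>) \<delta> \<kappa>))"
      "is_orientation (direction \<kappa>) (snd (split_orientation \<gamma> \<omega> \<delta> \<kappa>))"
      "is_orientation (direction \<kappa>) (snd (split_orientation \<gamma> (- \<omega>) \<delta> \<kappa>))"
      using A B by (simp_all add: oriented_direct_sum_def)
    from cochain_product_sign[OF r f(1,2) s f(3,4) or bs cs eq]
    show ?thesis unfolding z fst_conv snd_conv signed_simps .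
  qed
  then show "cup_product X v p q r s \<gamma> (- \<omega>) = - cup_product X v p q r s \<gamma> \<omega>"
    unfolding cup_product_sum[OF oc] cup_product_sum[OF oc'] by (simp add: sum_negf)
qed (simp add: cup_product_def)

text \<open>
  The part of the Leibniz rule that belongs to one pair \<open>(\<delta>, \<kappa>)\<close>. For a linked pair let \<open>\<tau>\<close> be the
  product of the values of \<open>r\<close> and \<open>s\<close> with respect to the orientation of \<open>\<gamma>\<close> that puts \<open>m\<close> first.
  Each term is \<open>\<tau>\<close> with the sign of the scalar product of \<open>m\<close> with an outward normal, so after
  moving everything to the left the ends in the direction \<open>m\<close> contribute \<open>\<tau>\<close> and those in the
  direction \<open>- m\<close> contribute \<open>- \<tau>\<close>.
\<close>

lemma pair_cancellation:
  fixes r s :: "('a, 'r::ring) cochain"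
  assumes \<gamma>: "\<gamma> \<in> X" "aff_dim \<gamma> = p + q + 1" and o: "is_orientation (direction \<gamma>) \<omega>"
    and r: "r \<in> cochains X p" and s: "s \<in> cochains X q"
    and \<delta>: "\<delta> face_of \<gamma>" "\<delta> \<noteq> {}" "aff_dim \<delta> = p" and \<kappa>: "\<kappa> face_of \<gamma>" "\<kappa> \<noteq> {}" "aff_dim \<kappa> = q"
  shows "(\<Sum>\<mu> | \<mu> facet_of \<gamma> \<and> (\<delta>, \<kappa>) \<in> product_pairs p q \<mu> v.
        r \<delta> (fst (split_orientation \<mu> (boundary_orientation \<gamma> \<omega> \<mu>) \<delta> \<kappa>)) *
        s \<kappa> (snd (split_orientation \<mu> (boundary_orientation \<gamma> \<omega> \<mu>) \<delta> \<kappa>)))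
    = (\<Sum>\<delta>' | (\<delta>', \<kappa>) \<in> product_pairs (p + 1) q \<gamma> v \<and> \<delta> facet_of \<delta>'.
        r \<delta> (boundary_orientation \<delta>' (fst (split_orientation \<gamma> \<omega> \<delta>' \<kappa>)) \<delta>) *
        s \<kappa> (snd (split_orientation \<gamma> \<omega> \<delta>' \<kappa>)))
    + signed (rotation_sign (nat p) (nat q))
      (\<Sum>\<kappa>' | (\<delta>, \<kappa>') \<in> product_pairs p (q + 1) \<gamma> v \<and> \<kappa> facet_of \<kappa>'.
        r \<delta> (fst (split_orientation \<gamma> \<omega> \<delta> \<kappa>')) *
        s \<kappa> (boundary_orientation \<kappa>' (snd (split_orientation \<gamma> \<omega> \<delta> \<kappa>')) \<kappa>))"
    (is "sum ?f ?A = sum ?g ?B + signed ?\<sigma> (sum ?h ?C)")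
proof (cases "linked v' \<gamma> \<delta> \<kappa>")
  case False
  have "\<not> (\<mu> facet_of \<gamma> \<and> (\<delta>, \<kappa>) \<in> product_pairs p q \<mu> v)" for \<mu>
  proof
    assume \<mu>: "\<mu> facet_of \<gamma> \<and> (\<delta>, \<kappa>) \<in> product_pairs p q \<mu> v"
    then have "linked v' \<mu> \<delta> \<kappa>" using pairs_iff[OF facet_cell[OF \<gamma>(1)]] by blast
    then show False
      using False \<mu> linked_lift[OF polytope_cell[OF \<gamma>(1)] _ \<delta>(2) \<kappa>(2)] by (auto simp: facet_of_def)
  qed
  then have A0: "?A = {}" by blast
  have "\<not> ((\<delta>', \<kappa>) \<in> product_pairs (p + 1) q \<gamma> v \<and> \<delta> facet_of \<delta>')" for \<delta>'
  proof
    assume \<delta>': "(\<delta>', \<kappa>) \<in> product_pairs (p + 1) q \<gamma> v \<and> \<delta> facet_of \<delta>'"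
    then have "linked v' \<gamma> \<delta>' \<kappa>" "\<delta> \<subseteq> \<delta>'"
      using pairs_iff[OF \<gamma>(1)] face_of_imp_subset by (blast, simp add: facet_of_def face_of_imp_subset)
    then show False using False linked_mono by blast
  qed
  then have B0: "?B = {}" by blast
  have "\<not> ((\<delta>, \<kappa>') \<in> product_pairs p (q + 1) \<gamma> v \<and> \<kappa> facet_of \<kappa>')" for \<kappa>'
  proof
    assume \<kappa>': "(\<delta>, \<kappa>') \<in> product_pairs p (q + 1) \<gamma> v \<and> \<kappa> facet_of \<kappa>'"
    then have "linked v' \<gamma> \<delta> \<kappa>'" "\<kappa> \<subseteq> \<kappa>'"
      using pairs_iff[OF \<gamma>(1)] face_of_imp_subset by (blast, simp add: facet_of_def face_of_imp_subset)
    then show False using False linked_mono by blast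
  qed
  then have C0: "?C = {}" by blast
  show ?thesis unfolding A0 B0 C0 by (simp add: signed_def)
next
  case True
  have poly: "polytope \<gamma>" "polyhedron \<gamma>" using polytope_cell cell_polyhedron \<gamma>(1) by auto
  have cells: "\<delta> \<in> X" "\<kappa> \<in> X" using face_cell \<gamma>(1) \<delta> \<kappa> by auto
  have ne: "\<gamma> \<noteq> {}" using \<delta> by auto
  have dp: "p = int (dim (direction \<delta>))" and dq: "q = int (dim (direction \<kappa>))"
    using aff_dim_direction \<delta> \<kappa> by auto
  have d: "dim (direction \<delta>) + dim (direction \<kappa>) + 1 = dim (direction \<gamma>)"
    using \<gamma>(2) dp dq aff_dim_direction[OF ne] by linarith
  obtain m where "wall \<gamma> v' \<delta> \<kappa> m"
    using wall_exists[OF poly(1) generic_cell[OF \<gamma>(1)] \<delta>(1) \<kappa>(1) \<delta>(2) \<kappa>(2) d True] .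
  then interpret wall \<gamma> v' \<delta> \<kappa> m .
  obtain \<alpha> \<beta> where \<alpha>: "is_orientation (direction \<delta>) \<alpha>" and \<beta>: "is_orientation (direction \<kappa>) \<beta>"
    and \<alpha>\<beta>: "\<And>bs cs. ordered_basis (direction \<delta>) bs \<Longrightarrow> ordered_basis (direction \<kappa>) cs \<Longrightarrow>
       \<omega> (m # bs @ cs) = \<alpha> bs * \<beta> cs"
    using normal_split_orientation[OF o] by blast
  define \<tau> where "\<tau> = r \<delta> \<alpha> * s \<kappa> \<beta>"
  obtain bs where bs: "ordered_basis (direction \<delta>) bs" using ordered_basis_exists[OF subspace_direction] .
  obtain cs where cs: "ordered_basis (direction \<kappa>) cs" using ordered_basis_exists[OF subspace_direction] .
  have compare: "r \<delta> \<alpha>' * s \<kappa> \<beta>' = signed (c * (m \<bullet> n)) \<tau>"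
    if "is_orientation (direction \<delta>) \<alpha>'" "is_orientation (direction \<kappa>) \<beta>'"
      "ordered_basis (direction \<gamma>) (n # bs @ cs)" "\<alpha>' bs * \<beta>' cs = c * \<omega> (n # bs @ cs)" for \<alpha>' \<beta>' n c
  proof -
    have "\<alpha>' bs * \<beta>' cs = (c * sgn (m \<bullet> n)) * (\<alpha> bs * \<beta> cs)"
      using that(4) orientation_normal_sign[OF o bs cs that(3)] \<alpha>\<beta>[OF bs cs] by simp
    from cochain_product_sign[OF r cells(1) \<delta>(3) s cells(2) \<kappa>(3) \<alpha> that(1) \<beta> that(2) bs cs this]
    have "r \<delta> \<alpha>' * s \<kappa> \<beta>' = signed c (signed (sgn (m \<bullet> n)) \<tau>)" by (simp add: \<tau>_def signed_signed)
    then show ?thesis by (simp add: signed_sgn signed_signed)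
  qed
  have fA: "?f \<mu> = signed (m \<bullet> outward_normal \<gamma> \<mu>) \<tau>" if \<mu>: "\<mu> \<in> ?A" for \<mu>
  proof -
    let ?\<omega>' = "boundary_orientation \<gamma> \<omega> \<mu>"
    have f: "\<mu> facet_of \<gamma>" and z: "(\<delta>, \<kappa>) \<in> product_pairs p q \<mu> v" using \<mu> by auto
    have o': "is_orientation (direction \<mu>) ?\<omega>'" by (rule is_orientation_boundary[OF poly(2) f o])
    have ad: "aff_dim \<mu> = p + q" using f \<gamma>(2) by (simp add: facet_of_def)
    note ods = split_orientation[OF facet_cell[OF \<gamma>(1) f] ad o' z]
    then have b: "ordered_basis (direction \<mu>) (bs @ cs)" using bs cs by (simp add: oriented_direct_sum_def)
    let ?S = "split_orientation \<mu> ?\<omega>' \<delta> \<kappa>"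
    have or: "is_orientation (direction \<delta>) (fst ?S)" "is_orientation (direction \<kappa>) (snd ?S)"
      and eq: "?\<omega>' (bs @ cs) = fst ?S bs * snd ?S cs"
      using ods bs cs unfolding oriented_direct_sum_def by blast+
    have "fst ?S bs * snd ?S cs = 1 * \<omega> (outward_normal \<gamma> \<mu> # bs @ cs)"
      using eq facet_basis(2)[OF poly(2) f b] by simp
    from compare[OF or facet_basis(1)[OF poly(2) f b] this] show ?thesis by simp
  qed
  have fB: "?g \<delta>' = signed (m \<bullet> outward_normal \<delta>' \<delta>) \<tau>" if \<delta>': "\<delta>' \<in> ?B" for \<delta>'
  proof -
    have f: "\<delta> facet_of \<delta>'" and z: "(\<delta>', \<kappa>) \<in> product_pairs (p + 1) q \<gamma> v" using \<delta>' by auto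
    then have "\<delta>' \<in> X" using pairs_iff[OF \<gamma>(1)] face_cell[OF \<gamma>(1)] by blast
    then have poly': "polyhedron \<delta>'" by (rule cell_polyhedron)
    have ad: "aff_dim \<gamma> = (p + 1) + q" using \<gamma>(2) by simp
    note ods = split_orientation[OF \<gamma>(1) ad o z]
    note fb = facet_basis[OF poly' f bs]
    let ?n = "outward_normal \<delta>' \<delta>" and ?S = "split_orientation \<gamma> \<omega> \<delta>' \<kappa>"
    have or: "is_orientation (direction \<delta>') (fst ?S)" "is_orientation (direction \<kappa>) (snd ?S)"
      and b: "ordered_basis (direction \<gamma>) ((?n # bs) @ cs)"
      and eq: "\<omega> ((?n # bs) @ cs) = fst ?S (?n # bs) * snd ?S cs"
      using ods fb(1) cs unfolding oriented_direct_sum_def by blast+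
    have b': "ordered_basis (direction \<gamma>) (?n # bs @ cs)" using b by simp
    have "boundary_orientation \<delta>' (fst ?S) \<delta> bs * snd ?S cs = 1 * \<omega> (?n # bs @ cs)"
      using eq fb(2) by simp
    from compare[OF is_orientation_boundary[OF poly' f or(1)] or(2) b' this] show ?thesis by simp
  qed
  have len: "length bs = nat p" "length cs = nat q"
    using bs cs dp dq by (simp_all add: ordered_basis_iff)
  \<comment> \<open>Both values of \<open>\<omega>\<close> related by the rotation are signs, so the rotation sign is one too.\<close>
  have \<sigma>: "?\<sigma> * ?\<sigma> = 1"
  proof -
    have b: "ordered_basis (direction \<gamma>) (m # bs @ cs)" by (rule normal_basis[OF bs cs])
    then have b': "ordered_basis (direction \<gamma>) (bs @ m # cs)" by (simp add: ordered_basis_iff)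
    have "\<omega> (m # bs @ cs) = ?\<sigma> * \<omega> (bs @ m # cs)"
      using orientation_rotate[OF o b] len by simp
    then show ?thesis
      using is_orientation_basis[OF o b] is_orientation_basis[OF o b'] by auto
  qed
  have fC: "signed ?\<sigma> (?h \<kappa>') = signed (m \<bullet> outward_normal \<kappa>' \<kappa>) \<tau>" if \<kappa>': "\<kappa>' \<in> ?C" for \<kappa>'
  proof -
    let ?n = "outward_normal \<kappa>' \<kappa>"
    have f: "\<kappa> facet_of \<kappa>'" and z: "(\<delta>, \<kappa>') \<in> product_pairs p (q + 1) \<gamma> v" using \<kappa>' by auto
    then have "\<kappa>' \<in> X" using pairs_iff[OF \<gamma>(1)] face_cell[OF \<gamma>(1)] by blast
    then have poly': "polyhedron \<kappa>'" by (rule cell_polyhedron)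
    have ad: "aff_dim \<gamma> = p + (q + 1)" using \<gamma>(2) by simp
    note ods = split_orientation[OF \<gamma>(1) ad o z]
    note fb = facet_basis[OF poly' f cs]
    have or: "is_orientation (direction \<delta>) (fst (split_orientation \<gamma> \<omega> \<delta> \<kappa>'))"
      "is_orientation (direction \<kappa>') (snd (split_orientation \<gamma> \<omega> \<delta> \<kappa>'))"
      and eq: "ordered_basis (direction \<gamma>) (bs @ ?n # cs)"
      "\<omega> (bs @ ?n # cs) = fst (split_orientation \<gamma> \<omega> \<delta> \<kappa>') bs * snd (split_orientation \<gamma> \<omega> \<delta> \<kappa>') (?n # cs)"
      using ods fb(1) bs unfolding oriented_direct_sum_def by blast+
    have b: "ordered_basis (direction \<gamma>) (?n # bs @ cs)" using eq(1) by (simp add: ordered_basis_iff)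
    have rot: "\<omega> (?n # bs @ cs) = ?\<sigma> * \<omega> (bs @ ?n # cs)"
      using orientation_rotate[OF o b] len by simp
    have "?\<sigma> * \<omega> (?n # bs @ cs) = \<omega> (bs @ ?n # cs)"
      unfolding rot mult.assoc[symmetric] \<sigma> by simp
    then have c: "fst (split_orientation \<gamma> \<omega> \<delta> \<kappa>') bs * boundary_orientation \<kappa>' (snd (split_orientation \<gamma> \<omega> \<delta> \<kappa>')) \<kappa> cs
        = ?\<sigma> * \<omega> (?n # bs @ cs)"
      using eq(2) fb(2) by simp
    have "?h \<kappa>' = signed (?\<sigma> * (m \<bullet> ?n)) \<tau>"
      by (rule compare[OF or(1) is_orientation_boundary[OF poly' f or(2)] b c])
    then have "signed ?\<sigma> (?h \<kappa>') = signed ((?\<sigma> * ?\<sigma>) * (m \<bullet> ?n)) \<tau>"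
      by (simp only: signed_signed mult.assoc)
    then show ?thesis by (simp only: \<sigma> mult_1)
  qed
  have fin: "finite {F. F face_of \<gamma>}" by (rule finite_polytope_faces[OF poly(1)])
  have finA: "finite ?A" by (rule finite_subset[OF _ fin]) (auto simp: facet_of_def)
  have finB: "finite ?B" by (rule finite_subset[OF _ fin]) (use pairs_iff[OF \<gamma>(1)] in auto)
  have finC: "finite ?C" by (rule finite_subset[OF _ fin]) (use pairs_iff[OF \<gamma>(1)] in auto)
  have face_iff: "F face_of \<mu> \<longleftrightarrow> F \<subseteq> \<mu>" if "F face_of \<gamma>" "\<mu> facet_of \<gamma>" for F \<mu>
    using that face_of_face[of \<mu> \<gamma> F] by (auto simp: facet_of_def)
  have Am: "\<mu> \<in> ?A \<longleftrightarrow> \<mu> facet_of \<gamma> \<and> \<delta> \<subseteq> \<mu> \<and> \<kappa> \<subseteq> \<mu> \<and> linked v' \<mu> \<delta> \<kappa>" for \<mu>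
    using pairs_iff[OF facet_cell[OF \<gamma>(1)], of \<mu> \<delta> \<kappa> p q] face_iff[OF \<delta>(1), of \<mu>] face_iff[OF \<kappa>(1), of \<mu>] \<delta> \<kappa> by auto
  have A: "{\<mu>. \<mu> \<in> ?A \<and> 0 < m \<bullet> outward_normal \<gamma> \<mu>} = outer_ends v' \<gamma> \<delta> \<kappa> m"
    "{\<mu>. \<mu> \<in> ?A \<and> m \<bullet> outward_normal \<gamma> \<mu> < 0} = outer_ends v' \<gamma> \<delta> \<kappa> (- m)"
    unfolding Am outer_ends_def by auto
  have Bm: "\<delta>' \<in> ?B \<longleftrightarrow> \<delta>' face_of \<gamma> \<and> \<delta> facet_of \<delta>' \<and> linked v' \<gamma> \<delta>' \<kappa>" for \<delta>'
    using pairs_iff[OF \<gamma>(1), of \<delta>' \<kappa> "p + 1" q] \<delta> \<kappa> by (auto simp: facet_of_def)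
  have B: "{\<delta>'. \<delta>' \<in> ?B \<and> 0 < m \<bullet> outward_normal \<delta>' \<delta>} = inner_ends v' \<gamma> \<delta> \<kappa> (- m)"
    "{\<delta>'. \<delta>' \<in> ?B \<and> m \<bullet> outward_normal \<delta>' \<delta> < 0} = inner_ends v' \<gamma> \<delta> \<kappa> m"
    unfolding Bm inner_ends_def by auto
  have Cm: "\<kappa>' \<in> ?C \<longleftrightarrow> \<kappa>' face_of \<gamma> \<and> \<kappa> facet_of \<kappa>' \<and> linked (- v') \<gamma> \<kappa>' \<delta>" for \<kappa>'
    using pairs_iff[OF \<gamma>(1), of \<delta> \<kappa>' p "q + 1"] \<delta> \<kappa> by (auto simp: facet_of_def linked_swap)
  have C: "{\<kappa>'. \<kappa>' \<in> ?C \<and> 0 < m \<bullet> outward_normal \<kappa>' \<kappa>} = inner_ends (- v') \<gamma> \<kappa> \<delta> (- m)"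
    "{\<kappa>'. \<kappa>' \<in> ?C \<and> m \<bullet> outward_normal \<kappa>' \<kappa> < 0} = inner_ends (- v') \<gamma> \<kappa> \<delta> m"
    unfolding Cm inner_ends_def by auto
  let ?T = "\<lambda>M. \<Sum>x\<in>M. \<tau>"
  \<comment> \<open>The constant sum over the ends in one direction has exactly one summand.\<close>
  have end1: "?T (outer_ends v' \<gamma> \<delta> \<kappa> m) + ?T (inner_ends v' \<gamma> \<delta> \<kappa> m) + ?T (inner_ends (- v') \<gamma> \<kappa> \<delta> m) = \<tau>"
    using unique_end by (elim disjE conjE exE) simp_all
  have end2: "?T (outer_ends v' \<gamma> \<delta> \<kappa> (- m)) + ?T (inner_ends v' \<gamma> \<delta> \<kappa> (- m)) + ?T (inner_ends (- v') \<gamma> \<kappa> \<delta> (- m)) = \<tau>"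
    using wall.unique_end[OF wall_uminus] by (elim disjE conjE exE) simp_all
  have SA: "sum ?f ?A = ?T (outer_ends v' \<gamma> \<delta> \<kappa> m) - ?T (outer_ends v' \<gamma> \<delta> \<kappa> (- m))"
    unfolding A[symmetric] sum_signed_const[OF finA, symmetric] using fA by (rule sum.cong[OF refl])
  have SB: "sum ?g ?B = ?T (inner_ends v' \<gamma> \<delta> \<kappa> (- m)) - ?T (inner_ends v' \<gamma> \<delta> \<kappa> m)"
    unfolding B[symmetric] sum_signed_const[OF finB, symmetric] using fB by (rule sum.cong[OF refl])
  have SC: "signed ?\<sigma> (sum ?h ?C) = ?T (inner_ends (- v') \<gamma> \<kappa> \<delta> (- m)) - ?T (inner_ends (- v') \<gamma> \<kappa> \<delta> m)"
    unfolding C[symmetric] sum_signed_const[OF finC, symmetric] signed_sum using fC by (rule sum.cong[OF refl])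
  have alg: "a - b = (c - d) + (e - f)" if "a + d + f = t" "b + c + e = t" for a b c d e f t :: 'r
  proof -
    have "a = t - d - f" "b = t - c - e" using that by (auto simp: algebra_simps)
    then show ?thesis by (simp add: algebra_simps)
  qed
  show ?thesis unfolding SA SB SC by (rule alg[OF end1 end2])
qed

text \<open>
  All three products are sums over a pair of faces of \<open>\<gamma>\<close> of dimensions \<open>p\<close>, \<open>q\<close> and one further
  cell: a facet of \<open>\<gamma>\<close> that contains both, or a face that has one of them as a facet. Exchanging
  the order of summation collects the terms of each pair.
\<close>

theorem leibniz:
  fixes r s :: "('a, 'r::ring) cochain"
  assumes r: "r \<in> cochains X p" and s: "s \<in> cochains X q"
    and oc: "oriented_cell X (p + q + 1) \<gamma> \<omega>"
  shows "coboundary X (cup_product X v p q r s) \<gamma> \<omega> =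
     cup_product X v (p + 1) q (coboundary X r) s \<gamma> \<omega> +
     signed (rotation_sign (nat p) (nat q)) (cup_product X v p (q + 1) r (coboundary X s) \<gamma> \<omega>)"
proof -
  have \<gamma>: "\<gamma> \<in> X" "aff_dim \<gamma> = p + q + 1" and o: "is_orientation (direction \<gamma>) \<omega>"
    using oc by (auto simp: oriented_cell_def)
  let ?so = "\<lambda>\<delta> \<kappa>. split_orientation \<gamma> \<omega> \<delta> \<kappa>"
  define N where "N = {(\<delta>, \<kappa>). \<delta> face_of \<gamma> \<and> \<delta> \<noteq> {} \<and> aff_dim \<delta> = p \<and> \<kappa> face_of \<gamma> \<and> \<kappa> \<noteq> {} \<and> aff_dim \<kappa> = q}"
  have fin: "finite {F. F face_of \<gamma>}" by (rule finite_polytope_faces[OF polytope_cell[OF \<gamma>(1)]])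
  have finN: "finite N"
    by (rule finite_subset[OF _ finite_cartesian_product[OF fin fin]]) (auto simp: N_def)
  have finP: "finite (product_pairs i j \<gamma> v)" for i j
    by (rule finite_subset[OF _ finite_cartesian_product[OF fin fin]]) (use pairs_iff[OF \<gamma>(1)] in auto)
  have finF: "finite {\<mu>. \<mu> facet_of \<gamma>}" by (rule finite_subset[OF _ fin]) (auto simp: facet_of_def)

  \<comment> \<open>The three kinds of terms; \<open>z\<close> is the pair of dimensions \<open>p\<close>, \<open>q\<close>, and \<open>y\<close> a pair with one face enlarged.\<close>
  define f where "f = (\<lambda>\<mu> (z :: 'a set \<times> 'a set). r (fst z) (fst (split_orientation \<mu> (boundary_orientation \<gamma> \<omega> \<mu>) (fst z) (snd z))) *
        s (snd z) (snd (split_orientation \<mu> (boundary_orientation \<gamma> \<omega> \<mu>) (fst z) (snd z))))"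
  define g where "g = (\<lambda>(y :: 'a set \<times> 'a set) (z :: 'a set \<times> 'a set). r (fst z) (boundary_orientation (fst y) (fst (?so (fst y) (snd y))) (fst z)) *
        s (snd y) (snd (?so (fst y) (snd y))))"
  define h where "h = (\<lambda>(y :: 'a set \<times> 'a set) (z :: 'a set \<times> 'a set). r (fst y) (fst (?so (fst y) (snd y))) *
        s (snd z) (boundary_orientation (snd y) (snd (?so (fst y) (snd y))) (snd z)))"

  have "coboundary X (cup_product X v p q r s) \<gamma> \<omega> =
      (\<Sum>\<mu> | \<mu> facet_of \<gamma>. cup_product X v p q r s \<mu> (boundary_orientation \<gamma> \<omega> \<mu>))"
    using \<gamma> o by (simp add: coboundary_def oriented_cell_def)
  also have "\<dots> = (\<Sum>\<mu> \<in> {\<mu>. \<mu> facet_of \<gamma>}. \<Sum>z | z \<in> N \<and> z \<in> product_pairs p q \<mu> v. f \<mu> z)"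
  proof (intro sum.cong refl)
    fix \<mu> assume "\<mu> \<in> {\<mu>. \<mu> facet_of \<gamma>}"
    then have \<mu>: "\<mu> facet_of \<gamma>" by simp
    then have "oriented_cell X (p + q) \<mu> (boundary_orientation \<gamma> \<omega> \<mu>)"
      using is_orientation_boundary[OF cell_polyhedron[OF \<gamma>(1)] \<mu> o] facet_cell[OF \<gamma>(1) \<mu>] \<gamma>(2)
      by (simp add: oriented_cell_def facet_of_def)
    moreover have "{z. z \<in> N \<and> z \<in> product_pairs p q \<mu> v} = product_pairs p q \<mu> v"
    proof (intro subset_antisym subsetI)
      fix z assume z: "z \<in> product_pairs p q \<mu> v"
      obtain \<delta> \<kappa> where "z = (\<delta>, \<kappa>)" by force
      moreover have "\<mu> face_of \<gamma>" using \<mu> by (simp add: facet_of_def)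
      ultimately show "z \<in> {z. z \<in> N \<and> z \<in> product_pairs p q \<mu> v}"
        using z pairs_iff[OF facet_cell[OF \<gamma>(1) \<mu>], of \<delta> \<kappa> p q] face_of_trans[of _ \<mu> \<gamma>] by (simp add: N_def)
    qed simp
    ultimately show "cup_product X v p q r s \<mu> (boundary_orientation \<gamma> \<omega> \<mu>) =
        (\<Sum>z | z \<in> N \<and> z \<in> product_pairs p q \<mu> v. f \<mu> z)"
      by (simp add: cup_product_sum f_def)
  qed
  also have "\<dots> = (\<Sum>z\<in>N. \<Sum>\<mu> | \<mu> \<in> {\<mu>. \<mu> facet_of \<gamma>} \<and> z \<in> product_pairs p q \<mu> v. f \<mu> z)"
    by (rule sum.swap_restrict[OF finF finN])
  finally have A: "coboundary X (cup_product X v p q r s) \<gamma> \<omega> =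
      (\<Sum>z\<in>N. \<Sum>\<mu> | \<mu> facet_of \<gamma> \<and> z \<in> product_pairs p q \<mu> v. f \<mu> z)" by simp

  have oc1: "oriented_cell X ((p + 1) + q) \<gamma> \<omega>" and oc2: "oriented_cell X (p + (q + 1)) \<gamma> \<omega>"
    using oc by (simp_all add: algebra_simps)
  note \<gamma>1 = oc1[unfolded oriented_cell_def, THEN conjunct2, THEN conjunct1]
    and \<gamma>2 = oc2[unfolded oriented_cell_def, THEN conjunct2, THEN conjunct1]

  have "cup_product X v (p + 1) q (coboundary X r) s \<gamma> \<omega> =
      (\<Sum>y \<in> product_pairs (p + 1) q \<gamma> v. \<Sum>z | z \<in> N \<and> snd z = snd y \<and> fst z facet_of fst y. g y z)"
    unfolding cup_product_sum[OF oc1]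
  proof (intro sum.cong refl)
    fix y assume "y \<in> product_pairs (p + 1) q \<gamma> v"
    then obtain \<delta>' \<kappa> where y: "y = (\<delta>', \<kappa>)" and yp: "(\<delta>', \<kappa>) \<in> product_pairs (p + 1) q \<gamma> v" by (metis surj_pair)
    have fy: "\<delta>' face_of \<gamma>" "\<delta>' \<noteq> {}" "aff_dim \<delta>' = p + 1" "\<kappa> face_of \<gamma>" "\<kappa> \<noteq> {}" "aff_dim \<kappa> = q"
      using yp pairs_iff[OF \<gamma>(1)] by auto
    have "oriented_cell X (aff_dim \<delta>') \<delta>' (fst (?so \<delta>' \<kappa>))"
      using face_cell[OF \<gamma>(1) fy(1,2)] split_orientation[OF \<gamma>(1) \<gamma>1 o yp]
      by (simp add: oriented_cell_def oriented_direct_sum_def)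
    then have "coboundary X r \<delta>' (fst (?so \<delta>' \<kappa>)) * s \<kappa> (snd (?so \<delta>' \<kappa>)) =
        (\<Sum>\<delta> | \<delta> facet_of \<delta>'. g y (\<delta>, \<kappa>))"
      by (simp add: coboundary_def sum_distrib_right g_def y)
    also have "\<dots> = (\<Sum>z | z \<in> N \<and> snd z = snd y \<and> fst z facet_of fst y. g y z)"
    proof (rule sum.reindex_bij_witness[of _ fst "\<lambda>\<delta>. (\<delta>, \<kappa>)"], goal_cases)
      case (2 \<delta>)
      then have "\<delta> face_of \<gamma>" using face_of_trans fy(1) by (auto simp: facet_of_def)
      then show ?case using 2 fy by (auto simp: N_def y facet_of_def)
    qed (auto simp: y)
    finally show "coboundary X r (fst y) (fst (?so (fst y) (snd y))) * s (snd y) (snd (?so (fst y) (snd y))) =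
        (\<Sum>z | z \<in> N \<and> snd z = snd y \<and> fst z facet_of fst y. g y z)" by (simp add: y)
  qed
  also have "\<dots> = (\<Sum>z\<in>N. \<Sum>y | y \<in> product_pairs (p + 1) q \<gamma> v \<and> snd z = snd y \<and> fst z facet_of fst y. g y z)"
    by (rule sum.swap_restrict[OF finP finN])
  finally have B: "cup_product X v (p + 1) q (coboundary X r) s \<gamma> \<omega> =
     (\<Sum>z\<in>N. \<Sum>y | y \<in> product_pairs (p + 1) q \<gamma> v \<and> snd z = snd y \<and> fst z facet_of fst y. g y z)" .

  have "cup_product X v p (q + 1) r (coboundary X s) \<gamma> \<omega> =
      (\<Sum>y \<in> product_pairs p (q + 1) \<gamma> v. \<Sum>z | z \<in> N \<and> fst z = fst y \<and> snd z facet_of snd y. h y z)"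
    unfolding cup_product_sum[OF oc2]
  proof (intro sum.cong refl)
    fix y assume "y \<in> product_pairs p (q + 1) \<gamma> v"
    then obtain \<delta> \<kappa>' where y: "y = (\<delta>, \<kappa>')" and yp: "(\<delta>, \<kappa>') \<in> product_pairs p (q + 1) \<gamma> v" by (metis surj_pair)
    have fy: "\<delta> face_of \<gamma>" "\<delta> \<noteq> {}" "aff_dim \<delta> = p" "\<kappa>' face_of \<gamma>" "\<kappa>' \<noteq> {}" "aff_dim \<kappa>' = q + 1"
      using yp pairs_iff[OF \<gamma>(1)] by auto
    have "oriented_cell X (aff_dim \<kappa>') \<kappa>' (snd (?so \<delta> \<kappa>'))"
      using face_cell[OF \<gamma>(1) fy(4,5)] split_orientation[OF \<gamma>(1) \<gamma>2 o yp]
      by (simp add: oriented_cell_def oriented_direct_sum_def)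
    then have "r \<delta> (fst (?so \<delta> \<kappa>')) * coboundary X s \<kappa>' (snd (?so \<delta> \<kappa>')) =
        (\<Sum>\<kappa> | \<kappa> facet_of \<kappa>'. h y (\<delta>, \<kappa>))"
      by (simp add: coboundary_def sum_distrib_left h_def y)
    also have "\<dots> = (\<Sum>z | z \<in> N \<and> fst z = fst y \<and> snd z facet_of snd y. h y z)"
    proof (rule sum.reindex_bij_witness[of _ snd "\<lambda>\<kappa>. (\<delta>, \<kappa>)"], goal_cases)
      case (2 \<kappa>)
      then have "\<kappa> face_of \<gamma>" using face_of_trans fy(4) by (auto simp: facet_of_def)
      then show ?case using 2 fy by (auto simp: N_def y facet_of_def)
    qed (auto simp: y)
    finally show "r (fst y) (fst (?so (fst y) (snd y))) * coboundary X s (snd y) (snd (?so (fst y) (snd y))) =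
        (\<Sum>z | z \<in> N \<and> fst z = fst y \<and> snd z facet_of snd y. h y z)" by (simp add: y)
  qed
  also have "\<dots> = (\<Sum>z\<in>N. \<Sum>y | y \<in> product_pairs p (q + 1) \<gamma> v \<and> fst z = fst y \<and> snd z facet_of snd y. h y z)"
    by (rule sum.swap_restrict[OF finP finN])
  finally have C: "cup_product X v p (q + 1) r (coboundary X s) \<gamma> \<omega> =
     (\<Sum>z\<in>N. \<Sum>y | y \<in> product_pairs p (q + 1) \<gamma> v \<and> fst z = fst y \<and> snd z facet_of snd y. h y z)" .

  have "(\<Sum>\<mu> | \<mu> facet_of \<gamma> \<and> z \<in> product_pairs p q \<mu> v. f \<mu> z) =
      (\<Sum>y | y \<in> product_pairs (p + 1) q \<gamma> v \<and> snd z = snd y \<and> fst z facet_of fst y. g y z) +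
      signed (rotation_sign (nat p) (nat q))
        (\<Sum>y | y \<in> product_pairs p (q + 1) \<gamma> v \<and> fst z = fst y \<and> snd z facet_of snd y. h y z)"
    if "z \<in> N" for z
  proof -
    obtain \<delta> \<kappa> where z: "z = (\<delta>, \<kappa>)" by force
    have f\<delta>: "\<delta> face_of \<gamma>" "\<delta> \<noteq> {}" "aff_dim \<delta> = p" and f\<kappa>: "\<kappa> face_of \<gamma>" "\<kappa> \<noteq> {}" "aff_dim \<kappa> = q"
      using that by (auto simp: N_def z)
    have 1: "(\<Sum>y | y \<in> product_pairs (p + 1) q \<gamma> v \<and> snd z = snd y \<and> fst z facet_of fst y. g y z) =
       (\<Sum>\<delta>' | (\<delta>', \<kappa>) \<in> product_pairs (p + 1) q \<gamma> v \<and> \<delta> facet_of \<delta>'. g (\<delta>', \<kappa>) z)"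
      by (rule sum.reindex_bij_witness[of _ "\<lambda>\<delta>'. (\<delta>', \<kappa>)" fst]) (auto simp: z)
    have 2: "(\<Sum>y | y \<in> product_pairs p (q + 1) \<gamma> v \<and> fst z = fst y \<and> snd z facet_of snd y. h y z) =
       (\<Sum>\<kappa>' | (\<delta>, \<kappa>') \<in> product_pairs p (q + 1) \<gamma> v \<and> \<kappa> facet_of \<kappa>'. h (\<delta>, \<kappa>') z)"
      by (rule sum.reindex_bij_witness[of _ "\<lambda>\<kappa>'. (\<delta>, \<kappa>')" snd]) (auto simp: z)
    show ?thesis
      unfolding 1 2 using pair_cancellation[OF \<gamma> o r s f\<delta> f\<kappa>] by (simp add: f_def g_def h_def z)
  qed
  then show ?thesis
    unfolding A B C signed_sum by (simp add: sum.distrib)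
qed

lemma coboundary_outside:
  assumes "r \<in> cochains X p" "\<not> oriented_cell X (p + 1) \<gamma> \<omega>"
  shows "coboundary X r \<gamma> \<omega> = 0"
proof (cases "oriented_cell X (aff_dim \<gamma>) \<gamma> \<omega>")
  case True
  then have "aff_dim \<gamma> \<noteq> p + 1" using assms(2) by (auto simp: oriented_cell_def)
  then have "r \<delta> (boundary_orientation \<gamma> \<omega> \<delta>) = 0" if "\<delta> facet_of \<gamma>" for \<delta>
    using assms(1) that by (auto simp: cochains_def oriented_cell_def facet_of_def)
  then show ?thesis by (simp add: coboundary_def)
qed (simp add: coboundary_def)

lemma coboundary_cup_product:
  fixes r s :: "('a, 'r::ring) cochain"
  assumes r: "r \<in> cochains X p" and s: "s \<in> closed_cochains X q"
  shows "coboundary X (cup_product X v p q r s) = cup_product X v (p + 1) q (coboundary X r) s"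
proof (intro ext)
  fix \<gamma> \<omega>
  have s': "s \<in> cochains X q" "coboundary X s = 0" using s by (auto simp: closed_cochains_def)
  have z: "cup_product X v p (q + 1) r 0 \<gamma> \<omega> = 0"
    by (simp add: cup_product_def case_prod_unfold Let_def)
  show "coboundary X (cup_product X v p q r s) \<gamma> \<omega> = cup_product X v (p + 1) q (coboundary X r) s \<gamma> \<omega>"
  proof (cases "oriented_cell X (p + q + 1) \<gamma> \<omega>")
    case True
    then show ?thesis using leibniz[OF r s'(1) True] s'(2) z by (simp add: signed_def)
  next
    case False
    then have "\<not> oriented_cell X (p + 1 + q) \<gamma> \<omega>" by (simp add: algebra_simps)
    then show ?thesis
      using coboundary_outside[OF cup_product_cochain[OF r s'(1)] False] by (simp add: cup_product_def)
  qed
qed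

end

text \<open>
  Convenience for all \<open>p\<close>, \<open>q\<close> is used here, since the pair of dimensions to which it is applied
  varies with the cell and the vertex.
\<close>

lemma generic_complex_convenient:
  fixes V :: "'a::euclidean_space set"
  assumes V: "subspace V" and X: "p_complex V X" and cpt: "\<forall>\<gamma>\<in>X. compact \<gamma>" and v: "v \<in> convenient V X"
  obtains v' where "generic_complex X v v'"
proof -
  have "v \<in> dual_space V" using v by (simp add: convenient_def convenient_pq_def)
  then obtain v' where v': "v = inner_functional V v'" by (rule dual_space_representation[OF V])
  have cell: "polytope \<gamma>" "\<gamma> \<noteq> {}" "\<gamma> \<subseteq> V" if "\<gamma> \<in> X" for \<gamma>
  proof -
    have "polyhedron \<gamma>" using X that unfolding p_complex_def by blast
    then show "polytope \<gamma>"
      using cpt that by (simp add: polytope_eq_bounded_polyhedron compact_imp_bounded)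
    show "\<gamma> \<noteq> {}" "\<gamma> \<subseteq> V" using X that unfolding p_complex_def by blast+
  qed
  have res: "restrict_functional (direction \<gamma>) v = inner_functional (direction \<gamma>) v'" if "\<gamma> \<in> X" for \<gamma>
  proof -
    have sub: "direction \<gamma> \<subseteq> V"
      using cell(3)[OF that] by (intro direction_minimal[OF V] subspace_diff[OF V]) blast+
    have "restrict_functional (direction \<gamma>) v x = inner_functional (direction \<gamma>) v' x" for x
      using subsetD[OF sub, of x] unfolding v' restrict_functional_def by simp
    then show ?thesis by (rule ext)
  qed
  have "generic_complex X v v'"
  proof unfold_locales
    fix \<gamma> assume \<gamma>: "\<gamma> \<in> X"
    show "polytope \<gamma>" using cell \<gamma> by blast
    show "generic v' \<gamma>" by (rule convenient_imp_generic[OF v \<gamma> cell(1,2)[OF \<gamma>] res[OF \<gamma>]])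
    fix \<delta> assume "\<delta> face_of \<gamma>" "\<delta> \<noteq> {}"
    then show "\<delta> \<in> X" using X \<gamma> unfolding p_complex_def by blast
  next
    fix \<gamma> \<delta> \<kappa> p q assume \<gamma>: "\<gamma> \<in> X"
    have "translate (restrict_functional (direction \<gamma>) v) (dual_cone \<gamma> \<delta>) \<inter> dual_cone \<gamma> \<kappa> \<noteq> {} \<longleftrightarrow> linked v' \<gamma> \<delta> \<kappa>"
      if "\<delta> face_of \<gamma>" "\<kappa> face_of \<gamma>"
      unfolding res[OF \<gamma>]
      by (rule linked_iff_dual_cones_meet[OF cell(2)[OF \<gamma>] that[THEN face_of_imp_subset]])
    then show "(\<delta>, \<kappa>) \<in> product_pairs p q \<gamma> v \<longleftrightarrow>
      \<delta> face_of \<gamma> \<and> \<delta> \<noteq> {} \<and> aff_dim \<delta> = p \<and> \<kappa> face_of \<gamma> \<and> \<kappa> \<noteq> {} \<and> aff_dim \<kappa> = q \<and> linked v' \<gamma> \<delta> \<kappa>"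
      unfolding product_pairs_def by auto
  qed
  then show thesis by (rule that)
qed

theorem corollary3:
  fixes V :: "'a::euclidean_space set"
    and X :: "'a set set"
    and S :: "bit \<Rightarrow> 'r::ring set"
    and v :: "'a \<Rightarrow> real"
    and p q :: int
    and r s :: "('a, 'r) cochain"
  assumes "subspace V"
    and "p_complex V X"
    and "\<forall>\<gamma>\<in>X. compact \<gamma>"
    and "supercommutative S"
    and "v \<in> convenient V X"
    and "r \<in> closed_cochains X p"
    and "s \<in> closed_cochains X q"
  shows "cup_product X v p q r s \<in> closed_cochains X (p + q) \<and>
    (\<forall>t \<in> cochains X (p - 1). r = coboundary X t \<longrightarrow>
       cup_product X v p q r s = coboundary X (cup_product X v (p - 1) q t s))"
proof -
  obtain v' where "generic_complex X v v'"
    using generic_complex_convenient[OF assms(1-3,5)] .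
  then interpret generic_complex X v v' .
  have r: "r \<in> cochains X p" "coboundary X r = 0" and s: "s \<in> cochains X q"
    using assms(6,7) by (auto simp: closed_cochains_def)
  have "cup_product X v (p + 1) q 0 s = 0"
    by (simp add: cup_product_def case_prod_unfold Let_def fun_eq_iff)
  then have "cup_product X v p q r s \<in> closed_cochains X (p + q)"
    using cup_product_cochain[OF r(1) s] coboundary_cup_product[OF r(1) assms(7)] r(2)
    by (simp add: closed_cochains_def)
  moreover have "cup_product X v p q r s = coboundary X (cup_product X v (p - 1) q t s)"
    if "t \<in> cochains X (p - 1)" "r = coboundary X t" for t
    using coboundary_cup_product[OF that(1) assms(7)] that(2) by simp
  ultimately show ?thesis by blast
qed

end
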